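(* Let $G$ be a (finite, simple, connected) distance-regular graph. Then $G$ is Lichnerowicz sharp if and only if $G$ is isomorphic to one of the following graphs: a cocktail party graph $CP(n)$ with $n\ge 2$, a Hamming graph $H(d,n)$ with $d\ge 1$ and $n\ge 2$, a Johnson graph $J(n,k)$ with $1\le k\le n-1$, a demi-cube $Q^n_{(2)}$ with $n\ge 2$, the Schläfli graph, or the Gosset graph.
   Context: All graphs are finite, simple and connected. For a vertex $x$ of a graph $G=(V,E)$ with degree $\deg(x)$ and $p\in[0,1]$, let $\mu_x^p$ be the probability measure with $\mu_x^p(x)=p$, $\mu_x^p(y)=(1-p)/\deg(x)$ if $xy\in E$, and $0$ otherwise. For probability measures $\mu_1,\mu_2$ on $V$, the Wasserstein distance is $W_1(\mu_1,\mu_2)=\inf_\pi\sum_{x,y}d(x,y)\pi(x,y)$, infimum over couplings $\pi:V\times V\to[0,1]$ with marginals $\mu_1,\mu_2$, where $d$ is the graph distance. The Lin–Lu–Yau curvature of $x,y$ is $\kappa(x,y)=\lim_{p\to1}\kappa_p(x,y)/(1-p)$ where $\kappa_p(x,y)=1-W_1(\mu_x^p,\mu_y^p)/d(x,y)$. The normalized Laplacian is $L=I-D^{-1/2}AD^{-1/2}$ ($A$ adjacency matrix, $D$ diagonal degree matrix), and $\lambda_1$ denotes its smallest nonzero eigenvalue. It is known that $\lambda_1\ge\min_{xy\in E}\kappa(x,y)$; $G$ is called Lichnerowicz sharp if $\lambda_1=\min_{xy\in E}\kappa(x,y)$. A connected graph of diameter $D$ is distance-regular if there are constants $c_i,a_i,b_i$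 ($0\le i\le D$) such that for any vertices $x,y$ at distance $i$, $y$ has exactly $c_i$ neighbours at distance $i-1$ from $x$, $a_i$ at distance $i$, and $b_i$ at distance $i+1$. Graphs: $CP(n)$ is $K_{2n}$ minus a perfect matching; $H(d,n)$ has vertex set the words of length $d$ over an $n$-letter alphabet, adjacent when differing in exactly one coordinate; $J(n,k)$ has vertex set the $k$-subsets of an $n$-set, adjacent when they intersect in $k-1$ elements; $Q^n_{(2)}$ has vertex set the binary vectors of length $n$ of even weight, adjacent when at Hamming distance $2$; the Schläfli graph is the unique strongly regular graph with parameters $(27,16,10,8)$; the Gosset graph is the unique distance-regular graph with intersection array $\{27,10,1;1,10,27\}$ (the 1-skeleton of the $3_{21}$ polytope, 56 vertices). *)

theory Defs
  imports Complex_Main "Graph_Theory.Graph_Theory" "HOL-Combinatorics.Permutations"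
begin

text \<open>
  Finite simple graphs are modelled by the locale \<^locale>\<open>pair_graph\<close>: finite, loop-free digraphs with
  a symmetric arc relation, so that an undirected edge is a pair of opposite arcs.
\<close>

section \<open>Distance and distance-regularity\<close>

definition neighbours :: "'a pair_pre_digraph \<Rightarrow> 'a \<Rightarrow> 'a set" where
  "neighbours G x = {y. (x, y) \<in> parcs G}"

definition deg :: "'a pair_pre_digraph \<Rightarrow> 'a \<Rightarrow> nat" where
  "deg G x = card (neighbours G x)"

definition gdist :: "'a pair_pre_digraph \<Rightarrow> 'a \<Rightarrow> 'a \<Rightarrow> nat" where
  "gdist G x y = (LEAST n. \<exists>p. pre_digraph.awalk (with_proj G) x p y \<and> length p = n)"

definition gdiameter :: "'a pair_pre_digraph \<Rightarrow> nat" where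
  "gdiameter G = Max {gdist G x y | x y. x \<in> pverts G \<and> y \<in> pverts G}"

text \<open>
  The condition \<open>gdist G x z + 1 = i\<close> instead of \<open>gdist G x z = i - 1\<close> avoids truncated subtraction
  and gives \<open>c 0 = 0\<close>.
\<close>

definition intersection_numbers ::
  "'a pair_pre_digraph \<Rightarrow> (nat \<Rightarrow> nat) \<Rightarrow> (nat \<Rightarrow> nat) \<Rightarrow> (nat \<Rightarrow> nat) \<Rightarrow> bool" where
  "intersection_numbers G c a b \<longleftrightarrow>
     (\<forall>i\<le>gdiameter G. \<forall>x\<in>pverts G. \<forall>y\<in>pverts G. gdist G x y = i \<longrightarrow>
        card {z \<in> neighbours G y. gdist G x z + 1 = i} = c i \<and>
        card {z \<in> neighbours G y. gdist G x z = i} = a i \<and>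
        card {z \<in> neighbours G y. gdist G x z = i + 1} = b i)"

definition distance_regular :: "'a pair_pre_digraph \<Rightarrow> bool" where
  "distance_regular G \<longleftrightarrow>
     Digraph_Component.connected (with_proj G) \<and> (\<exists>c a b. intersection_numbers G c a b)"

section \<open>Lin--Lu--Yau curvature\<close>

definition lazy_walk_measure :: "'a pair_pre_digraph \<Rightarrow> real \<Rightarrow> 'a \<Rightarrow> 'a \<Rightarrow> real" where
  "lazy_walk_measure G p x y =
     (if y = x then p else if (x, y) \<in> parcs G then (1 - p) / real (deg G x) else 0)"

definition coupling ::
  "'a pair_pre_digraph \<Rightarrow> ('a \<Rightarrow> real) \<Rightarrow> ('a \<Rightarrow> real) \<Rightarrow> ('a \<Rightarrow> 'a \<Rightarrow> real) \<Rightarrow> bool" where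
  "coupling G \<mu>1 \<mu>2 \<pi> \<longleftrightarrow>
     (\<forall>x\<in>pverts G. \<forall>y\<in>pverts G. 0 \<le> \<pi> x y \<and> \<pi> x y \<le> 1) \<and>
     (\<forall>x\<in>pverts G. (\<Sum>y\<in>pverts G. \<pi> x y) = \<mu>1 x) \<and>
     (\<forall>y\<in>pverts G. (\<Sum>x\<in>pverts G. \<pi> x y) = \<mu>2 y)"

definition wasserstein :: "'a pair_pre_digraph \<Rightarrow> ('a \<Rightarrow> real) \<Rightarrow> ('a \<Rightarrow> real) \<Rightarrow> real" where
  "wasserstein G \<mu>1 \<mu>2 =
     (INF \<pi>\<in>{\<pi>. coupling G \<mu>1 \<mu>2 \<pi>}. \<Sum>x\<in>pverts G. \<Sum>y\<in>pverts G. real (gdist G x y) * \<pi> x y)"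

definition lazy_curvature :: "'a pair_pre_digraph \<Rightarrow> real \<Rightarrow> 'a \<Rightarrow> 'a \<Rightarrow> real" where
  "lazy_curvature G p x y =
     1 - wasserstein G (lazy_walk_measure G p x) (lazy_walk_measure G p y) / real (gdist G x y)"

text \<open>The idleness \<open>p\<close> ranges over \<open>[0,1]\<close>, so the limit at \<open>1\<close> is the left-hand limit.\<close>

definition lly_curvature :: "'a pair_pre_digraph \<Rightarrow> 'a \<Rightarrow> 'a \<Rightarrow> real" where
  "lly_curvature G x y = Lim (at_left 1) (\<lambda>p. lazy_curvature G p x y / (1 - p))"

section \<open>The normalized Laplacian and Lichnerowicz sharpness\<close>

definition adjacency :: "'a pair_pre_digraph \<Rightarrow> 'a \<Rightarrow> 'a \<Rightarrow> real" where
  "adjacency G x y = (if (x, y) \<in> parcs G then 1 else 0)"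

definition normalized_laplacian :: "'a pair_pre_digraph \<Rightarrow> 'a \<Rightarrow> 'a \<Rightarrow> real" where
  "normalized_laplacian G x y =
     (if x = y then 1 else 0) - real (deg G x) powr (-1/2) * adjacency G x y * real (deg G y) powr (-1/2)"

text \<open>Matrices are functions of two indices, of which only the values on \<open>V \<times> V\<close> matter.\<close>

definition matrix_eigenvalue_on :: "'a set \<Rightarrow> ('a \<Rightarrow> 'a \<Rightarrow> real) \<Rightarrow> real \<Rightarrow> bool" where
  "matrix_eigenvalue_on V M l \<longleftrightarrow>
     (\<exists>f. (\<exists>x\<in>V. f x \<noteq> 0) \<and> (\<forall>x\<in>V. (\<Sum>y\<in>V. M x y * f y) = l * f x))"

definition lambda1 :: "'a pair_pre_digraph \<Rightarrow> real" where
  "lambda1 G = Min {l. matrix_eigenvalue_on (pverts G) (normalized_laplacian G) l \<and> l \<noteq> 0}"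

text \<open>
  For the one-vertex graph neither side of the equation exists (there is no edge, and the degree
  matrix is not invertible); the guard \<open>parcs G \<noteq> {}\<close> makes it not sharp.
\<close>

definition lichnerowicz_sharp :: "'a pair_pre_digraph \<Rightarrow> bool" where
  "lichnerowicz_sharp G \<longleftrightarrow>
     parcs G \<noteq> {} \<and> lambda1 G = Min {lly_curvature G x y | x y. (x, y) \<in> parcs G}"

section \<open>The graphs of the classification\<close>

definition graph_on :: "'a set \<Rightarrow> ('a \<Rightarrow> 'a \<Rightarrow> bool) \<Rightarrow> 'a pair_pre_digraph" where
  "graph_on V adj = \<lparr>pverts = V, parcs = {(x, y). x \<in> V \<and> y \<in> V \<and> adj x y}\<rparr>"

text \<open>The perfect matching removed from the complete graph is \<open>{{2i, 2i+1} | i < n}\<close>.\<close>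

definition cocktail_party_graph :: "nat \<Rightarrow> nat pair_pre_digraph" where
  "cocktail_party_graph n = graph_on {..<2 * n} (\<lambda>x y. x \<noteq> y \<and> x div 2 \<noteq> y div 2)"

definition hamming_distance :: "'a list \<Rightarrow> 'a list \<Rightarrow> nat" where
  "hamming_distance v w = card {i. i < length v \<and> v ! i \<noteq> w ! i}"

definition hamming_graph :: "nat \<Rightarrow> nat \<Rightarrow> nat list pair_pre_digraph" where
  "hamming_graph d n =
     graph_on {w. length w = d \<and> set w \<subseteq> {..<n}} (\<lambda>v w. hamming_distance v w = 1)"

definition johnson_graph :: "nat \<Rightarrow> nat \<Rightarrow> nat set pair_pre_digraph" where
  "johnson_graph n k =
     graph_on {S. S \<subseteq> {..<n} \<and> card S = k} (\<lambda>S T. card (S \<inter> T) + 1 = k)"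

definition demicube_graph :: "nat \<Rightarrow> bool list pair_pre_digraph" where
  "demicube_graph n =
     graph_on {w. length w = n \<and> even (count_list w True)} (\<lambda>v w. hamming_distance v w = 2)"

text \<open>
  The vertices of the polytope \<open>3\<^sub>2\<^sub>1\<close> are the 56 vectors obtained from \<open>\<plusminus>(3,3,-1,-1,-1,-1,-1,-1)\<close> by
  permuting coordinates; two of them span an edge iff their inner product is 8. Below, \<open>(s, S)\<close> is the
  vector with sign \<open>s\<close> and entries \<open>\<plusminus>3\<close> at the two positions in \<open>S\<close>. That this graph has the intersection
  array \<open>{27,10,1; 1,10,27}\<close>, which determines it up to isomorphism, is proved below.
\<close>

definition gosset_graph :: "(bool \<times> nat set) pair_pre_digraph" where
  "gosset_graph = graph_on {(s, S). S \<subseteq> {..<8} \<and> card S = 2}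
     (\<lambda>(s, S) (t, T). if s = t then card (S \<inter> T) = 1 else S \<inter> T = {})"

text \<open>
  The 27 lines on a smooth cubic surface in the classical notation \<open>a\<^sub>i\<close>, \<open>b\<^sub>i\<close>, \<open>c\<^sub>i\<^sub>j\<close> (\<open>i \<noteq> j\<close>, six
  indices), adjacent when they are skew. That this graph is strongly regular with parameters
  \<open>(27,16,10,8)\<close>, which determine it up to isomorphism, is proved below.
\<close>

datatype cubic_line = LineA nat | LineB nat | LineC "nat set"

fun skew_lines :: "cubic_line \<Rightarrow> cubic_line \<Rightarrow> bool" where
  "skew_lines (LineA i) (LineA j) \<longleftrightarrow> i \<noteq> j"
| "skew_lines (LineB i) (LineB j) \<longleftrightarrow> i \<noteq> j"
| "skew_lines (LineA i) (LineB j) \<longleftrightarrow> i = j"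
| "skew_lines (LineB i) (LineA j) \<longleftrightarrow> i = j"
| "skew_lines (LineA i) (LineC S) \<longleftrightarrow> i \<notin> S"
| "skew_lines (LineB i) (LineC S) \<longleftrightarrow> i \<notin> S"
| "skew_lines (LineC S) (LineA i) \<longleftrightarrow> i \<notin> S"
| "skew_lines (LineC S) (LineB i) \<longleftrightarrow> i \<notin> S"
| "skew_lines (LineC S) (LineC T) \<longleftrightarrow> card (S \<inter> T) = 1"

definition schlaefli_graph :: "cubic_line pair_pre_digraph" where
  "schlaefli_graph =
     graph_on (LineA ` {..<6} \<union> LineB ` {..<6} \<union> LineC ` {S. S \<subseteq> {..<6} \<and> card S = 2}) skew_lines"

section \<open>Parameters of the two sporadic graphs\<close>

lemma gdist_eqI:
  assumes "pair_graph G"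
    and D0: "\<And>x. x \<in> pverts G \<Longrightarrow> D x x = 0"
      "\<And>x y. x \<in> pverts G \<Longrightarrow> y \<in> pverts G \<Longrightarrow> D x y = 0 \<Longrightarrow> x = y"
    and Dle: "\<And>x y z. x \<in> pverts G \<Longrightarrow> (y, z) \<in> parcs G \<Longrightarrow> D x z \<le> Suc (D x y)"
    and DSuc: "\<And>x y n. x \<in> pverts G \<Longrightarrow> y \<in> pverts G \<Longrightarrow> D x y = Suc n \<Longrightarrow>
                 \<exists>z. (z, y) \<in> parcs G \<and> D x z = n"
    and x: "x \<in> pverts G" and y: "y \<in> pverts G"
  shows "gdist G x y = D x y"
    and "\<exists>p. pre_digraph.awalk (with_proj G) x p y"
proof -
  interpret pair_graph G by fact
  have le: "D x y \<le> length p" if "awalk x p y" for p y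
    using that
  proof (induction p arbitrary: y rule: rev_induct)
    case Nil
    then show ?case using D0(1) by (auto simp: awalk_Nil_iff)
  next
    case (snoc e p)
    from snoc.prems obtain w where w: "awalk x p w" "awalk w [e] y"
      by (auto simp: awalk_append_iff)
    then have "(w, y) \<in> parcs G"
      by (cases e) (auto simp: awalk_def)
    with Dle[OF x] snoc.IH[OF w(1)] show ?case by fastforce
  qed
  have ex: "\<exists>p. awalk x p y \<and> length p = n" if "y \<in> pverts G" "D x y = n" for n y
    using that
  proof (induction n arbitrary: y)
    case 0
    then show ?case using D0(2)[OF x] x by (auto simp: awalk_Nil_iff)
  next
    case (Suc n)
    from DSuc[OF x Suc.prems] obtain z where z: "(z, y) \<in> parcs G" "D x z = n" by auto
    then have "z \<in> pverts G" using in_arcsD1 by blast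
    from Suc.IH[OF this z(2)] obtain p where p: "awalk x p z" "length p = n" by auto
    moreover have "awalk z [(z, y)] y"
      using z(1) in_arcsD1 by (auto simp: awalk_def)
    ultimately have "awalk x (p @ [(z, y)]) y" by (rule_tac awalk_appendI)
    then show ?case using p(2) by (intro exI[of _ "p @ [(z, y)]"]) auto
  qed
  show "gdist G x y = D x y"
    unfolding gdist_def using ex[OF y refl] le by (intro Least_equality) auto
  show "\<exists>p. awalk x p y" using ex[OF y refl] by auto
qed

lemma pair_graph_graph_on:
  assumes "finite V"
    and "\<And>x. x \<in> V \<Longrightarrow> \<not> adj x x"
    and "\<And>x y. x \<in> V \<Longrightarrow> y \<in> V \<Longrightarrow> adj x y \<Longrightarrow> adj y x"
  shows "pair_graph (graph_on V adj)"
proof -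
  have "finite {(x, y). x \<in> V \<and> y \<in> V \<and> adj x y}"
    by (rule finite_subset[of _ "V \<times> V"]) (use assms(1) in auto)
  moreover have "sym {(x, y). x \<in> V \<and> y \<in> V \<and> adj x y}"
    by (rule symI) (use assms(3) in blast)
  ultimately show ?thesis
    using assms(1,2) by unfold_locales (auto simp: graph_on_def Digraph.symmetric_def)
qed

lemma card_filter_list:
  assumes "V = f ` set xs" "inj_on f (set xs)" "distinct xs"
  shows "card {z \<in> V. P z} = length (filter (P \<circ> f) xs)"
proof -
  have "{z \<in> V. P z} = f ` {x \<in> set xs. P (f x)}" using assms(1) by auto
  also have "card \<dots> = card {x \<in> set xs. P (f x)}"
    by (rule card_image) (use assms(2) in \<open>auto simp: inj_on_def\<close>)
  also have "\<dots> = length (filter (P \<circ> f) xs)"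
    using assms(3) by (metis (mono_tags, lifting) Collect_cong comp_apply distinct_card distinct_filter set_filter)
  finally show ?thesis .
qed

definition pair_list :: "nat \<Rightarrow> (nat \<times> nat) list" where
  "pair_list n = concat (map (\<lambda>i. map (Pair i) [Suc i..<n]) [0..<n])"

lemma set_pair_list: "set (pair_list n) = {(i, j). i < j \<and> j < n}"
  by (auto simp: pair_list_def image_iff)

lemma two_subsets: "{S. S \<subseteq> {..<n} \<and> card S = 2} = (\<lambda>(i, j). {i, j}) ` set (pair_list n)"
proof
  show "{S. S \<subseteq> {..<n} \<and> card S = 2} \<subseteq> (\<lambda>(i, j). {i, j}) ` set (pair_list n)"
  proof
    fix S assume "S \<in> {S. S \<subseteq> {..<n} \<and> card S = 2}"
    then obtain i j where S: "S = {i, j}" "i \<noteq> j" "i < n" "j < n"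
      by (auto simp: card_2_iff)
    then have "S = {min i j, max i j}" "min i j < max i j" "max i j < n" by (auto simp: min_def max_def)
    then show "S \<in> (\<lambda>(i, j). {i, j}) ` set (pair_list n)"
      unfolding set_pair_list by blast
  qed
qed (auto simp: set_pair_list)

lemma inj_pair_list: "inj_on (\<lambda>(i, j). {i, j}) (set (pair_list n))"
  by (auto simp: inj_on_def set_pair_list doubleton_eq_iff)

subsection \<open>The Schlaefli graph is strongly regular with parameters (27,16,10,8)\<close>

definition schlaefli_list :: "cubic_line list" where
  "schlaefli_list = map LineA [0..<6] @ map LineB [0..<6] @ map (\<lambda>(i, j). LineC {i, j}) (pair_list 6)"

definition schlaefli_check :: "cubic_line \<Rightarrow> cubic_line list \<Rightarrow> cubic_line \<Rightarrow> bool" where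
  "schlaefli_check x zs y \<longleftrightarrow>
     length (filter (skew_lines y) zs) = (if x = y then 16 else if skew_lines x y then 10 else 8)"

definition schlaefli_checks :: "cubic_line \<Rightarrow> bool" where
  "schlaefli_checks x \<longleftrightarrow> list_all (schlaefli_check x (filter (skew_lines x) schlaefli_list)) schlaefli_list"

lemma schlaefli_checks: "list_all schlaefli_checks schlaefli_list"
  by code_simp

lemma pverts_schlaefli: "pverts schlaefli_graph = set schlaefli_list"
  unfolding schlaefli_graph_def schlaefli_list_def graph_on_def two_subsets
  by (auto simp: image_iff split: prod.splits)

lemma distinct_schlaefli_list: "distinct schlaefli_list"
  by code_simp

lemma skew_lines_sym: "skew_lines x y \<Longrightarrow> skew_lines y x"
  by (cases x; cases y) (auto simp: Int_commute)

lemma pair_graph_schlaefli: "pair_graph schlaefli_graph"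
  unfolding schlaefli_graph_def
  by (rule pair_graph_graph_on) (auto intro: skew_lines_sym)

lemma schlaefli_strongly_regular:
  shows "card (pverts schlaefli_graph) = 27"
    and "x \<in> pverts schlaefli_graph \<Longrightarrow> deg schlaefli_graph x = 16"
    and "x \<in> pverts schlaefli_graph \<Longrightarrow> y \<in> pverts schlaefli_graph \<Longrightarrow> x \<noteq> y \<Longrightarrow>
           card (neighbours schlaefli_graph x \<inter> neighbours schlaefli_graph y) =
             (if (x, y) \<in> parcs schlaefli_graph then 10 else 8)"
proof -
  have "length schlaefli_list = 27" by code_simp
  then show "card (pverts schlaefli_graph) = 27"
    by (simp add: pverts_schlaefli distinct_card[OF distinct_schlaefli_list])
  have arcs: "(x, y) \<in> parcs schlaefli_graph \<longleftrightarrow>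
      x \<in> set schlaefli_list \<and> y \<in> set schlaefli_list \<and> skew_lines x y" for x y
    unfolding pverts_schlaefli[symmetric] by (simp add: schlaefli_graph_def graph_on_def)
  define common where
    "common x y = length (filter (skew_lines y) (filter (skew_lines x) schlaefli_list))" for x y
  have common: "card (neighbours schlaefli_graph x \<inter> neighbours schlaefli_graph y) = common x y"
    if "x \<in> pverts schlaefli_graph" "y \<in> pverts schlaefli_graph" for x y
  proof -
    have "neighbours schlaefli_graph x \<inter> neighbours schlaefli_graph y =
        {z \<in> set schlaefli_list. skew_lines x z \<and> skew_lines y z}"
      using that by (auto simp: neighbours_def arcs pverts_schlaefli)
    also have "card \<dots> = common x y"
      using card_filter_list[of "set schlaefli_list" id schlaefli_list "\<lambda>z. skew_lines x z \<and> skew_lines y z"]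
        distinct_schlaefli_list
      by (simp add: common_def)
    finally show ?thesis .
  qed
  have check: "common x y = (if x = y then 16 else if skew_lines x y then 10 else 8)"
    if "x \<in> pverts schlaefli_graph" "y \<in> pverts schlaefli_graph" for x y
    using schlaefli_checks that
    by (auto simp: list_all_iff schlaefli_checks_def schlaefli_check_def pverts_schlaefli common_def)
  show "deg schlaefli_graph x = 16" if "x \<in> pverts schlaefli_graph"
    using common[OF that that] check[OF that that] by (simp add: deg_def)
  show "card (neighbours schlaefli_graph x \<inter> neighbours schlaefli_graph y) =
             (if (x, y) \<in> parcs schlaefli_graph then 10 else 8)"
    if "x \<in> pverts schlaefli_graph" "y \<in> pverts schlaefli_graph" "x \<noteq> y"
    using common[OF that(1,2)] check[OF that(1,2)] that arcs by (auto simp: pverts_schlaefli)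
qed

subsection \<open>The Gosset graph has intersection array {27,10,1; 1,10,27}\<close>

fun gosset_dist :: "bool \<times> nat set \<Rightarrow> bool \<times> nat set \<Rightarrow> nat" where
  "gosset_dist (s, S) (t, T) = (if s = t then 2 - card (S \<inter> T) else Suc (card (S \<inter> T)))"

abbreviation (input) gosset_verts :: "(bool \<times> nat set) set" where
  "gosset_verts \<equiv> pverts gosset_graph"

lemma pverts_gosset: "pverts gosset_graph = UNIV \<times> {S. S \<subseteq> {..<8} \<and> card S = 2}"
  by (auto simp: gosset_graph_def graph_on_def)

lemma mem_gosset: "(s, S) \<in> gosset_verts \<longleftrightarrow> S \<subseteq> {..<8} \<and> card S = 2"
  by (simp add: pverts_gosset)

lemma finite_gosset: "finite gosset_verts"
  unfolding pverts_gosset by (rule finite_subset[of _ "UNIV \<times> Pow {..<8}"]) auto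

lemma card_Int_two_subset:
  assumes "card S = 2" "card T = 2"
  shows "card (S \<inter> T) \<le> 2" "card (S \<inter> T) = 2 \<longleftrightarrow> S = T"
proof -
  have fin: "finite S" "finite T" using assms card.infinite by fastforce+
  show "card (S \<inter> T) \<le> 2" using card_mono[of S "S \<inter> T"] fin assms by auto
  show "card (S \<inter> T) = 2 \<longleftrightarrow> S = T"
    using card_subset_eq[of S "S \<inter> T"] card_subset_eq[of T "S \<inter> T"] fin assms by auto
qed

lemma parcs_gosset:
  "(x, y) \<in> parcs gosset_graph \<longleftrightarrow> x \<in> gosset_verts \<and> y \<in> gosset_verts \<and> gosset_dist x y = 1"
proof (cases x; cases y)
  fix s S t T assume xy: "x = (s, S)" "y = (t, T)"
  have "finite S" if "card S = 2" using that card.infinite by fastforce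
  then show ?thesis
    using xy by (auto simp: mem_gosset) (auto simp: gosset_graph_def graph_on_def split: if_splits)
qed

lemma gosset_dist_commute: "gosset_dist x y = gosset_dist y x"
  by (cases x; cases y) (auto simp: Int_commute)

lemma gosset_dist_le: "x \<in> gosset_verts \<Longrightarrow> y \<in> gosset_verts \<Longrightarrow> gosset_dist x y \<le> 3"
  using card_Int_two_subset(1)[of "snd x" "snd y"] by (cases x; cases y) (auto simp: mem_gosset)

lemma gosset_dist_eq_0: "x \<in> gosset_verts \<Longrightarrow> y \<in> gosset_verts \<Longrightarrow> gosset_dist x y = 0 \<longleftrightarrow> x = y"
  using card_Int_two_subset[of "snd x" "snd y"] by (cases x; cases y) (auto simp: mem_gosset)

lemma pair_graph_gosset: "pair_graph gosset_graph"
  unfolding gosset_graph_def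
proof (rule pair_graph_graph_on)
  show "finite {(s :: bool, S). S \<subseteq> {..<8::nat} \<and> card S = 2}"
    using finite_gosset by (simp add: gosset_graph_def graph_on_def)
qed (auto simp: Int_commute split: if_splits)

definition gosset_list :: "(bool \<times> nat \<times> nat) list" where
  "gosset_list = map (Pair True) (pair_list 8) @ map (Pair False) (pair_list 8)"

fun gosset_decode :: "bool \<times> nat \<times> nat \<Rightarrow> bool \<times> nat set" where
  "gosset_decode (s, i, j) = (s, {i, j})"

fun overlap :: "nat \<times> nat \<Rightarrow> nat \<times> nat \<Rightarrow> nat" where
  "overlap (i, j) (k, l) = (if i = k \<or> i = l then if j = k \<or> j = l then 2 else 1
                            else if j = k \<or> j = l then 1 else 0)"

fun gosset_list_dist :: "bool \<times> nat \<times> nat \<Rightarrow> bool \<times> nat \<times> nat \<Rightarrow> nat" where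
  "gosset_list_dist (s, p) (t, q) = (if s = t then 2 - overlap p q else Suc (overlap p q))"

lemma gosset_verts_list: "gosset_verts = gosset_decode ` set gosset_list"
proof -
  have dec: "gosset_decode = map_prod id (\<lambda>(i, j). {i, j})" by (auto simp: fun_eq_iff)
  have "set gosset_list = UNIV \<times> set (pair_list 8)"
    by (auto simp: gosset_list_def UNIV_bool)
  then show ?thesis
    unfolding pverts_gosset two_subsets dec by (simp add: map_prod_surj_on image_id)
qed

lemma inj_gosset_decode: "inj_on gosset_decode (set gosset_list)"
  by (auto simp: inj_on_def gosset_list_def set_pair_list doubleton_eq_iff)

lemma distinct_gosset_list: "distinct gosset_list"
  by code_simp

lemma gosset_dist_decode:
  assumes "x \<in> set gosset_list" "y \<in> set gosset_list"
  shows "gosset_dist (gosset_decode x) (gosset_decode y) = gosset_list_dist x y"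
  using assms by (auto simp: gosset_list_def set_pair_list Int_insert_left)

definition gosset_check :: "nat \<Rightarrow> nat list \<Rightarrow> bool" where
  "gosset_check i ds \<longleftrightarrow> list_all (\<lambda>d. d \<le> Suc i) ds \<and>
     count_list (map Suc ds) i = [0, 1, 10, 27] ! i \<and>
     count_list ds i = [0, 16, 16, 0] ! i \<and>
     count_list ds (Suc i) = [27, 10, 1, 0] ! i"

definition gosset_adj_list :: "bool \<times> nat \<times> nat \<Rightarrow> bool \<times> nat \<times> nat \<Rightarrow> bool" where
  "gosset_adj_list x y \<longleftrightarrow> gosset_list_dist x y = 1"

definition gosset_checks :: "bool \<times> nat \<times> nat \<Rightarrow> bool \<times> nat \<times> nat \<Rightarrow> bool" where
  "gosset_checks x y \<longleftrightarrow>
     gosset_check (gosset_list_dist x y) (map (gosset_list_dist x) (filter (gosset_adj_list y) gosset_list))"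

lemma gosset_checks: "list_all (gosset_checks (True, 0, 1)) gosset_list"
  by code_simp

definition gosset_counts :: "bool \<times> nat set \<Rightarrow> bool \<times> nat set \<Rightarrow> bool" where
  "gosset_counts x y \<longleftrightarrow>
     (\<forall>z\<in>gosset_verts. gosset_dist y z = 1 \<longrightarrow> gosset_dist x z \<le> Suc (gosset_dist x y)) \<and>
     card {z \<in> gosset_verts. gosset_dist y z = 1 \<and> Suc (gosset_dist x z) = gosset_dist x y} =
       [0, 1, 10, 27] ! gosset_dist x y \<and>
     card {z \<in> gosset_verts. gosset_dist y z = 1 \<and> gosset_dist x z = gosset_dist x y} =
       [0, 16, 16, 0] ! gosset_dist x y \<and>
     card {z \<in> gosset_verts. gosset_dist y z = 1 \<and> gosset_dist x z = Suc (gosset_dist x y)} =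
       [27, 10, 1, 0] ! gosset_dist x y"

lemma gosset_counts_base:
  assumes "y \<in> gosset_verts"
  shows "gosset_counts (True, {0, 1}) y"
proof -
  define x :: "bool \<times> nat \<times> nat" where "x = (True, 0, 1)"
  have x: "x \<in> set gosset_list" by (auto simp: x_def gosset_list_def set_pair_list)
  obtain y' where y': "y' \<in> set gosset_list" "y = gosset_decode y'"
    using assms gosset_verts_list by auto
  have count: "card {z \<in> gosset_verts. gosset_dist y z = 1 \<and> P (gosset_dist (gosset_decode x) z)} =
      length (filter P (map (gosset_list_dist x) (filter (gosset_adj_list y') gosset_list)))" for P
  proof -
    have "card {z \<in> gosset_verts. gosset_dist y z = 1 \<and> P (gosset_dist (gosset_decode x) z)} =
        length (filter ((\<lambda>z. gosset_dist y z = 1 \<and> P (gosset_dist (gosset_decode x) z)) \<circ> gosset_decode)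
          gosset_list)"
      by (rule card_filter_list[OF gosset_verts_list inj_gosset_decode distinct_gosset_list])
    also have "filter ((\<lambda>z. gosset_dist y z = 1 \<and> P (gosset_dist (gosset_decode x) z)) \<circ> gosset_decode)
          gosset_list = filter (\<lambda>z. gosset_adj_list y' z \<and> P (gosset_list_dist x z)) gosset_list"
      using x y' by (intro filter_cong) (auto simp: gosset_dist_decode gosset_adj_list_def)
    finally show ?thesis by (simp add: filter_map comp_def conj_commute)
  qed
  have cl: "count_list ds i = length (filter (\<lambda>d. d = i) ds)"
    "count_list (map Suc ds) i = length (filter (\<lambda>d. Suc d = i) ds)" for ds i
    by (induction ds) auto
  have chk: "gosset_checks x y'" using gosset_checks y' by (auto simp: list_all_iff x_def)
  have i: "gosset_dist (gosset_decode x) y = gosset_list_dist x y'"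
    using x y' by (simp add: gosset_dist_decode)
  have "gosset_dist (gosset_decode x) z \<le> Suc (gosset_dist (gosset_decode x) y)"
    if z: "z \<in> gosset_verts" "gosset_dist y z = 1" for z
  proof -
    obtain z' where z': "z' \<in> set gosset_list" "z = gosset_decode z'"
      using z gosset_verts_list by auto
    have "\<forall>z\<in>set gosset_list. gosset_list_dist y' z = 1 \<longrightarrow> gosset_list_dist x z \<le> Suc (gosset_list_dist x y')"
      using chk unfolding gosset_checks_def gosset_check_def list_all_iff gosset_adj_list_def by auto
    with z z' x y' show ?thesis
      by (simp add: gosset_dist_decode)
  qed
  then have "gosset_counts (gosset_decode x) y"
    using chk unfolding gosset_counts_def gosset_checks_def gosset_check_def cl i[symmetric]
    using count[of "\<lambda>d. Suc d = gosset_dist (gosset_decode x) y"]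
      count[of "\<lambda>d. d = gosset_dist (gosset_decode x) y"]
      count[of "\<lambda>d. d = Suc (gosset_dist (gosset_decode x) y)"] by simp
  then show ?thesis by (simp add: x_def)
qed

lemma gosset_counts_iso:
  assumes bij: "bij_betw h gosset_verts gosset_verts"
    and iso: "\<And>x y. x \<in> gosset_verts \<Longrightarrow> y \<in> gosset_verts \<Longrightarrow> gosset_dist (h x) (h y) = gosset_dist x y"
    and x: "x \<in> gosset_verts" and y: "y \<in> gosset_verts"
    and counts: "gosset_counts (h x) (h y)"
  shows "gosset_counts x y"
proof -
  have "card {z \<in> gosset_verts. gosset_dist (h y) z = 1 \<and> P (gosset_dist (h x) z)} =
      card {z \<in> gosset_verts. gosset_dist y z = 1 \<and> P (gosset_dist x z)}" for P
  proof -
    have "{z \<in> gosset_verts. gosset_dist (h y) z = 1 \<and> P (gosset_dist (h x) z)} =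
        {z \<in> h ` gosset_verts. gosset_dist (h y) z = 1 \<and> P (gosset_dist (h x) z)}"
      using bij_betw_imp_surj_on[OF bij] by simp
    also have "\<dots> = h ` {z \<in> gosset_verts. gosset_dist (h y) (h z) = 1 \<and> P (gosset_dist (h x) (h z))}"
      by blast
    also have "{z \<in> gosset_verts. gosset_dist (h y) (h z) = 1 \<and> P (gosset_dist (h x) (h z))} =
        {z \<in> gosset_verts. gosset_dist y z = 1 \<and> P (gosset_dist x z)}"
      using iso x y by (intro Collect_cong) (metis (no_types, lifting))
    also have "card (h ` \<dots>) = card \<dots>"
      by (rule card_image, rule inj_on_subset[OF bij_betw_imp_inj_on[OF bij]]) blast
    finally show ?thesis .
  qed
  note card = this
  have "gosset_dist x z \<le> Suc (gosset_dist x y)" if "z \<in> gosset_verts" "gosset_dist y z = 1" for z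
  proof -
    have "h z \<in> gosset_verts" using bij that(1) by (rule bij_betwE[THEN bspec])
    then show ?thesis using counts iso x y that unfolding gosset_counts_def by metis
  qed
  then show ?thesis
    using counts card[of "\<lambda>d. Suc d = gosset_dist x y"] card[of "\<lambda>d. d = gosset_dist x y"]
      card[of "\<lambda>d. d = Suc (gosset_dist x y)"] iso[OF x y]
    unfolding gosset_counts_def by simp
qed

lemma gosset_counts:
  assumes x: "x \<in> gosset_verts" and y: "y \<in> gosset_verts"
  shows "gosset_counts x y"
proof -
  obtain s i j where ij: "x = (s, {i, j})" "i \<noteq> j" "i < 8" "j < 8"
    using x by (cases x) (auto simp: mem_gosset card_2_iff)
  define f where "f = transpose (transpose i 0 j) 1 \<circ> transpose i (0 :: nat)"
  have f: "f permutes {..<8}"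
    unfolding f_def using ij
    by (intro permutes_compose permutes_swap_id) (auto simp: transpose_def)
  have fij: "f i = 0" "f j = 1"
    using ij by (auto simp: f_def transpose_def)
  define h where "h = (\<lambda>(t :: bool, T). (t = s, f ` T))"
  have inj: "inj f" using f permutes_inj by blast
  have hV: "h z \<in> gosset_verts" if "z \<in> gosset_verts" for z
    using that permutes_in_image[OF f] card_image[OF inj_on_subset[OF inj subset_UNIV]]
    by (cases z) (auto simp: h_def mem_gosset)
  have "inj_on h gosset_verts"
    using inj by (auto simp: inj_on_def h_def inj_image_eq_iff)
  then have "bij_betw h gosset_verts gosset_verts"
    using hV finite_gosset by (intro bij_betw_imageI endo_inj_surj) auto
  moreover have "gosset_dist (h z) (h w) = gosset_dist z w" for z w
    using inj by (cases z; cases w)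
      (auto simp: h_def image_Int[symmetric] card_image inj_on_subset[OF inj subset_UNIV])
  moreover have "gosset_counts (h x) (h y)"
    using gosset_counts_base[OF hV[OF y]] fij ij by (simp add: h_def)
  ultimately show ?thesis using x y gosset_counts_iso by blast
qed

lemma gosset_neighbours:
  "y \<in> gosset_verts \<Longrightarrow> {z \<in> neighbours gosset_graph y. P z} = {z \<in> gosset_verts. gosset_dist y z = 1 \<and> P z}"
  by (auto simp: neighbours_def parcs_gosset)

lemma gosset_walks:
  assumes "x \<in> gosset_verts" "y \<in> gosset_verts"
  shows "gdist gosset_graph x y = gosset_dist x y"
    and "\<exists>p. pre_digraph.awalk (with_proj gosset_graph) x p y"
proof -
  have le: "gosset_dist x z \<le> Suc (gosset_dist x y)"
    if "x \<in> pverts gosset_graph" "(y, z) \<in> parcs gosset_graph" for x y z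
    using that gosset_counts[of x y] unfolding gosset_counts_def parcs_gosset by blast
  have Suc: "\<exists>z. (z, y) \<in> parcs gosset_graph \<and> gosset_dist x z = n"
    if xy: "x \<in> pverts gosset_graph" "y \<in> pverts gosset_graph" "gosset_dist x y = Suc n" for x y n
  proof -
    have "Suc n \<le> 3" using gosset_dist_le[of x y] xy by simp
    then have "n \<in> {0, 1, 2}" by auto
    then have "[0, 1, 10, 27] ! Suc n \<noteq> (0 :: nat)" by auto
    then have "card {z \<in> gosset_verts. gosset_dist y z = 1 \<and> Suc (gosset_dist x z) = gosset_dist x y} \<noteq> 0"
      using gosset_counts[of x y] xy unfolding gosset_counts_def by metis
    then have "{z \<in> gosset_verts. gosset_dist y z = 1 \<and> Suc (gosset_dist x z) = gosset_dist x y} \<noteq> {}"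
      by (metis card.empty)
    then show ?thesis using xy by (auto simp: parcs_gosset gosset_dist_commute[of y])
  qed
  note * = gdist_eqI[of gosset_graph gosset_dist, OF pair_graph_gosset _ _ le Suc]
  show "gdist gosset_graph x y = gosset_dist x y" "\<exists>p. pre_digraph.awalk (with_proj gosset_graph) x p y"
    by (rule *; use assms in \<open>auto simp: gosset_dist_eq_0\<close>)+
qed

lemma connected_gosset: "Digraph_Component.connected (with_proj gosset_graph)"
proof -
  interpret pair_graph gosset_graph by (rule pair_graph_gosset)
  have "(True, {0, 1}) \<in> gosset_verts" by (simp add: mem_gosset)
  moreover have "reachable (with_proj (mk_symmetric (with_proj gosset_graph))) x y"
    if "x \<in> gosset_verts" "y \<in> gosset_verts" for x y
    by (rule reachable_mk_symmetricI) (use gosset_walks(2)[OF that] in \<open>simp add: reachable_awalk\<close>)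
  ultimately show ?thesis
    unfolding Digraph_Component.connected_def strongly_connected_def by auto
qed

lemma gosset_intersection_array:
  shows "gdiameter gosset_graph = 3"
    and "intersection_numbers gosset_graph
           (\<lambda>i. [0, 1, 10, 27] ! i) (\<lambda>i. [0, 16, 16, 0] ! i) (\<lambda>i. [27, 10, 1, 0] ! i)"
proof -
  have V: "(True, {0, 1}) \<in> gosset_verts" "(False, {0, 1}) \<in> gosset_verts" by (simp_all add: mem_gosset)
  have d3: "3 = gdist gosset_graph (True, {0, 1}) (False, {0, 1})"
    using gosset_walks(1)[OF V] by simp
  show "gdiameter gosset_graph = 3"
    unfolding gdiameter_def
  proof (intro Max_eqI)
    show "finite {gdist gosset_graph x y |x y. x \<in> gosset_verts \<and> y \<in> gosset_verts}"
      by (rule finite_image_set2) (simp_all add: finite_gosset)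
    show "n \<le> 3" if "n \<in> {gdist gosset_graph x y |x y. x \<in> gosset_verts \<and> y \<in> gosset_verts}" for n
      using that gosset_walks(1) gosset_dist_le by auto
    show "3 \<in> {gdist gosset_graph x y |x y. x \<in> gosset_verts \<and> y \<in> gosset_verts}"
      using V d3 by blast
  qed
  show "intersection_numbers gosset_graph
           (\<lambda>i. [0, 1, 10, 27] ! i) (\<lambda>i. [0, 16, 16, 0] ! i) (\<lambda>i. [27, 10, 1, 0] ! i)"
    unfolding intersection_numbers_def
  proof (intro allI impI ballI)
    fix i x y assume xy: "x \<in> gosset_verts" "y \<in> gosset_verts" and i: "gdist gosset_graph x y = i"
    have i': "gosset_dist x y = i" using gosset_walks(1)[OF xy] i by simp
    have eq: "{z \<in> neighbours gosset_graph y. P (gdist gosset_graph x z)} =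
        {z \<in> gosset_verts. gosset_dist y z = 1 \<and> P (gosset_dist x z)}" for P
      unfolding gosset_neighbours[OF xy(2)] using gosset_walks(1)[OF xy(1)] by (intro Collect_cong) metis
    show "card {z \<in> neighbours gosset_graph y. gdist gosset_graph x z + 1 = i} = [0, 1, 10, 27] ! i \<and>
        card {z \<in> neighbours gosset_graph y. gdist gosset_graph x z = i} = [0, 16, 16, 0] ! i \<and>
        card {z \<in> neighbours gosset_graph y. gdist gosset_graph x z = i + 1} = [27, 10, 1, 0] ! i"
      using gosset_counts[OF xy] eq[of "\<lambda>d. d + 1 = i"] eq[of "\<lambda>d. d = i"] eq[of "\<lambda>d. d = i + 1"]
      unfolding gosset_counts_def i' by simp
  qed
qed

corollary distance_regular_gosset: "distance_regular gosset_graph"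
  unfolding distance_regular_def using connected_gosset gosset_intersection_array(2) by blast

end

theory Submission
  imports Defs "Jordan_Normal_Form.Spectral_Radius"
begin

text \<open>
  Sharpness makes every vertex a weight of a minuscule representation. Let \<open>\<theta>\<close> be the second largest adjacency
  eigenvalue of a sharp distance-regular graph. The projections of the vertices to its eigenspace lie on a
  sphere, with inner products depending only on the distance. For an edge \<open>xy\<close> the eigenfunction given by the
  inner product with \<open>x - y\<close> has its steepest edge at \<open>xy\<close>, so it is an optimal Kantorovich potential, and the
  transport from \<open>x\<close> to \<open>y\<close> moves mass only along edges that are translates of \<open>xy\<close> (two consecutive such edges
  would put three collinear points on the sphere). Hence every neighbour \<open>z\<close> of \<open>x\<close> outside the closed
  neighbourhood of \<open>y\<close> has a neighbour \<open>z + (y - x)\<close>. It follows that the edge vectors form a simply laced root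
  system, and that the vertex set is invariant under its reflections and has inner products \<open>-1, 0, 1\<close> with it.

  Such a graph is determined by the neighbourhood of one vertex, and this neighbourhood is again of the same
  type, with \<open>c\<^sub>2\<close> lowered by two. Descending along \<open>c\<^sub>2\<close> leads from disjoint cliques (Hamming graphs) through
  grids (Johnson graphs) to demicubes, the Schlaefli graph, the Gosset graph, and cocktail party graphs.
  Conversely, on a graph of this type the roots are eigenfunctions, and the translations are transport plans,
  that realise the common value \<open>(2 + a\<^sub>1) / k\<close> of the curvature and of the first eigenvalue.
\<close>

text \<open>No root system or reflection group is ever built. Vectors are visible only through the
  kernel \<open>D\<close>, and the axioms fix \<open>D\<close> only for adjacent vertices and at
  distance two. The obstacle is to gain global control from this local data. The trichotomy
  \<open>tri\<close> is carried along edges to every vertex, and it shows that \<open>D\<close> is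
  the graph distance. From then on \<open>D = 1\<close> means adjacency, parallelograms stay inside
  neighbourhoods, and graph isomorphisms preserve \<open>D\<close>. In the descent, the two lost
  common neighbours of y and z are x itself and the opposite corner y + z - x of the parallelogram;
  all others are adjacent to x. What keeps the list short is that \<open>D \<le> 2\<close> holds on
  every neighbourhood, so most graphs of one level cannot occur as local graphs of the next. For c2
  = 2 the descent has no lower level: local graphs may be disconnected there, and they are treated
  directly. The value (2 + a1) / k counts what a translation leaves in place: the closed
  neighbourhoods of adjacent x and y have k + 1 vertices each, share a1 + 2 of them, and the other k
  - 1 - a1 vertices move by one step.\<close>

definition iso_on :: "'a set \<Rightarrow> ('a \<Rightarrow> 'a \<Rightarrow> bool) \<Rightarrow> 'b set \<Rightarrow> ('b \<Rightarrow> 'b \<Rightarrow> bool) \<Rightarrow> bool" where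
  "iso_on V A W B \<longleftrightarrow> (\<exists>\<phi>. bij_betw \<phi> V W \<and> (\<forall>x\<in>V. \<forall>y\<in>V. A x y \<longleftrightarrow> B (\<phi> x) (\<phi> y)))"

lemma iso_onI:
  "bij_betw \<phi> V W \<Longrightarrow> (\<And>x y. x \<in> V \<Longrightarrow> y \<in> V \<Longrightarrow> A x y \<longleftrightarrow> B (\<phi> x) (\<phi> y)) \<Longrightarrow> iso_on V A W B"
  unfolding iso_on_def by blast

lemma iso_on_sym: "iso_on V A W B \<Longrightarrow> iso_on W B V A"
proof -
  assume "iso_on V A W B"
  then obtain f where f: "bij_betw f V W" "\<And>x y. x \<in> V \<Longrightarrow> y \<in> V \<Longrightarrow> A x y \<longleftrightarrow> B (f x) (f y)"
    unfolding iso_on_def by blast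
  show ?thesis
  proof (rule iso_onI)
    show "bij_betw (inv_into V f) W V" using f(1) by (rule bij_betw_inv_into)
    fix x y assume "x \<in> W" "y \<in> W"
    then have "inv_into V f x \<in> V" "inv_into V f y \<in> V" "f (inv_into V f x) = x" "f (inv_into V f y) = y"
      using bij_betwE[OF bij_betw_inv_into[OF f(1)]] bij_betw_inv_into_right[OF f(1)] by auto
    then show "B x y \<longleftrightarrow> A (inv_into V f x) (inv_into V f y)"
      using f(2)[of "inv_into V f x" "inv_into V f y"] by simp
  qed
qed

lemma iso_on_trans:
  assumes "iso_on V A W B" "iso_on W B U C" shows "iso_on V A U C"
proof -
  obtain f where f: "bij_betw f V W" "\<forall>x\<in>V. \<forall>y\<in>V. A x y \<longleftrightarrow> B (f x) (f y)"
    using assms(1) unfolding iso_on_def by blast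
  obtain g where g: "bij_betw g W U" "\<forall>x\<in>W. \<forall>y\<in>W. B x y \<longleftrightarrow> C (g x) (g y)"
    using assms(2) unfolding iso_on_def by blast
  show ?thesis
  proof (rule iso_onI)
    show "bij_betw (g \<circ> f) V U" using f(1) g(1) by (rule bij_betw_trans)
    fix x y assume "x \<in> V" "y \<in> V"
    then show "A x y \<longleftrightarrow> C ((g \<circ> f) x) ((g \<circ> f) y)"
      using f g bij_betwE[OF f(1)] by simp
  qed
qed

text \<open>
  \<open>D x y\<close> is half the squared Euclidean distance of two weights in a minuscule Weyl orbit, so
  \<open>D s w - D s z = D s y - D s x\<close> for all \<open>s\<close> says that the vectors \<open>w - z\<close> and \<open>y - x\<close> agree.
\<close>

locale minuscule =
  fixes V :: "'a set" and A :: "'a \<Rightarrow> 'a \<Rightarrow> bool" and D :: "'a \<Rightarrow> 'a \<Rightarrow> real"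
  assumes finite_V: "finite V"
    and A_V: "A x y \<Longrightarrow> x \<in> V"
    and A_sym: "A x y \<Longrightarrow> A y x"
    and A_irrefl: "\<not> A x x"
    and A_conn: "x \<in> V \<Longrightarrow> y \<in> V \<Longrightarrow> A\<^sup>*\<^sup>* x y"
    and D_self: "x \<in> V \<Longrightarrow> D x x = 0"
    and D_sym: "x \<in> V \<Longrightarrow> y \<in> V \<Longrightarrow> D x y = D y x"
    and D_adj: "A x y \<Longrightarrow> D x y = 1"
    and D_two: "A x y \<Longrightarrow> A y z \<Longrightarrow> x \<noteq> z \<Longrightarrow> \<not> A x z \<Longrightarrow> D x z = 2"
    and parallelogram: "A x y \<Longrightarrow> A x z \<Longrightarrow> z \<noteq> y \<Longrightarrow> \<not> A y z \<Longrightarrow>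
      \<exists>w. A y w \<and> A z w \<and> (\<forall>s\<in>V. D s w - D s z = D s y - D s x)"
begin

lemma A_V2: "A x y \<Longrightarrow> y \<in> V" using A_sym A_V by blast

lemma V_induct [consumes 2, case_names base step]:
  assumes "x \<in> V" "y \<in> V" "P x" "\<And>y z. y \<in> V \<Longrightarrow> P y \<Longrightarrow> A y z \<Longrightarrow> P z"
  shows "P y"
proof -
  have "A\<^sup>*\<^sup>* x y" using A_conn assms by blast
  then have "P y \<and> y \<in> V"
    by (induction rule: rtranclp_induct) (use assms A_V2 in blast)+
  then show ?thesis by blast
qed

section \<open>Parallel arcs and the values of a root\<close>

definition par :: "'a \<Rightarrow> 'a \<Rightarrow> 'a \<Rightarrow> 'a \<Rightarrow> bool" where
  "par x y z w \<longleftrightarrow> (\<forall>s\<in>V. D s w - D s z = D s y - D s x)"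

lemma parD: "par x y z w \<Longrightarrow> s \<in> V \<Longrightarrow> D s w - D s z = D s y - D s x"
  unfolding par_def by blast

lemma par_refl: "par x y x y" unfolding par_def by simp
lemma par_sym: "par x y z w \<Longrightarrow> par z w x y" unfolding par_def by simp
lemma par_swap: "par x y z w \<Longrightarrow> par y x w z" unfolding par_def by (simp add: algebra_simps)
lemma par_shift: "par x y z w \<Longrightarrow> par x z y w" unfolding par_def by (simp add: algebra_simps)
lemma par_trans: "par x y z w \<Longrightarrow> par z w u v \<Longrightarrow> par x y u v" unfolding par_def by simp

text \<open>With a common neighbour, two vertices are in the only range where the axioms give
  \<open>D\<close>. Before \<open>D_eq_gd\<close>, adjacency can be read off the kernel only
  here.\<close>

lemma D_near:
  assumes "A t x" "A t y"
  shows "D x y = (if x = y then 0 else if A x y then 1 else 2)"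
  using assms D_self D_adj D_two A_sym A_V by metis

lemma D_near_eq:
  assumes "A t x" "A t y"
  shows "D x y = 0 \<longleftrightarrow> x = y" "D x y = 1 \<longleftrightarrow> A x y" "D x y = 2 \<longleftrightarrow> x \<noteq> y \<and> \<not> A x y"
  using D_near[OF assms] A_irrefl by auto

text \<open>That w lies outside the closed neighbourhood of x is not part of the axiom: the
  parallelogram evaluated at x gives \<open>D x w = 1 + 1 - 0 = 2\<close>.\<close>

lemma ex_translate:
  assumes "A x y" "A x z" "z \<noteq> y" "\<not> A y z"
  obtains w where "A y w" "A z w" "par x y z w" "w \<noteq> x" "\<not> A x w"
proof -
  obtain w where w: "A y w" "A z w" "par x y z w"
    using parallelogram[OF assms] unfolding par_def by blast
  have "D x w - D x z = D x y - D x x" using parD[OF w(3)] assms A_V by blast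
  then have "D x w = 2" using assms D_adj D_self A_V by simp
  then have "w \<noteq> x" "\<not> A x w" using D_self[of x] assms A_V D_adj[of x w] by auto
  with w that show ?thesis by blast
qed

text \<open>
  The three cases are \<open>\<langle>t, y - x\<rangle> = -1\<close>, \<open>1\<close> and \<open>0\<close>: in the first two the reflection in the root
  \<open>y - x\<close> moves \<open>t\<close> to a neighbour.
\<close>

definition tri :: "'a \<Rightarrow> 'a \<Rightarrow> 'a \<Rightarrow> bool" where
  "tri x y t \<longleftrightarrow>
     D t x - D t y = -1 \<and> (\<exists>t'. A t t' \<and> par x y t t') \<or>
     D t x - D t y = 1 \<and> (\<exists>t'. A t t' \<and> par x y t' t) \<or>
     D t x - D t y = 0 \<and> (\<exists>u u'. A t u \<and> A t u' \<and> A u u' \<and> par x y u u')"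

text \<open>The trichotomy depends on the root, not on the arc that represents it; at each vertex a
  convenient representative may be used.\<close>

lemma tri_par:
  assumes "par x y z w" "t \<in> V" "tri z w t" shows "tri x y t"
proof -
  have "D t x - D t y = D t z - D t w" using parD[OF assms(1,2)] by simp
  with assms(3) show ?thesis unfolding tri_def using par_trans[OF assms(1)] by metis
qed

lemma tri_swap: "tri x y t \<Longrightarrow> tri y x t"
proof -
  assume "tri x y t"
  then consider "D t x - D t y = -1" "\<exists>t'. A t t' \<and> par x y t t'" |
     "D t x - D t y = 1" "\<exists>t'. A t t' \<and> par x y t' t" |
     "D t x - D t y = 0" "\<exists>u u'. A t u \<and> A t u' \<and> A u u' \<and> par x y u u'"
    unfolding tri_def by blast
  then show "tri y x t"
  proof cases
    case 1 then have "\<exists>t'. A t t' \<and> par y x t' t" using par_swap by blast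
    with 1 show ?thesis unfolding tri_def by simp
  next
    case 2 then have "\<exists>t'. A t t' \<and> par y x t t'" using par_swap by blast
    with 2 show ?thesis unfolding tri_def by simp
  next
    case 3 then have "\<exists>u u'. A t u \<and> A t u' \<and> A u u' \<and> par y x u u'" using par_swap A_sym by blast
    with 3 show ?thesis unfolding tri_def by simp
  qed
qed

text \<open>Base of the propagation. For \<open>w = y\<close> the translate is x, with value 1; if w
  is adjacent to y, the triangle w x y gives value 0; otherwise a parallelogram gives value
  -1.\<close>

lemma tri_adj:
  assumes "A x y" "A x w" shows "tri x y w"
proof -
  consider "w = y" | "w \<noteq> y" "A y w" | "w \<noteq> y" "\<not> A y w" by blast
  then show ?thesis
  proof cases
    case 1
    then have "D w x - D w y = 1" using assms A_V D_adj A_sym D_self by (metis diff_zero)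
    then show ?thesis using 1 assms(1) A_sym par_refl unfolding tri_def by blast
  next
    case 2
    then have "D w x - D w y = 0" using assms D_adj A_sym by (metis diff_self)
    then show ?thesis using 2 assms A_sym par_refl unfolding tri_def by blast
  next
    case 3
    then obtain v where "A w v" "par x y w v" using ex_translate[OF assms] by metis
    moreover have "D w x = 1" "D w y = 2"
      using 3 assms D_adj D_two A_sym by blast+
    ultimately show ?thesis unfolding tri_def by auto
  qed
qed

text \<open>If the root is represented by an arc at t, or by an arc of a triangle at t one of whose
  ends is w or a neighbour of w, then \<open>tri_adj\<close> applies to that arc. The remaining case
  has a triangle t u u' with w near neither u nor u'.\<close>

lemma tri_step:
  assumes "A x y" "t \<in> V" "tri x y t" "A t w" shows "tri x y w"
proof -
  have wV: "w \<in> V" using assms A_V2 by blast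
  from assms(3) consider t' where "A t t'" "par x y t t'" | t' where "A t t'" "par x y t' t"
    | u u' where "A t u" "A t u'" "A u u'" "par x y u u'"
    unfolding tri_def by blast
  then show ?thesis
  proof cases
    case 1
    then show ?thesis using tri_adj[OF 1(1) assms(4)] tri_par wV by blast
  next
    case 2
    then show ?thesis using tri_swap[OF tri_adj[OF 2(1) assms(4)]] tri_par wV by blast
  next
    case 3
    consider "w = u" | "w = u'" | "A u w" | "A u' w" | "w \<noteq> u" "w \<noteq> u'" "\<not> A u w" "\<not> A u' w" by blast
    then show ?thesis
    proof cases
      case 1
      then show ?thesis using tri_swap[OF tri_adj[OF A_sym[OF 3(3)] A_sym[OF 3(3)]]] 3 tri_par wV by blast
    next
      case 2
      then show ?thesis using tri_adj[OF 3(3) 3(3)] 3 tri_par wV by blast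
    next
      case c: 3
      then show ?thesis using tri_adj[OF 3(3) c] 3 tri_par wV by blast
    next
      case 4
      then show ?thesis using tri_swap[OF tri_adj[OF A_sym[OF 3(3)] 4]] 3 tri_par wV by blast
    next
      case 5
      \<comment> \<open>The whole triangle t u u' is translated by w - t; its image w v v'
        represents the same root at w.\<close>
      obtain v where v: "A w v" "A u v" "par t w u v"
        using ex_translate[OF assms(4) 3(1)] 5 A_sym by metis
      obtain v' where v': "A w v'" "A u' v'" "par t w u' v'"
        using ex_translate[OF assms(4) 3(2)] 5 A_sym by metis
      have p: "par u u' v v'"
        using par_shift[OF par_trans[OF par_sym[OF v(3)] v'(3)]] .
      have V: "t \<in> V" "u \<in> V" "u' \<in> V" "v \<in> V" "v' \<in> V" using 3 v v' A_V A_V2 by blast+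
      \<comment> \<open>That v and v' are adjacent must come from \<open>D v v' = 1\<close>; this is
        enough because w is a common neighbour of both.\<close>
      have "D u' v - D u' u = D u' w - D u' t" using parD[OF v(3)] V by blast
      moreover have "D u' u = 1" "D u' t = 1" "D u' w = 2"
        using 3 assms(4) 5 A_sym D_adj D_two by blast+
      ultimately have "D u' v = 2" by simp
      moreover have "D v v' - D v v = D v u' - D v u" using parD[OF p] V by blast
      moreover have "D v u = 1" using v A_sym D_adj by blast
      ultimately have "D v v' = 1" using D_self D_sym V by simp
      then have vv: "A v v'" using D_near_eq(2)[OF v(1) v'(1)] by simp
      have "D w x - D w y = 0"
        using parD[OF p wV] parD[OF 3(4) wV] D_adj[OF v(1)] D_adj[OF v'(1)] by simp
      moreover have "par x y v v'" using par_trans[OF 3(4) p] .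
      ultimately show ?thesis unfolding tri_def using vv v v' by blast
    qed
  qed
qed

lemma tri: "A x y \<Longrightarrow> t \<in> V \<Longrightarrow> tri x y t"
proof -
  assume xy: "A x y" and t: "t \<in> V"
  have "x \<in> V" using xy A_V by blast
  then show ?thesis using t
  proof (induction rule: V_induct)
    case base
    show ?case using tri_swap[OF tri_adj[OF A_sym[OF xy] A_sym[OF xy]]] .
  next
    case (step t w)
    then show ?case using tri_step[OF xy] by blast
  qed
qed


subsection \<open>The kernel is the graph distance\<close>

definition gd :: "'a \<Rightarrow> 'a \<Rightarrow> nat" where "gd x y = (LEAST n. (A ^^ n) x y)"

lemma gd_path: "x \<in> V \<Longrightarrow> y \<in> V \<Longrightarrow> (A ^^ gd x y) x y"
  unfolding gd_def using A_conn[of x y] by (metis LeastI rtranclp_imp_relpowp)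

lemma gd_le: "(A ^^ n) x y \<Longrightarrow> gd x y \<le> n"
  unfolding gd_def by (rule Least_le)

lemma relpowp_sym: "(A ^^ n) x y \<Longrightarrow> (A ^^ n) y x"
proof (induction n arbitrary: y)
  case (Suc n)
  then obtain z where "(A ^^ n) x z" "A z y" by (auto elim: relpowp_Suc_E)
  then show ?case using Suc.IH A_sym relpowp_Suc_I2 by metis
qed simp

lemma gd_sym: "gd x y = gd y x"
proof -
  have "(\<lambda>n. (A ^^ n) x y) = (\<lambda>n. (A ^^ n) y x)" using relpowp_sym by blast
  then show ?thesis unfolding gd_def by simp
qed

lemma gd_self: "gd x x = 0" using gd_le[of 0 x x] by simp

lemma gd_0: "x \<in> V \<Longrightarrow> y \<in> V \<Longrightarrow> gd x y = 0 \<Longrightarrow> x = y"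
  using gd_path[of x y] by simp

lemma gd_step: "A x y \<Longrightarrow> z \<in> V \<Longrightarrow> gd x z \<le> Suc (gd y z)"
  using gd_path[of y z] A_V2 relpowp_Suc_I2 gd_le by metis

lemma gd_step2: "A y z \<Longrightarrow> x \<in> V \<Longrightarrow> gd x z \<le> Suc (gd x y)"
  using gd_step[of z y x] A_sym gd_sym by metis

lemma gd_Suc: 
  assumes "x \<in> V" "z \<in> V" "gd x z = Suc m" obtains y where "A x y" "gd y z = m"
proof -
  obtain y where y: "A x y" "(A ^^ m) y z"
    using gd_path[OF assms(1,2)] assms(3) relpowp_Suc_D2 by metis
  have "gd y z \<le> m" using y gd_le by blast
  moreover have "Suc m \<le> Suc (gd y z)" using gd_step[OF y(1) assms(2)] assms(3) by simp
  ultimately show ?thesis using that y by simp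
qed

text \<open>A geodesic from t to c is translated by z - c, one parallelogram per edge, into a path
  of length m from t' to z. The bound n confines the use of \<open>D = gd\<close> to pairs already
  settled in the induction of \<open>D_eq_gd\<close>.\<close>

lemma translate_path:
  assumes IH: "\<And>p q. p \<in> V \<Longrightarrow> q \<in> V \<Longrightarrow> gd p q < n \<Longrightarrow> D p q = gd p q" and cz: "A c z"
  shows "t \<in> V \<Longrightarrow> gd t c = m \<Longrightarrow> gd t z = Suc m \<Longrightarrow> Suc m < n \<Longrightarrow> A t t' \<Longrightarrow> par c z t t' \<Longrightarrow> gd t' z \<le> m"
proof (induction m arbitrary: t t')
  case 0
  have V: "c \<in> V" "z \<in> V" using cz A_V A_V2 by auto
  have tc: "t = c" using 0 gd_0 V by blast
  have "D z t' - D z t = D z z - D z c" using parD[OF 0(6)] V by blast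
  then have "D z t' = 0" using tc D_self V by simp
  then have "t' = z" using D_near_eq(1)[of c z t'] cz 0(5) tc by simp
  then show ?case by (simp add: gd_self)
next
  case (Suc m)
  have V: "c \<in> V" "z \<in> V" "t' \<in> V" using cz A_V A_V2 Suc.prems by auto
  obtain t1 where t1: "A t t1" "gd t1 c = m" using gd_Suc[OF Suc.prems(1) V(1) Suc.prems(2)] .
  have t1V: "t1 \<in> V" using t1 A_V2 by blast
  have g: "gd t1 z = Suc m"
    using gd_step[OF t1(1) V(2)] gd_step2[OF cz t1V] t1 Suc.prems by simp
  have d: "D t1 c = m" "D t1 z = Suc m" using IH t1V V t1 g Suc.prems by simp_all
  have "D t' t' - D t' t = D t' z - D t' c" using parD[OF Suc.prems(6)] V by blast
  then have "D t' c - D t' z = 1" using D_self V Suc.prems D_adj A_sym by simp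
  then have ne: "t1 \<noteq> t'" using d by auto
  \<comment> \<open>The value two excludes adjacency of t1 and t', so that the arcs t t' and t t1
    span a parallelogram.\<close>
  have "D t1 t' - D t1 t = D t1 z - D t1 c" using parD[OF Suc.prems(6)] t1V by blast
  then have "D t1 t' = 2" using d D_adj t1 A_sym by simp
  then have "\<not> A t' t1" using D_adj A_sym by fastforce
  then obtain w where w: "A t' w" "A t1 w" "par t t' t1 w"
    using ex_translate[OF Suc.prems(5) t1(1) ne] by metis
  have "gd w z \<le> m" using Suc.IH[OF t1V t1(2) g _ w(2)] par_trans[OF Suc.prems(6) w(3)] Suc.prems by simp
  then show ?case using gd_step[OF w(1) V(2)] by simp
qed

text \<open>For distance m + 2, let b follow x and c precede y on a geodesic. The translate b' of b
  by y - c is within m of y, hence neither x nor a neighbour of x, and \<open>D x b' = 2\<close>.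
  The parallelogram evaluated at x then gives \<open>D x y = (m + 1) + 2 - 1\<close>.\<close>

theorem D_eq_gd: "x \<in> V \<Longrightarrow> y \<in> V \<Longrightarrow> D x y = gd x y"
proof (induction "gd x y" arbitrary: x y rule: less_induct)
  case less
  consider "gd x y = 0" | "gd x y = 1" | m where "gd x y = Suc (Suc m)"
    by (metis One_nat_def nat.exhaust)
  then show ?case
  proof cases
    case 1
    then show ?thesis using gd_0 less.prems D_self by fastforce
  next
    case 2
    then have "A x y" using gd_path[OF less.prems] by (simp add: eq_OO)
    then show ?thesis using 2 D_adj by simp
  next
    case 3
    have IH: "D p q = gd p q" if "p \<in> V" "q \<in> V" "gd p q < Suc (Suc m)" for p q
      using less.hyps[of p q] that 3 by simp
    obtain b where b: "A x b" "gd b y = Suc m" using gd_Suc[OF less.prems 3] .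
    have bV: "b \<in> V" using b A_V2 by blast
    obtain c where c: "A y c" "gd c b = m" using gd_Suc[OF less.prems(2) bV, of m] b gd_sym by metis
    have cV: "c \<in> V" using c A_V2 by blast
    have cy: "A c y" using c A_sym by blast
    have g: "gd b c = m" "gd x c = Suc m"
      using c gd_sym gd_step[OF b(1) cV] gd_step2[OF cy less.prems(1)] 3 by (simp_all add: gd_sym)
    have d: "D b c = m" "D b y = Suc m" "D x c = Suc m"
      using IH bV cV less.prems g b by simp_all
    \<comment> \<open>At b the root y - c has value m - (m + 1) = -1, which selects the case with a
      translate b'.\<close>
    have "tri c y b" using tri[OF cy bV] .
    then obtain b' where b': "A b b'" "par c y b b'" using d unfolding tri_def by auto
    have gb': "gd b' y \<le> m"
      using translate_path[OF IH cy bV g(1) b(2) _ b'] by simp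
    have "x \<noteq> b'" using gb' 3 by auto
    moreover have "\<not> A b' x"
      using gd_step[of x b' y] A_sym less.prems gb' 3 by fastforce
    ultimately have "D x b' = 2" using D_near_eq(3)[of b x b'] b b' A_sym by blast
    moreover have "D x b' - D x b = D x y - D x c" using parD[OF b'(2)] less.prems by blast
    moreover have "D x b = 1" using b D_adj by blast
    ultimately show ?thesis using d 3 by simp
  qed
qed

lemma D_eq_0_iff: "x \<in> V \<Longrightarrow> y \<in> V \<Longrightarrow> D x y = 0 \<longleftrightarrow> x = y"
  using D_eq_gd gd_0 D_self by fastforce

lemma D_eq_1_iff: "x \<in> V \<Longrightarrow> y \<in> V \<Longrightarrow> D x y = 1 \<longleftrightarrow> A x y"
proof
  assume V: "x \<in> V" "y \<in> V" and "D x y = 1"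
  then have "gd x y = 1" using D_eq_gd by simp
  then show "A x y" using gd_path[OF V] by (simp add: eq_OO)
qed (rule D_adj)

lemma par_unique:
  assumes "par x y z w" "par x y z w'" "w \<in> V" "w' \<in> V" shows "w = w'"
proof -
  have "D w w = D w w'" using parD[OF assms(1,3)] parD[OF assms(2,3)] by simp
  then show ?thesis using D_eq_0_iff[of w w'] assms D_self by simp
qed

subsection \<open>Roots and the closed neighbourhood of a vertex\<close>

text \<open>The trichotomy at x, read as a normal form: each of its three cases exhibits the root as
  an arc inside the closed neighbourhood of x.\<close>

lemma root_cases:
  assumes "A z w" "x \<in> V"
  obtains p q where "p = x \<or> A x p" "q = x \<or> A x q" "A p q" "par p q z w"
proof -
  have "tri z w x" using tri assms by blast
  then consider t where "A x t" "par z w x t" | t where "A x t" "par z w t x"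
    | u u' where "A x u" "A x u'" "A u u'" "par z w u u'" unfolding tri_def by blast
  then show ?thesis
  proof cases
    case 1 then show ?thesis using that[of x t] par_sym by blast
  next
    case 2 then show ?thesis using that[of t x] par_sym A_sym by blast
  next
    case 3 then show ?thesis using that[of u u'] par_sym by blast
  qed
qed

lemma translate_ex:
  assumes "A p q" "z \<in> V" "D z p - D z q = -1"
  obtains w where "A z w" "par p q z w"
  using tri[OF assms(1,2)] assms(3) that unfolding tri_def by auto

lemma root_values:
  assumes "A p q" "z \<in> V" shows "D z p - D z q \<in> {-1, 0, 1}"
  using tri[OF assms] unfolding tri_def by auto

lemma determined_by_neighbourhood:
  assumes "x \<in> V" "z \<in> V" "z' \<in> V"
    and eq: "\<And>p q. p = x \<or> A x p \<Longrightarrow> q = x \<or> A x q \<Longrightarrow> D z p - D z q = D z' p - D z' q"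
  shows "z = z'"
proof -
  have const: "D z s - D z' s = D z x - D z' x" if "s \<in> V" for s
    using assms(1) that
  proof (induction rule: V_induct)
    case (step s t)
    obtain p q where "p = x \<or> A x p" "q = x \<or> A x q" "par p q s t"
      by (rule root_cases[OF step.hyps(2) assms(1)])
    then show ?case using eq[of p q] parD[of p q s t z] parD[of p q s t z'] assms step by simp
  qed simp
  \<comment> \<open>The constant difference equals - \<open>D z z'\<close> at s = z and +
    \<open>D z z'\<close> at s = z', so it vanishes.\<close>
  have "D z z - D z' z = D z z' - D z' z'" using const[OF assms(2)] const[OF assms(3)] by simp
  then have "D z z' = 0" using assms D_self D_sym by simp
  then show ?thesis using D_eq_0_iff assms by blast
qed

end

section \<open>Local graphs, and uniqueness of a minuscule graph with given local graph\<close>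

definition nb :: "('a \<Rightarrow> 'a \<Rightarrow> bool) \<Rightarrow> 'a \<Rightarrow> 'a set" where "nb A x = {y. A x y}"

text \<open>Confined to the neighbourhood because the locale requires both ends of every arc to be
  vertices.\<close>

definition loc :: "('a \<Rightarrow> 'a \<Rightarrow> bool) \<Rightarrow> 'a \<Rightarrow> 'a \<Rightarrow> 'a \<Rightarrow> bool" where
  "loc A x y z \<longleftrightarrow> A x y \<and> A x z \<and> A y z"

lemma iso_on_cong:
  assumes "iso_on V A W B" "\<And>x y. x \<in> V \<Longrightarrow> y \<in> V \<Longrightarrow> A x y \<longleftrightarrow> A' x y"
    "\<And>x y. x \<in> W \<Longrightarrow> y \<in> W \<Longrightarrow> B x y \<longleftrightarrow> B' x y"
  shows "iso_on V A' W B'"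
proof -
  obtain f where f: "bij_betw f V W" "\<forall>x\<in>V. \<forall>y\<in>V. A x y \<longleftrightarrow> B (f x) (f y)"
    using assms(1) unfolding iso_on_def by blast
  show ?thesis by (rule iso_onI[OF f(1)]) (use f assms bij_betwE[OF f(1)] in auto)
qed

lemma iso_on_loc:
  "iso_on (nb A x) (loc A x) W B \<longleftrightarrow> iso_on (nb A x) A W B"
  "iso_on W B (nb A x) (loc A x) \<longleftrightarrow> iso_on W B (nb A x) A"
  by (auto elim!: iso_on_cong simp: nb_def loc_def)

text \<open>Vertices are compared by their coordinates against the closed neighbourhoods. An arc z w
  is a root represented there by some p q and has value -1 at z; the value at z' is the same, so the
  root f q - f p leads from z' to a matching w'. With the roles exchanged this yields a
  bisimulation.\<close>

lemma nbhd_simulation: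
  assumes M: "minuscule V A D" and N: "minuscule W B E"
    and C: "x \<in> V" "x' \<in> W"
    and f: "\<And>p. p = x \<or> A x p \<Longrightarrow> f p = x' \<or> B x' (f p)"
    and fD: "\<And>p q. p = x \<or> A x p \<Longrightarrow> q = x \<or> A x q \<Longrightarrow> E (f p) (f q) = D p q"
    and zz: "z \<in> V" "z' \<in> W"
    and rel: "\<And>p q. p = x \<or> A x p \<Longrightarrow> q = x \<or> A x q \<Longrightarrow> E z' (f p) - E z' (f q) = D z p - D z q"
    and zw: "A z w"
  shows "\<exists>w'. B z' w' \<and> (\<forall>p q. (p = x \<or> A x p) \<longrightarrow> (q = x \<or> A x q) \<longrightarrow>
    E w' (f p) - E w' (f q) = D w p - D w q)"
proof -
  interpret M: minuscule V A D by fact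
  interpret N: minuscule W B E by fact
  have CV: "p \<in> V" "f p \<in> W" if "p = x \<or> A x p" for p
    using that C f[OF that] M.A_V2 N.A_V2 by auto
  obtain p q where pq: "p = x \<or> A x p" "q = x \<or> A x q" "A p q" "M.par p q z w"
    using M.root_cases[OF zw C(1)] .
  have "D z w - D z z = D z q - D z p" using M.parD[OF pq(4) zz(1)] .
  then have "D z p - D z q = -1" using M.D_self[OF zz(1)] M.D_adj[OF zw] by simp
  then have m: "E z' (f p) - E z' (f q) = -1" using rel pq by simp
  have "B (f p) (f q)"
    using fD[OF pq(1,2)] M.D_adj[OF pq(3)] N.D_eq_1_iff CV pq by simp
  then obtain w' where w': "B z' w'" "N.par (f p) (f q) z' w'" using N.translate_ex m zz by metis
  have wV: "w \<in> V" "w' \<in> W" using zw w' M.A_V2 N.A_V2 by auto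
  have "E w' (f a) - E w' (f b) = D w a - D w b" if ab: "a = x \<or> A x a" "b = x \<or> A x b" for a b
  proof -
    \<comment> \<open>Moving along the root changes the coordinates only by Gram data of the closed
      neighbourhood, which f preserves.\<close>
    have 1: "D w c = D z c + D c q - D c p" if "c = x \<or> A x c" for c
      using M.parD[OF pq(4) CV(1)[OF that]] M.D_sym wV zz CV(1)[OF that] by simp
    have 2: "E w' (f c) = E z' (f c) + D c q - D c p" if "c = x \<or> A x c" for c
      using N.parD[OF w'(2) CV(2)[OF that]] N.D_sym wV zz CV(2)[OF that] fD[OF that] pq by simp
    show ?thesis using 1[OF ab(1)] 1[OF ab(2)] 2[OF ab(1)] 2[OF ab(2)] rel[OF ab] by simp
  qed
  with w' show ?thesis by blast
qed

text \<open>
  A minuscule graph is determined by its local graph at one vertex: every root is a difference of two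
  elements of the closed neighbourhood, whose Gram matrix is encoded in the local graph.
\<close>

theorem minuscule_unique:
  assumes M: "minuscule V A D" and N: "minuscule W B E"
    and C: "x \<in> V" "x' \<in> W"
    and iso: "iso_on (nb A x) A (nb B x') B"
  shows "iso_on V A W B"
proof -
  interpret M: minuscule V A D by fact
  interpret N: minuscule W B E by fact
  obtain h where h: "bij_betw h (nb A x) (nb B x')"
    "\<forall>y\<in>nb A x. \<forall>z\<in>nb A x. A y z \<longleftrightarrow> B (h y) (h z)"
    using iso unfolding iso_on_def by blast
  define f where "f p = (if p = x then x' else h p)" for p
  define g where "g p = (if p = x' then x else inv_into (nb A x) h p)" for p
  have hn: "B x' (h p)" if "A x p" for p
    using bij_betwE[OF h(1)] that by (simp add: nb_def)
  have hi: "A x (inv_into (nb A x) h p)" "h (inv_into (nb A x) h p) = p" if "B x' p" for p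
    using bij_betwE[OF bij_betw_inv_into[OF h(1)]] bij_betw_inv_into_right[OF h(1)] that
    by (simp_all add: nb_def)
  have f: "f p = x' \<or> B x' (f p)" if "p = x \<or> A x p" for p
    using that hn by (auto simp: f_def)
  have g: "g p = x \<or> A x (g p)" if "p = x' \<or> B x' p" for p
    using that hi by (auto simp: g_def)
  have fg: "f (g p) = p" if "p = x' \<or> B x' p" for p
    using that hi(2)[of p] hi(1)[of p] M.A_irrefl[of x] by (auto simp: f_def g_def)
  have gf: "g (f p) = p" if "p = x \<or> A x p" for p
  proof (cases "p = x")
    case False
    then have "A x p" "p \<in> nb A x" using that by (auto simp: nb_def)
    then show ?thesis using hn[of p] N.A_irrefl bij_betw_inv_into_left[OF h(1)] False
      by (auto simp: f_def g_def)
  qed (simp add: f_def g_def)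
  have hD: "E (h p) (h q) = D p q" if "A x p" "A x q" for p q
  proof -
    have "h p = h q \<longleftrightarrow> p = q"
      using h(1) that by (auto simp: bij_betw_def inj_on_def nb_def)
    moreover have "A p q \<longleftrightarrow> B (h p) (h q)" using h(2) that by (auto simp: nb_def)
    ultimately show ?thesis
      using M.D_near[OF that] N.D_near[OF hn[OF that(1)] hn[OF that(2)]] by simp
  qed
  have fD: "E (f p) (f q) = D p q" if "p = x \<or> A x p" "q = x \<or> A x q" for p q
  proof -
    have 1: "D x p = 1" "D p x = 1" "E x' (h p) = 1" "E (h p) x' = 1" if "A x p" for p
      using that M.D_adj M.A_sym N.D_adj N.A_sym hn by blast+
    show ?thesis
      using that hD[of p q] 1[of p] 1[of q] M.D_self[OF C(1)] N.D_self[OF C(2)]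
      by (cases "p = x"; cases "q = x") (simp_all add: f_def)
  qed
  have gD: "D (g p) (g q) = E p q" if "p = x' \<or> B x' p" "q = x' \<or> B x' q" for p q
    using fD[OF g[OF that(1)] g[OF that(2)]] fg that by simp
  \<comment> \<open>This relation turns out to be the graph of the isomorphism: total on both sides
    by simulation along walks from x and x', single-valued both ways by
    \<open>determined_by_neighbourhood\<close>.\<close>
  define rel where "rel z z' \<longleftrightarrow> z \<in> V \<and> z' \<in> W \<and>
    (\<forall>p q. (p = x \<or> A x p) \<longrightarrow> (q = x \<or> A x q) \<longrightarrow> E z' (f p) - E z' (f q) = D z p - D z q)" for z z'
  have relg: "D z (g p) - D z (g q) = E z' p - E z' q"
    if "rel z z'" "p = x' \<or> B x' p" "q = x' \<or> B x' q" for z z' p q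
  proof -
    have "E z' (f (g p)) - E z' (f (g q)) = D z (g p) - D z (g q)"
      using that(1) g[OF that(2)] g[OF that(3)] unfolding rel_def by blast
    then show ?thesis using fg[OF that(2)] fg[OF that(3)] by simp
  qed
  have relI: "rel z z'" if "z \<in> V" "z' \<in> W"
    "\<And>p q. p = x' \<or> B x' p \<Longrightarrow> q = x' \<or> B x' q \<Longrightarrow> D z (g p) - D z (g q) = E z' p - E z' q" for z z'
    unfolding rel_def
  proof (intro conjI allI impI)
    fix p q assume pq: "p = x \<or> A x p" "q = x \<or> A x q"
    show "E z' (f p) - E z' (f q) = D z p - D z q"
      using that(3)[OF f[OF pq(1)] f[OF pq(2)]] gf[OF pq(1)] gf[OF pq(2)] by simp
  qed (use that in auto)
  have fwd: "\<exists>w'. B z' w' \<and> rel w w'" if r: "rel z z'" and e: "A z w" for z z' w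
  proof -
    have zz: "z \<in> V" "z' \<in> W" using r unfolding rel_def by auto
    have r': "E z' (f p) - E z' (f q) = D z p - D z q" if "p = x \<or> A x p" "q = x \<or> A x q" for p q
      using r that unfolding rel_def by blast
    have wV: "w \<in> V" using e M.A_V2 by blast
    show ?thesis
      using nbhd_simulation[OF M N C f fD zz r' e] wV N.A_V2 unfolding rel_def by blast
  qed
  have bwd: "\<exists>w. A z w \<and> rel w w'" if r: "rel z z'" and e: "B z' w'" for z z' w'
  proof -
    have zz: "z' \<in> W" "z \<in> V" using r e unfolding rel_def by auto
    obtain w where w: "A z w" "\<forall>p q. (p = x' \<or> B x' p) \<longrightarrow> (q = x' \<or> B x' q) \<longrightarrow>
        D w (g p) - D w (g q) = E w' p - E w' q"
      using nbhd_simulation[OF N M C(2,1) g gD zz relg[OF r] e] by blast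
    have "w \<in> V" "w' \<in> W" using w(1) e M.A_V2 N.A_V2 by blast+
    then have "rel w w'" using w(2) by (intro relI) blast+
    then show ?thesis using w(1) by blast
  qed
  have base: "rel x x'"
    unfolding rel_def
  proof (intro conjI allI impI)
    fix p q assume pq: "p = x \<or> A x p" "q = x \<or> A x q"
    have "f x = x'" by (simp add: f_def)
    then show "E x' (f p) - E x' (f q) = D x p - D x q" using fD[of x p] fD[of x q] pq by simp
  qed (use C in auto)
  have tot1: "\<exists>z'. rel z z'" if "z \<in> V" for z
    using C(1) that by (induction rule: M.V_induct) (use base fwd in blast)+
  have tot2: "\<exists>z. rel z z'" if "z' \<in> W" for z'
    using C(2) that by (induction rule: N.V_induct) (use base bwd in blast)+
  have uni1: "z' = w'" if "rel z z'" "rel z w'" for z z' w'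
    by (rule N.determined_by_neighbourhood[OF C(2)])
      (use that relg[OF that(1)] relg[OF that(2)] in \<open>auto simp: rel_def\<close>)
  have uni2: "z = w" if "rel z z'" "rel w z'" for z w z'
    by (rule M.determined_by_neighbourhood[OF C(1)])
      (use that in \<open>auto simp: rel_def\<close>)
  define F where "F z = (SOME z'. rel z z')" for z
  have F: "rel z (F z)" if "z \<in> V" for z unfolding F_def using tot1[OF that] by (rule someI_ex)
  show ?thesis
  proof (rule iso_onI)
    show "bij_betw F V W"
    proof (rule bij_betwI')
      fix y z assume "y \<in> V" "z \<in> V"
      then show "F y = F z \<longleftrightarrow> y = z" using F uni2 by metis
    next
      fix z assume "z \<in> V" then show "F z \<in> W" using F unfolding rel_def by blast
    next
      fix z' assume "z' \<in> W"
      then obtain z where "rel z z'" using tot2 by blast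
      moreover from this have "z \<in> V" unfolding rel_def by blast
      ultimately show "\<exists>z\<in>V. z' = F z" using uni1 F by blast
    qed
    fix y z assume V: "y \<in> V" "z \<in> V"
    show "A y z \<longleftrightarrow> B (F y) (F z)"
    proof
      assume "A y z" then show "B (F y) (F z)" using fwd[OF F[OF V(1)]] F[OF V(2)] uni1 by blast
    next
      assume "B (F y) (F z)" then show "A y z" using bwd[OF F[OF V(1)]] F[OF V(2)] uni2 by blast
    qed
  qed
qed

text \<open>Both kernels are graph distances by \<open>D_eq_gd\<close>, so an isomorphism of the
  graphs alone carries one to the other.\<close>

lemma minuscule_iso_D:
  assumes M: "minuscule V A D" and N: "minuscule W B E"
    and f: "bij_betw f V W" "\<And>x y. x \<in> V \<Longrightarrow> y \<in> V \<Longrightarrow> A x y \<longleftrightarrow> B (f x) (f y)"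
    and V: "x \<in> V" "y \<in> V"
  shows "E (f x) (f y) = D x y"
proof -
  interpret M: minuscule V A D by fact
  interpret N: minuscule W B E by fact
  have fW: "f z \<in> W" if "z \<in> V" for z using f(1) that bij_betwE by blast
  have 1: "(B ^^ n) (f a) (f b)" if "(A ^^ n) a b" "a \<in> V" for n a b
    using that
  proof (induction n arbitrary: b)
    case (Suc n)
    then obtain c where c: "(A ^^ n) a c" "A c b" by (auto elim: relpowp_Suc_E)
    then have "B (f c) (f b)" using f(2)[of c b] M.A_V M.A_V2 by blast
    with Suc c show ?case by (auto intro: relpowp_Suc_I)
  qed simp
  have 2: "\<exists>b\<in>V. f b = b' \<and> (A ^^ n) a b" if "(B ^^ n) (f a) b'" "a \<in> V" for n a b'
    using that
  proof (induction n arbitrary: b')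
    case (Suc n)
    then obtain c' where c': "(B ^^ n) (f a) c'" "B c' b'" by (auto elim: relpowp_Suc_E)
    then obtain c where c: "c \<in> V" "f c = c'" "(A ^^ n) a c" using Suc by blast
    obtain b where b: "b \<in> V" "f b = b'" 
      using f(1) N.A_V2[OF c'(2)] unfolding bij_betw_def by blast
    have "A c b" using f(2)[OF c(1) b(1)] c b c' by simp
    then show ?case using b c by (auto intro: relpowp_Suc_I)
  qed auto
  have "(\<lambda>n. (A ^^ n) x y) = (\<lambda>n. (B ^^ n) (f x) (f y))"
  proof (rule ext, rule iffI)
    fix n assume "(B ^^ n) (f x) (f y)"
    then obtain b where "b \<in> V" "f b = f y" "(A ^^ n) x b" using 2[OF _ V(1)] by blast
    then show "(A ^^ n) x y" using f(1) V unfolding bij_betw_def inj_on_def by blast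
  qed (use 1 V in blast)
  then have "M.gd x y = N.gd (f x) (f y)" unfolding M.gd_def N.gd_def by simp
  then show ?thesis using M.D_eq_gd[OF V] N.D_eq_gd[OF fW[OF V(1)] fW[OF V(2)]] by simp
qed

section \<open>The local graph and common neighbours\<close>

context minuscule
begin

text \<open>The kernel is kept. The fourth corner satisfies \<open>D x w = 1\<close>, and only
  \<open>D_eq_1_iff\<close> turns this value into adjacency. Connectedness is an assumption because
  it can fail: in a Hamming graph the local graph is a disjoint union of cliques.\<close>

lemma local_minuscule:
  assumes "x \<in> V" and conn: "\<And>y z. A x y \<Longrightarrow> A x z \<Longrightarrow> (loc A x)\<^sup>*\<^sup>* y z"
  shows "minuscule (nb A x) (loc A x) D"
proof unfold_locales
  show "finite (nb A x)" using finite_V A_V2 unfolding nb_def by (rule_tac finite_subset[of _ V]) auto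
  show "\<exists>w. loc A x z w \<and> loc A x u w \<and> (\<forall>s\<in>nb A x. D s w - D s u = D s z - D s y)"
    if as: "loc A x y z" "loc A x y u" "u \<noteq> z" "\<not> loc A x z u" for y z u
  proof -
    have 1: "A y z" "A y u" "\<not> A z u" "A x y" "A x z" "A x u" using as unfolding loc_def by auto
    obtain w where w: "A z w" "A u w" "par y z u w" using ex_translate[OF 1(1,2) as(3) 1(3)] by metis
    have "D x w - D x u = D x z - D x y" using parD[OF w(3) assms(1)] .
    then have "D x w = 1" using D_adj 1 by simp
    then have "A x w" using D_eq_1_iff assms(1) A_V2[OF w(1)] by blast
    then show ?thesis using w 1 parD[OF w(3)] A_V2 unfolding loc_def nb_def by blast
  qed
qed (use assms A_V A_V2 A_sym A_irrefl D_self D_sym D_adj D_two in \<open>auto simp: nb_def loc_def\<close>)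

text \<open>With w opposite to x, a common neighbour t satisfies
  \<open>D t w + D t x = D t y + D t z = 2\<close>. So t is x, or w, or a neighbour of x.\<close>

lemma card_common_neighbours:
  assumes "A x y" "A x z" "y \<noteq> z" "\<not> A y z"
  shows "card {t. A y t \<and> A z t} = card {t. A x t \<and> A y t \<and> A z t} + 2"
proof -
  obtain w where w: "A y w" "A z w" "par x y z w" "w \<noteq> x" "\<not> A x w"
    using ex_translate[OF assms(1,2)] assms by metis
  have "{t. A y t \<and> A z t} = insert x (insert w {t. A x t \<and> A y t \<and> A z t})"
  proof (intro equalityI subsetI)
    fix t assume "t \<in> {t. A y t \<and> A z t}"
    then have t: "A y t" "A z t" by auto
    have V: "t \<in> V" "x \<in> V" "w \<in> V" using t assms w A_V A_V2 by blast+
    have "D t w - D t z = D t y - D t x" using parD[OF w(3) V(1)] .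
    moreover have "D t z = 1" "D t y = 1" using t A_sym D_adj by blast+
    ultimately have s: "D t w + D t x = 2" by simp
    have "D t x \<in> {0, 1, 2}" using D_near[of y t x] t assms A_sym by auto
    then consider "D t x = 0" | "D t x = 1" | "D t w = 0" using s by auto
    then show "t \<in> insert x (insert w {t. A x t \<and> A y t \<and> A z t})"
      by cases (use V t D_eq_0_iff D_eq_1_iff A_sym in auto)
  qed (use assms w A_sym in auto)
  moreover have "finite {t. A x t \<and> A y t \<and> A z t}"
    by (rule finite_subset[OF _ finite_V]) (use A_V2 in auto)
  ultimately show ?thesis using w A_irrefl by simp
qed

text \<open>A vertex z outside the closed neighbourhood of x but adjacent to some y in it would give
  the corner x + z - y, a neighbour of x not adjacent to y.\<close>

lemma complete_if_local_complete:
  assumes "x \<in> V" "\<And>y z. A x y \<Longrightarrow> A x z \<Longrightarrow> y \<noteq> z \<Longrightarrow> A y z" "p \<in> V" "q \<in> V" "p \<noteq> q"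
  shows "A p q"
proof -
  have "y = x \<or> A x y" if "y \<in> V" for y
    using assms(1) that
  proof (induction rule: V_induct)
    case (step y z)
    show ?case
    proof (rule ccontr)
      assume n: "\<not> (z = x \<or> A x z)"
      then have xy: "A x y" using step by auto
      then obtain w where "A x w" "par y x z w" "w \<noteq> y" "\<not> A y w"
        using ex_translate[OF A_sym[OF xy] step.hyps(2)] n A_sym by metis
      then show False using assms(2)[OF xy] by blast
    qed
  qed simp
  then show ?thesis using assms A_sym by metis
qed

text \<open>The corner w = a + b - y has \<open>D c w = 2 + 2 - 1\<close>. Where the kernel is
  bounded by two, this forbids claws.\<close>

lemma three_independent_neighbours:
  assumes "A y a" "A y b" "A y c" "a \<noteq> b" "a \<noteq> c" "b \<noteq> c" "\<not> A a b" "\<not> A a c" "\<not> A b c"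
  obtains w where "w \<in> V" "D c w = 3"
proof -
  obtain w where w: "A a w" "par y a b w" using ex_translate[OF assms(1,2)] assms by metis
  have "D c w - D c b = D c a - D c y" using parD[OF w(2)] assms A_V2 by blast
  moreover have "D c b = 2" "D c a = 2"
    using D_near_eq(3)[OF assms(3,2)] D_near_eq(3)[OF assms(3,1)] assms A_sym by blast+
  moreover have "D c y = 1" using assms A_sym D_adj by blast
  ultimately have "D c w = 3" by simp
  then show ?thesis using that w A_V2 by blast
qed

end

text \<open>Criterion for the concrete graphs. Descent towards y gives connectedness, and for the
  fourth corner only the distance identity is asked: evaluated at y and at z it shows that w is
  adjacent to both.\<close>

lemma minusculeI:
  fixes d :: "'a \<Rightarrow> 'a \<Rightarrow> nat"
  assumes fin: "finite V"
    and A: "\<And>x y. A x y \<longleftrightarrow> x \<in> V \<and> y \<in> V \<and> d x y = 1"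
    and d0: "\<And>x y. x \<in> V \<Longrightarrow> y \<in> V \<Longrightarrow> d x y = 0 \<longleftrightarrow> x = y"
    and dsym: "\<And>x y. x \<in> V \<Longrightarrow> y \<in> V \<Longrightarrow> d x y = d y x"
    and d2: "\<And>x y z. A x y \<Longrightarrow> A y z \<Longrightarrow> d x z \<le> 2"
    and desc: "\<And>x y. x \<in> V \<Longrightarrow> y \<in> V \<Longrightarrow> 1 < d x y \<Longrightarrow> \<exists>z. A x z \<and> d z y < d x y"
    and para: "\<And>x y z. A x y \<Longrightarrow> A x z \<Longrightarrow> d y z = 2 \<Longrightarrow>
      \<exists>w\<in>V. \<forall>s\<in>V. d s w + d s x = d s y + d s z"
  shows "minuscule V A (\<lambda>x y. real (d x y))"
proof unfold_locales
  show "A\<^sup>*\<^sup>* x y" if "x \<in> V" "y \<in> V" for x y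
    using that
  proof (induction "d x y" arbitrary: x rule: less_induct)
    case less
    consider "d x y = 0" | "d x y = 1" | "1 < d x y" by linarith
    then show ?case
    proof cases
      case 1 then show ?thesis using d0 less.prems by auto
    next
      case 2 then show ?thesis using A less.prems by auto
    next
      case 3
      then obtain z where z: "A x z" "d z y < d x y" using desc less.prems by blast
      then have "A\<^sup>*\<^sup>* z y" using less A by blast
      then show ?thesis using z(1) by (rule converse_rtranclp_into_rtranclp[rotated])
    qed
  qed
  show two: "real (d x z) = 2" if "A x y" "A y z" "x \<noteq> z" "\<not> A x z" for x y z
  proof -
    have V: "x \<in> V" "z \<in> V" using that A by auto
    have "d x z \<noteq> 0" "d x z \<noteq> 1" "d x z \<le> 2" using that A d0 V d2 by auto
    then show ?thesis by simp
  qed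
  show "\<exists>w. A y w \<and> A z w \<and> (\<forall>s\<in>V. real (d s w) - real (d s z) = real (d s y) - real (d s x))"
    if xyz: "A x y" "A x z" "z \<noteq> y" "\<not> A y z" for x y z
  proof -
    have V: "x \<in> V" "y \<in> V" "z \<in> V" using that A by auto
    have yx: "A y x" using xyz A V dsym by metis
    have dyz: "d y z = 2" using two[OF yx xyz(2)] xyz by simp
    then obtain w where w: "w \<in> V" "\<And>s. s \<in> V \<Longrightarrow> d s w + d s x = d s y + d s z"
      using para[OF xyz(1,2)] by blast
    have "d y y = 0" "d z z = 0" "d y x = 1" "d z x = 1" "d z y = 2"
      using d0 V xyz A dsym dyz by auto
    then have "d y w = 1" "d z w = 1" using w(2)[of y] w(2)[of z] V dyz by simp_all
    then have "A y w" "A z w" using A V w(1) by auto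
    moreover have "real (d s w) - real (d s z) = real (d s y) - real (d s x)" if "s \<in> V" for s
      using w(2)[OF that] by linarith
    ultimately show ?thesis by blast
  qed
  show "\<not> A x x" for x using A[of x x] d0[of x x] by auto
qed (use fin A d0 dsym in auto)

lemma minuscule_iso:
  assumes M: "minuscule V A D" and f: "bij_betw f W V"
    and B: "\<And>x y. B x y \<longleftrightarrow> x \<in> W \<and> y \<in> W \<and> A (f x) (f y)"
  shows "minuscule W B (\<lambda>x y. D (f x) (f y))"
proof -
  interpret M: minuscule V A D by fact
  have fV: "f x \<in> V" if "x \<in> W" for x using f that bij_betwE by blast
  have inj: "f x = f y \<longleftrightarrow> x = y" if "x \<in> W" "y \<in> W" for x y
    using f that by (auto simp: bij_betw_def inj_on_def)
  have pre: "\<exists>x\<in>W. f x = v" if "v \<in> V" for v using f that by (force simp: bij_betw_def)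
  show ?thesis
  proof
    show "B\<^sup>*\<^sup>* x y" if "x \<in> W" "y \<in> W" for x y
    proof -
      have "\<forall>z\<in>W. f z = v \<longrightarrow> B\<^sup>*\<^sup>* x z" if "v \<in> V" for v
        using fV[OF \<open>x \<in> W\<close>] that
      proof (induction rule: M.V_induct)
        case base
        then show ?case using inj that \<open>x \<in> W\<close> by auto
      next
        case (step v u)
        show ?case
        proof (intro ballI impI)
          fix z assume z: "z \<in> W" "f z = u"
          obtain y where y: "y \<in> W" "f y = v" using pre step by blast
          then have "B y z" using B z step by auto
          moreover have "B\<^sup>*\<^sup>* x y" using step y by blast
          ultimately show "B\<^sup>*\<^sup>* x z" by simp
        qed
      qed
      then show ?thesis using that fV by blast
    qed
    show "\<exists>w. B y w \<and> B z w \<and> (\<forall>s\<in>W. D (f s) (f w) - D (f s) (f z) = D (f s) (f y) - D (f s) (f x))"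
      if "B x y" "B x z" "z \<noteq> y" "\<not> B y z" for x y z
    proof -
      have W: "x \<in> W" "y \<in> W" "z \<in> W" using that B by auto
      have "A (f x) (f y)" "A (f x) (f z)" "f z \<noteq> f y" "\<not> A (f y) (f z)"
        using that B W inj by auto
      then obtain v where v: "A (f y) v" "A (f z) v" "\<forall>s\<in>V. D s v - D s (f z) = D s (f y) - D s (f x)"
        using M.parallelogram by blast
      obtain w where w: "w \<in> W" "f w = v" using pre v M.A_V2 by blast
      then show ?thesis using v B W fV by (intro exI[of _ w]) auto
    qed
    show "finite W" using f M.finite_V bij_betw_finite by blast
    show "D (f x) (f z) = 2" if "B x y" "B y z" "x \<noteq> z" "\<not> B x z" for x y z
      using that B inj M.D_two[of "f x" "f y" "f z"] by auto
  qed (use B M.A_sym M.A_irrefl M.D_self M.D_sym M.D_adj fV in auto)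
qed

abbreviation adjG :: "'a pair_pre_digraph \<Rightarrow> 'a \<Rightarrow> 'a \<Rightarrow> bool" where
  "adjG G \<equiv> (\<lambda>x y. (x, y) \<in> parcs G)"

subsection \<open>Counting differing coordinates\<close>

text \<open>Words are taken as functions so that lists (Hamming graphs, demicubes) and indicator
  functions of sets (Johnson graphs) share one calculus.\<close>

definition hm :: "nat \<Rightarrow> (nat \<Rightarrow> 'b) \<Rightarrow> (nat \<Rightarrow> 'b) \<Rightarrow> nat" where
  "hm n x y = (\<Sum>i<n. of_bool (x i \<noteq> y i))"

lemma hm_card: "hm n x y = card {i. i < n \<and> x i \<noteq> y i}"
  unfolding hm_def by (simp add: sum.If_cases of_bool_def) (simp add: Int_def conj_commute)

lemma hm_sym: "hm n x y = hm n y x" unfolding hm_def by (intro sum.cong) auto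

lemma hm_cong:
  "(\<And>i. i < n \<Longrightarrow> x i = x' i) \<Longrightarrow> (\<And>i. i < n \<Longrightarrow> y i = y' i) \<Longrightarrow> hm n x y = hm n x' y'"
  unfolding hm_def by (intro sum.cong) auto

lemma hm_0: "hm n x y = 0 \<longleftrightarrow> (\<forall>i<n. x i = y i)" unfolding hm_def by auto

lemma hm_self: "hm n x x = 0" by (simp add: hm_0)

lemma hm_triangle: "hm n x z \<le> hm n x y + hm n y z"
  unfolding hm_def sum.distrib[symmetric] by (intro sum_mono) auto

text \<open>Equality in the triangle inequality holds coordinatewise: a position where x differs
  from both y and z counts at most once on the left and twice on the right.\<close>

lemma hm_additive:
  assumes "hm n y z = hm n x y + hm n x z" "i < n" shows "x i = y i \<or> x i = z i"
proof (rule ccontr)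
  assume n: "\<not> (x i = y i \<or> x i = z i)"
  have "hm n y z < hm n x y + hm n x z"
    unfolding hm_def sum.distrib[symmetric] 
    by (rule sum_strict_mono_ex1) (use n assms(2) in \<open>auto intro!: bexI[of _ i]\<close>)
  with assms(1) show False by simp
qed

text \<open>At each position w takes the value of y or z that x does not take up, so w and x
  together show the same two letters as y and z. This is the corner y + z - x.\<close>

lemma hm_par:
  assumes "\<And>i. i < n \<Longrightarrow> x i = y i \<or> x i = z i" "\<And>i. i < n \<Longrightarrow> w i = (if x i = y i then z i else y i)"
  shows "hm n s w + hm n s x = hm n s y + hm n s z"
proof -
  have "of_bool (s i \<noteq> w i) + of_bool (s i \<noteq> x i) = (of_bool (s i \<noteq> y i) + of_bool (s i \<noteq> z i) :: nat)"
    if "i < n" for i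
    using assms(1)[OF that] assms(2)[OF that] by (cases "x i = y i") auto
  then show ?thesis unfolding hm_def sum.distrib[symmetric] by (intro sum.cong) auto
qed

lemma hm_upd:
  assumes "i < n" "x i \<noteq> y i"
  shows "hm n (x(i := y i)) y + 1 = hm n x y" "hm n x (x(i := y i)) = 1"
proof -
  have s: "(\<Sum>j<n. f j) = f i + (\<Sum>j\<in>{..<n}-{i}. f j)" for f :: "nat \<Rightarrow> nat"
    using assms(1) by (intro sum.remove) auto
  show "hm n (x(i := y i)) y + 1 = hm n x y" "hm n x (x(i := y i)) = 1"
    unfolding hm_def using assms by (simp_all add: s)
qed

lemma hm_upd2:
  assumes "i < n" "x i \<noteq> y i" "j < n" "x j \<noteq> y j" "i \<noteq> j"
  defines "z \<equiv> x(i := y i, j := y j)"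
  shows "hm n z y + 2 = hm n x y" "hm n x z = 2"
proof -
  have j: "(x(i := y i)) j \<noteq> y j" using assms by simp
  show 1: "hm n z y + 2 = hm n x y"
    using hm_upd(1)[of i n x y, OF assms(1,2)] hm_upd(1)[of j n "x(i := y i)" y, OF assms(3) j] by (simp add: z_def)
  have "hm n x z \<le> 2"
    using hm_triangle[of n x z "x(i := y i)"] hm_upd(2)[of i n x y, OF assms(1,2)]
      hm_upd(2)[of j n "x(i := y i)" y, OF assms(3) j] by (simp add: z_def)
  then show "hm n x z = 2" using hm_triangle[of n x y z] 1 by simp
qed

lemma hm_two_positions:
  assumes "2 \<le> hm n x y" obtains i j where "i < n" "x i \<noteq> y i" "j < n" "x j \<noteq> y j" "i \<noteq> j"
proof -
  have c: "2 \<le> card {i. i < n \<and> x i \<noteq> y i}" using assms unfolding hm_card .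
  then obtain i where i: "i < n \<and> x i \<noteq> y i"
    by (metis (mono_tags, lifting) card_eq_0_iff empty_Collect_eq not_numeral_le_zero)
  have "\<exists>j. j < n \<and> x j \<noteq> y j \<and> j \<noteq> i"
  proof (rule ccontr)
    assume "\<not> ?thesis"
    then have "{i. i < n \<and> x i \<noteq> y i} \<subseteq> {i}" by auto
    then have "card {i. i < n \<and> x i \<noteq> y i} \<le> card {i}" by (intro card_mono) auto
    then show False using c by simp
  qed
  then show ?thesis using i that by blast
qed

definition wt :: "nat \<Rightarrow> (nat \<Rightarrow> bool) \<Rightarrow> nat" where "wt n x = (\<Sum>i<n. of_bool (x i))"

lemma hm_wt: "hm n x y + 2 * wt n (\<lambda>i. x i \<and> y i) = wt n x + wt n y"
  unfolding hm_def wt_def sum_distrib_left sum.distrib[symmetric] by (intro sum.cong) auto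

lemma even_hm: "even (wt n x) \<Longrightarrow> even (wt n y) \<Longrightarrow> even (hm n x y)"
  using arg_cong[OF hm_wt[of n x y], of even] by simp

lemma even_wt: "even (wt n x) \<Longrightarrow> even (hm n x y) \<Longrightarrow> even (wt n y)"
  using arg_cong[OF hm_wt[of n x y], of even] by simp

lemma hamming_distance_hm: "length v = n \<Longrightarrow> hamming_distance v w = hm n ((!) v) ((!) w)"
  unfolding hamming_distance_def hm_card by simp

subsection \<open>The concrete graphs are minuscule\<close>

lemma list_par:
  assumes len: "length x = n" "length y = n" "length z = n"
    and eq: "hm n ((!) y) ((!) z) = hm n ((!) x) ((!) y) + hm n ((!) x) ((!) z)"
  obtains w where "length w = n" "\<And>s. hm n ((!) s) ((!) w) + hm n ((!) s) ((!) x) = hm n ((!) s) ((!) y) + hm n ((!) s) ((!) z)"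
    "set w \<subseteq> set y \<union> set z"
proof
  define w where "w = map (\<lambda>i. if x ! i = y ! i then z ! i else y ! i) [0..<n]"
  show "length w = n" by (simp add: w_def)
  show "hm n ((!) s) ((!) w) + hm n ((!) s) ((!) x) = hm n ((!) s) ((!) y) + hm n ((!) s) ((!) z)" for s
    by (rule hm_par) (use hm_additive[OF eq] in \<open>auto simp: w_def\<close>)
  show "set w \<subseteq> set y \<union> set z" using len by (auto simp: w_def)
qed

lemma hm_list_0: "length x = n \<Longrightarrow> length y = n \<Longrightarrow> hm n ((!) x) ((!) y) = 0 \<longleftrightarrow> x = y"
  unfolding hm_0 by (auto simp: list_eq_iff_nth_eq)

lemma hm_list_upd: "i < n \<Longrightarrow> length x = n \<Longrightarrow> hm n ((!) (x[i := a])) f = hm n (((!) x)(i := a)) f"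
  "i < n \<Longrightarrow> length x = n \<Longrightarrow> hm n f ((!) (x[i := a])) = hm n f (((!) x)(i := a))"
  unfolding hm_def by (intro sum.cong; auto simp: nth_list_update)+

lemma minuscule_hamming:
  "minuscule (pverts (hamming_graph d n)) (adjG (hamming_graph d n)) (\<lambda>x y. real (hm d ((!) x) ((!) y)))"
proof (rule minusculeI)
  let ?V = "pverts (hamming_graph d n)" and ?A = "adjG (hamming_graph d n)" and ?d = "\<lambda>x y. hm d ((!) x) ((!) y)"
  have V: "w \<in> ?V \<longleftrightarrow> length w = d \<and> set w \<subseteq> {..<n}" for w
    by (simp add: hamming_graph_def graph_on_def)
  show "finite ?V" using finite_lists_length_eq[of "{..<n}" d]
    by (simp add: hamming_graph_def graph_on_def conj_commute)
  show A: "?A x y \<longleftrightarrow> x \<in> ?V \<and> y \<in> ?V \<and> ?d x y = 1" for x y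
    using hamming_distance_hm[of x d y] by (auto simp: hamming_graph_def graph_on_def)
  show "?d x y = 0 \<longleftrightarrow> x = y" if "x \<in> ?V" "y \<in> ?V" for x y
    using hm_list_0[of x d y] that V by auto
  show "?d x y = ?d y x" for x y by (rule hm_sym)
  show "?d x z \<le> 2" if "?A x y" "?A y z" for x y z
    using that A hm_triangle[of d "(!) x" "(!) z" "(!) y"] by simp
  show "\<exists>z. ?A x z \<and> ?d z y < ?d x y" if xy: "x \<in> ?V" "y \<in> ?V" and gt: "1 < ?d x y" for x y
  proof -
    obtain i where i: "i < d" "x ! i \<noteq> y ! i" using hm_0[of d "(!) x" "(!) y"] gt by auto
    have l: "length x = d" using xy V by auto
    have "x[i := y ! i] \<in> ?V" using i xy V set_update_subset_insert[of x i "y ! i"]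
      by (auto dest!: subsetD simp: subset_iff)
    then show ?thesis
      using hm_upd[of i d "(!) x" "(!) y"] i xy A hm_list_upd[OF i(1) l]
      by (intro exI[of _ "x[i := y ! i]"]) auto
  qed
  show "\<exists>w\<in>?V. \<forall>s\<in>?V. ?d s w + ?d s x = ?d s y + ?d s z" if xyz: "?A x y" "?A x z" "?d y z = 2" for x y z
  proof -
    have l: "length x = d" "length y = d" "length z = d" using xyz V A by auto
    obtain w where w: "length w = d" "set w \<subseteq> set y \<union> set z" "\<And>s. ?d s w + ?d s x = ?d s y + ?d s z"
      using list_par[OF l] xyz A by (metis one_add_one)
    then have "w \<in> ?V" using V xyz A by (metis Un_subset_iff subset_trans)
    then show ?thesis using w by blast
  qed
qed

lemma count_list_wt: "count_list w True = wt (length w) ((!) w)"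
proof (induction w)
  case (Cons a w)
  then show ?case by (simp add: wt_def sum.lessThan_Suc_shift del: sum.lessThan_Suc)
qed (simp add: wt_def)

lemma pverts_demicube: "w \<in> pverts (demicube_graph n) \<longleftrightarrow> length w = n \<and> even (wt n ((!) w))"
  using count_list_wt[of w] by (auto simp: demicube_graph_def graph_on_def)

lemma adj_demicube:
  "adjG (demicube_graph n) x y \<longleftrightarrow>
    x \<in> pverts (demicube_graph n) \<and> y \<in> pverts (demicube_graph n) \<and> hm n ((!) x) ((!) y) = 2"
  using hamming_distance_hm[of x n y] by (auto simp: demicube_graph_def graph_on_def)

text \<open>Arcs join words at Hamming distance two, so the kernel is half that distance; words of
  even weight have even distances, which makes the division exact.\<close>

lemma minuscule_demicube:
  "minuscule (pverts (demicube_graph n)) (adjG (demicube_graph n)) (\<lambda>x y. real (hm n ((!) x) ((!) y) div 2))"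
proof (rule minusculeI)
  let ?V = "pverts (demicube_graph n)" and ?A = "adjG (demicube_graph n)" and ?h = "\<lambda>x y. hm n ((!) x) ((!) y)"
  have V: "w \<in> ?V \<longleftrightarrow> length w = n \<and> even (wt n ((!) w))" for w by (rule pverts_demicube)
  have ev: "even (?h x y)" if "x \<in> ?V" "y \<in> ?V" for x y using that even_hm V by blast
  have "?V \<subseteq> {w. set w \<subseteq> UNIV \<and> length w = n}" by (auto simp: V)
  then show "finite ?V" using finite_subset[OF _ finite_lists_length_eq[of "UNIV :: bool set" n]] by auto
  show A: "?A x y \<longleftrightarrow> x \<in> ?V \<and> y \<in> ?V \<and> ?h x y div 2 = 1" for x y
    using adj_demicube[of x y n] ev[of x y] by (auto elim!: evenE)
  show "?h x y div 2 = 0 \<longleftrightarrow> x = y" if "x \<in> ?V" "y \<in> ?V" for x y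
    using hm_list_0[of x n y] ev[OF that] that V by (auto elim!: evenE)
  show "?h x y div 2 = ?h y x div 2" for x y by (simp add: hm_sym)
  show "?h x z div 2 \<le> 2" if "?A x y" "?A y z" for x y z
    using that adj_demicube hm_triangle[of n "(!) x" "(!) z" "(!) y"] by simp
  show "\<exists>z. ?A x z \<and> ?h z y div 2 < ?h x y div 2" if xy: "x \<in> ?V" "y \<in> ?V" and gt: "1 < ?h x y div 2" for x y
  proof -
    have h2: "2 \<le> ?h x y" using gt by auto
    obtain i j where ij: "i < n" "x ! i \<noteq> y ! i" "j < n" "x ! j \<noteq> y ! j" "i \<noteq> j"
      using hm_two_positions[of n "(!) x" "(!) y"] h2 by blast
    define z where "z = x[i := y ! i, j := y ! j]"
    have l: "length x = n" "length z = n" using xy V by (auto simp: z_def)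
    have "?h z y = hm n (((!) x)(i := y ! i, j := y ! j)) ((!) y)"
      "?h x z = hm n ((!) x) (((!) x)(i := y ! i, j := y ! j))"
      using l ij by (auto intro!: hm_cong simp: z_def nth_list_update)
    then have z: "?h z y + 2 = ?h x y" "?h x z = 2"
      using hm_upd2[of i n "(!) x" "(!) y" j] ij by simp_all
    have "even (wt n ((!) z))" using even_wt[of n "(!) x" "(!) z"] xy V z by simp
    then have "?A x z" using adj_demicube l z xy V by blast
    then show ?thesis using z by (intro exI[of _ z]) auto
  qed
  show "\<exists>w\<in>?V. \<forall>s\<in>?V. ?h s w div 2 + ?h s x div 2 = ?h s y div 2 + ?h s z div 2"
    if xyz: "?A x y" "?A x z" "?h y z div 2 = 2" for x y z
  proof -
    have W: "x \<in> ?V" "y \<in> ?V" "z \<in> ?V" using xyz A by auto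
    have l: "length x = n" "length y = n" "length z = n" using W V by auto
    have h: "?h y z = 4" "?h x y = 2" "?h x z = 2"
      using xyz ev[OF W(2,3)] adj_demicube by (auto elim!: evenE)
    obtain w where w: "length w = n" "\<And>s. ?h s w + ?h s x = ?h s y + ?h s z"
      using list_par[OF l] h by (metis numeral_Bit0)
    \<comment> \<open>An even distance from x forces even weight, so the corner stays in the
      demicube.\<close>
    have "?h x w = 4" using w(2)[of x] h hm_self[of n "(!) x"] by simp
    then have wV: "w \<in> ?V" using V w(1) even_wt[of n "(!) x" "(!) w"] W by simp
    have "?h s w div 2 + ?h s x div 2 = ?h s y div 2 + ?h s z div 2" if "s \<in> ?V" for s
      using w(2)[of s] ev[OF that wV] ev[OF that W(1)] ev[OF that W(2)] ev[OF that W(3)]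
      by (auto elim!: evenE)
    then show ?thesis using wV by blast
  qed
qed

lemma card_wt: "S \<subseteq> {..<n} \<Longrightarrow> card S = wt n (\<lambda>i. i \<in> S)"
  unfolding wt_def by (simp add: sum.If_cases of_bool_def Int_absorb1 Collect_mem_eq)

lemma pverts_johnson: "S \<in> pverts (johnson_graph n k) \<longleftrightarrow> S \<subseteq> {..<n} \<and> card S = k"
  by (simp add: johnson_graph_def graph_on_def)

lemma card_Int_hm:
  assumes "S \<in> pverts (johnson_graph n k)" "T \<in> pverts (johnson_graph n k)"
  shows "hm n (\<lambda>i. i \<in> S) (\<lambda>i. i \<in> T) + 2 * card (S \<inter> T) = 2 * k"
proof -
  have "S \<inter> T \<subseteq> {..<n}" using assms pverts_johnson by blast
  then show ?thesis
    using hm_wt[of n "\<lambda>i. i \<in> S" "\<lambda>i. i \<in> T"] card_wt[of S n] card_wt[of T n] card_wt[of "S \<inter> T" n] assms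
    by (simp add: pverts_johnson)
qed

lemma adj_johnson:
  "adjG (johnson_graph n k) S T \<longleftrightarrow>
    S \<in> pverts (johnson_graph n k) \<and> T \<in> pverts (johnson_graph n k) \<and> hm n (\<lambda>i. i \<in> S) (\<lambda>i. i \<in> T) = 2"
proof (cases "S \<in> pverts (johnson_graph n k) \<and> T \<in> pverts (johnson_graph n k)")
  case True
  then have "card (S \<inter> T) + 1 = k \<longleftrightarrow> hm n (\<lambda>i. i \<in> S) (\<lambda>i. i \<in> T) = 2"
    using card_Int_hm[of S n k T] by auto
  then show ?thesis using True by (auto simp: johnson_graph_def graph_on_def)
qed (auto simp: johnson_graph_def graph_on_def)

lemma minuscule_johnson:
  "minuscule (pverts (johnson_graph n k)) (adjG (johnson_graph n k)) (\<lambda>S T. real (hm n (\<lambda>i. i \<in> S) (\<lambda>i. i \<in> T) div 2))"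
proof (rule minusculeI)
  let ?V = "pverts (johnson_graph n k)" and ?A = "adjG (johnson_graph n k)"
    and ?h = "\<lambda>S T. hm n (\<lambda>i. i \<in> S) (\<lambda>i. i \<in> T)"
  have V: "S \<in> ?V \<longleftrightarrow> S \<subseteq> {..<n} \<and> wt n (\<lambda>i. i \<in> S) = k" for S
    using card_wt[of S n] by (auto simp: pverts_johnson)
  have ev: "even (?h x y)" if "x \<in> ?V" "y \<in> ?V" for x y using card_Int_hm[OF that] by presburger
  show "finite ?V" by (rule finite_subset[of _ "Pow {..<n}"]) (auto simp: pverts_johnson)
  show A: "?A x y \<longleftrightarrow> x \<in> ?V \<and> y \<in> ?V \<and> ?h x y div 2 = 1" for x y
    using adj_johnson[of x y n k] ev[of x y] by (auto elim!: evenE)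
  show "?h x y div 2 = 0 \<longleftrightarrow> x = y" if "x \<in> ?V" "y \<in> ?V" for x y
  proof -
    have "?h x y = 0 \<longleftrightarrow> x = y" using that unfolding hm_0 V by auto
    then show ?thesis using ev[OF that] by (auto elim!: evenE)
  qed
  show "?h x y div 2 = ?h y x div 2" for x y by (simp add: hm_sym)
  show "?h x z div 2 \<le> 2" if "?A x y" "?A y z" for x y z
    using that adj_johnson hm_triangle[of n "\<lambda>i. i \<in> x" "\<lambda>i. i \<in> z" "\<lambda>i. i \<in> y"] by simp
  show "\<exists>z. ?A x z \<and> ?h z y div 2 < ?h x y div 2" if xy: "x \<in> ?V" "y \<in> ?V" and gt: "1 < ?h x y div 2" for x y
  proof -
    have fin: "finite x" "finite y" using xy finite_subset[of _ "{..<n}"] by (auto simp: pverts_johnson)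
    have ne: "x \<noteq> y" using gt hm_self[of n "\<lambda>i. i \<in> x"] by auto
    have c: "card x = k" "card y = k" using xy by (simp_all add: pverts_johnson)
    have "\<not> x \<subseteq> y" "\<not> y \<subseteq> x"
      using card_subset_eq[OF fin(2), of x] card_subset_eq[OF fin(1), of y] c ne by auto
    then obtain i j where i: "i \<in> x" "i \<notin> y" and j: "j \<in> y" "j \<notin> x" by blast
    define z where "z = insert j (x - {i})"
    have ij: "i < n" "j < n" "i \<noteq> j" using i j xy pverts_johnson by auto
    have zf: "(\<lambda>l. l \<in> z) = (\<lambda>l. l \<in> x)(i := i \<in> y, j := j \<in> y)"
      using i j by (auto simp: z_def fun_eq_iff)
    have z: "?h z y + 2 = ?h x y" "?h x z = 2"
      using hm_upd2[of i n "\<lambda>l. l \<in> x" "\<lambda>l. l \<in> y" j] ij i j unfolding zf by auto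
    have "card z = k" using i j fin c card_Suc_Diff1[OF fin(1) i(1)] by (simp add: z_def)
    then have "z \<in> ?V" using xy ij by (auto simp: pverts_johnson z_def)
    then have "?A x z" using adj_johnson z xy by blast
    then show ?thesis using z by (intro exI[of _ z]) auto
  qed
  show "\<exists>w\<in>?V. \<forall>s\<in>?V. ?h s w div 2 + ?h s x div 2 = ?h s y div 2 + ?h s z div 2"
    if xyz: "?A x y" "?A x z" "?h y z div 2 = 2" for x y z
  proof -
    have W: "x \<in> ?V" "y \<in> ?V" "z \<in> ?V" using xyz A by auto
    have h: "?h y z = 4" "?h x y = 2" "?h x z = 2"
      using xyz ev[OF W(2,3)] adj_johnson by (auto elim!: evenE)
    define w where "w = {i. i < n \<and> (if (i \<in> x) = (i \<in> y) then i \<in> z else i \<in> y)}"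
    have a: "(i \<in> x) = (i \<in> y) \<or> (i \<in> x) = (i \<in> z)" if "i < n" for i
      using hm_additive[of n "\<lambda>i. i \<in> y" "\<lambda>i. i \<in> z" "\<lambda>i. i \<in> x"] h that by simp
    have w: "?h s w + ?h s x = ?h s y + ?h s z" for s
      by (rule hm_par) (use a in \<open>auto simp: w_def\<close>)
    \<comment> \<open>The same coordinatewise exchange preserves total weight, so w again has k
      elements.\<close>
    have "wt n (\<lambda>i. i \<in> w) + wt n (\<lambda>i. i \<in> x) = wt n (\<lambda>i. i \<in> y) + wt n (\<lambda>i. i \<in> z)"
      unfolding wt_def sum.distrib[symmetric]
    proof (rule sum.cong)
      fix i assume "i \<in> {..<n}"
      then show "of_bool (i \<in> w) + of_bool (i \<in> x) = (of_bool (i \<in> y) + of_bool (i \<in> z) :: nat)"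
        using a[of i] by (auto simp: w_def)
    qed simp
    then have wV: "w \<in> ?V" using W V by (auto simp: w_def)
    have "?h s w div 2 + ?h s x div 2 = ?h s y div 2 + ?h s z div 2" if "s \<in> ?V" for s
      using w[of s] ev[OF that wV] ev[OF that W(1)] ev[OF that W(2)] ev[OF that W(3)]
      by (auto elim!: evenE)
    then show ?thesis using wV by blast
  qed
qed

subsection \<open>Cocktail party graphs\<close>

lemma same_half:
  fixes s x y :: nat
  assumes "x \<noteq> y" "x div 2 = y div 2" "s div 2 = x div 2" shows "s = x \<or> s = y"
proof -
  have "even s = even x \<or> even s = even y" "even x \<noteq> even y"
    using assms by (metis bit_eq_rec)+
  then show ?thesis using assms by (metis bit_eq_rec)
qed

text \<open>The two members of a removed matching pair have distances to any s that add up to 2.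
  Hence if y and z are matched, the partner of x is the fourth corner. For connectedness a second
  pair is required, whence \<open>n \<ge> 2\<close>.\<close>

lemma minuscule_cocktail_party:
  assumes "n \<ge> 2"
  shows "minuscule (pverts (cocktail_party_graph n)) (adjG (cocktail_party_graph n))
    (\<lambda>x y. real (if x = y then 0 else if x div 2 = y div 2 then 2 else 1))"
proof (rule minusculeI)
  let ?V = "pverts (cocktail_party_graph n)" and ?A = "adjG (cocktail_party_graph n)"
  define d where "d = (\<lambda>x y :: nat. if x = y then 0 else if x div 2 = y div 2 then 2 else 1 :: nat)"
  have V: "?V = {..<2 * n}" by (simp add: cocktail_party_graph_def graph_on_def)
  show "finite ?V" by (simp add: V)
  show A: "?A x y \<longleftrightarrow> x \<in> ?V \<and> y \<in> ?V \<and> d x y = 1" for x y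
    by (auto simp: cocktail_party_graph_def graph_on_def d_def)
  show "d x y = 0 \<longleftrightarrow> x = y" "d x y = d y x" "d x y \<le> 2" for x y by (auto simp: d_def)
  show "\<exists>z. ?A x z \<and> d z y < d x y" if "x \<in> ?V" "y \<in> ?V" "1 < d x y" for x y
  proof -
    have xy: "x \<noteq> y" "x div 2 = y div 2" using that by (auto simp: d_def split: if_splits)
    define z :: nat where "z = (if x div 2 = 0 then 2 else 0)"
    have z: "z \<noteq> x" "z div 2 \<noteq> x div 2" "z < 2 * n" using assms by (auto simp: z_def)
    have "d x z = 1" "d z y < d x y" using z xy by (auto simp: d_def)
    then show ?thesis using A z that V by auto
  qed
  have two: "d s x + d s y = 2" if "x \<noteq> y" "x div 2 = y div 2" for s x y
  proof (cases "s div 2 = x div 2")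
    case True
    then have "s = x \<or> s = y" using that same_half by blast
    then show ?thesis using that by (auto simp: d_def)
  qed (use that in \<open>auto simp: d_def\<close>)
  show "\<exists>w\<in>?V. \<forall>s\<in>?V. d s w + d s x = d s y + d s z"
    if xyz: "?A x y" "?A x z" "d y z = 2" for x y z
  proof
    define w where "w = (if even x then x + 1 else x - 1)"
    have w: "w \<noteq> x" "w div 2 = x div 2" "w < 2 * n"
      using xyz(1) A V unfolding w_def by (auto elim!: evenE oddE)
    then show "w \<in> ?V" by (simp add: V)
    have "y \<noteq> z" "y div 2 = z div 2" using xyz by (auto simp: d_def split: if_splits)
    then show "\<forall>s\<in>?V. d s w + d s x = d s y + d s z" using two w by auto
  qed
qed

text \<open>An abstract form of the cocktail party graph, so that the 4-demicube and the cocktail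
  party graphs are handled alike; up to isomorphism only the number of vertices is left
  free.\<close>

definition matching_complement :: "'a set \<Rightarrow> ('a \<Rightarrow> 'a \<Rightarrow> bool) \<Rightarrow> bool" where
  "matching_complement N A \<longleftrightarrow>
     (\<forall>y\<in>N. \<exists>z\<in>N. z \<noteq> y \<and> \<not> A y z \<and> (\<forall>u\<in>N. u \<noteq> y \<longrightarrow> u \<noteq> z \<longrightarrow> A y u))"

lemma matching_complement_remove:
  assumes "matching_complement N A" "\<And>x y. A x y \<Longrightarrow> A y x" "y \<in> N" "z \<in> N" "z \<noteq> y" "\<not> A y z"
  shows "matching_complement (N - {y, z}) A"
    and "\<And>u. u \<in> N - {y, z} \<Longrightarrow> A y u \<and> A z u"
proof -
  have sep: "A y u \<and> A z u" if u: "u \<in> N - {y, z}" for u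
    using assms u unfolding matching_complement_def by (metis DiffE insertCI)
  then show "\<And>u. u \<in> N - {y, z} \<Longrightarrow> A y u \<and> A z u" .
  show "matching_complement (N - {y, z}) A"
    unfolding matching_complement_def
  proof
    fix u assume u: "u \<in> N - {y, z}"
    then obtain v where v: "v \<in> N" "v \<noteq> u" "\<not> A u v" "\<forall>t\<in>N. t \<noteq> u \<longrightarrow> t \<noteq> v \<longrightarrow> A u t"
      using assms(1) unfolding matching_complement_def by blast
    have "v \<noteq> y" "v \<noteq> z" using v sep[OF u] assms(2) by blast+
    then show "\<exists>z'\<in>N - {y, z}. z' \<noteq> u \<and> \<not> A u z' \<and> (\<forall>t\<in>N - {y, z}. t \<noteq> u \<longrightarrow> t \<noteq> z' \<longrightarrow> A u t)"
      using v by blast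
  qed
qed

text \<open>One nonadjacent pair is removed on each side. Both its members are adjacent to
  everything left over, so any matching of the two pairs extends an isomorphism of the
  remainders.\<close>

lemma matching_complement_iso:
  assumes "finite N" "finite N'" "card N = card N'"
    and "matching_complement N A" "matching_complement N' B"
    and A: "\<And>x y. A x y \<Longrightarrow> A y x" "\<And>x. \<not> A x x" and B: "\<And>x y. B x y \<Longrightarrow> B y x" "\<And>x. \<not> B x x"
  shows "iso_on N A N' B"
  using assms(1-5)
proof (induction "card N" arbitrary: N N' rule: less_induct)
  case less
  show ?case
  proof (cases "N = {}")
    case True
    then have "N' = {}" using less.prems by simp
    then show ?thesis using True by (auto simp: iso_on_def bij_betw_def)
  next
    case False
    then obtain y z where y: "y \<in> N" "z \<in> N" "z \<noteq> y" "\<not> A y z"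
      using less.prems(4) unfolding matching_complement_def by blast
    have "N' \<noteq> {}" using False less.prems by auto
    then obtain y' z' where y': "y' \<in> N'" "z' \<in> N'" "z' \<noteq> y'" "\<not> B y' z'"
      using less.prems(5) unfolding matching_complement_def by blast
    have r: "matching_complement (N - {y, z}) A" "\<And>u. u \<in> N - {y, z} \<Longrightarrow> A y u \<and> A z u"
      using matching_complement_remove[OF less.prems(4) A(1) y] by blast+
    have r': "matching_complement (N' - {y', z'}) B" "\<And>u. u \<in> N' - {y', z'} \<Longrightarrow> B y' u \<and> B z' u"
      using matching_complement_remove[OF less.prems(5) B(1) y'] by blast+
    have c: "card (N - {y, z}) = card N - 2" "card (N' - {y', z'}) = card N' - 2"
      using y y' less.prems by (simp_all add: card_Diff_subset)
    have "card N > 0" using y less.prems card_gt_0_iff by blast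
    then have "iso_on (N - {y, z}) A (N' - {y', z'}) B"
      using less.prems c r(1) r'(1) by (intro less.hyps) auto
    then obtain f where f: "bij_betw f (N - {y, z}) (N' - {y', z'})"
      "\<forall>u\<in>N - {y, z}. \<forall>v\<in>N - {y, z}. A u v \<longleftrightarrow> B (f u) (f v)" unfolding iso_on_def by blast
    define g where "g u = (if u = y then y' else if u = z then z' else f u)" for u
    show ?thesis
    proof (rule iso_onI)
      have "bij_betw g (N - {y, z}) (N' - {y', z'})"
        using f(1) by (subst bij_betw_cong[of _ g f]) (auto simp: g_def)
      moreover have "bij_betw g {y, z} {y', z'}" using y y' by (auto simp: g_def bij_betw_def)
      ultimately have "bij_betw g (N - {y, z} \<union> {y, z}) (N' - {y', z'} \<union> {y', z'})"
        by (rule bij_betw_combine) auto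
      moreover have "N - {y, z} \<union> {y, z} = N" "N' - {y', z'} \<union> {y', z'} = N'" using y y' by auto
      ultimately show "bij_betw g N N'" by simp
      fix u v assume uv: "u \<in> N" "v \<in> N"
      have fm: "f w \<in> N' - {y', z'}" if "w \<in> N - {y, z}" for w using f(1) that bij_betwE by blast
      consider "u \<in> N - {y, z}" "v \<in> N - {y, z}" | "u \<in> {y, z}" "v \<in> N - {y, z}"
        | "u \<in> N - {y, z}" "v \<in> {y, z}" | "u \<in> {y, z}" "v \<in> {y, z}" using uv by blast
      then show "A u v \<longleftrightarrow> B (g u) (g v)"
      proof cases
        case 1 then show ?thesis using f(2) by (auto simp: g_def)
      next
        case 2
        then have "A u v" using r(2)[of v] by blast
        moreover have "B (g u) (g v)" using r'(2)[OF fm[OF 2(2)]] 2 by (auto simp: g_def split: if_splits)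
        ultimately show ?thesis by simp
      next
        case 3
        then have "A v u" using r(2)[of u] by blast
        then have "A u v" by (rule A(1))
        moreover have "B (g v) (g u)" using r'(2)[OF fm[OF 3(1)]] 3 by (auto simp: g_def)
        then have "B (g u) (g v)" by (rule B(1))
        ultimately show ?thesis by simp
      next
        case 4 
        then have "\<not> A u v" using y(4) A(1)[of z y] A(2)[of y] A(2)[of z] by blast
        moreover have "g u \<in> {y', z'}" "g v \<in> {y', z'}" using 4 by (auto simp: g_def)
        then have "\<not> B (g u) (g v)" using y'(4) B(1)[of z' y'] B(2)[of y'] B(2)[of z'] by auto
        ultimately show ?thesis by simp
      qed
    qed
  qed
qed

lemma cocktail_party_local:
  assumes "n \<ge> 1"
  shows "0 \<in> pverts (cocktail_party_graph n)"
    "card (nb (adjG (cocktail_party_graph n)) 0) = 2 * n - 2"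
    "matching_complement (nb (adjG (cocktail_party_graph n)) 0) (adjG (cocktail_party_graph n))"
proof -
  have N: "nb (adjG (cocktail_party_graph n)) 0 = {2..<2 * n}"
    using assms by (auto simp: nb_def cocktail_party_graph_def graph_on_def)
  show "0 \<in> pverts (cocktail_party_graph n)" using assms by (simp add: cocktail_party_graph_def graph_on_def)
  show "card (nb (adjG (cocktail_party_graph n)) 0) = 2 * n - 2" by (simp add: N)
  show "matching_complement (nb (adjG (cocktail_party_graph n)) 0) (adjG (cocktail_party_graph n))"
    unfolding N matching_complement_def
  proof
    fix x :: nat assume x: "x \<in> {2..<2 * n}"
    define w where "w = (if even x then x + 1 else x - 1)"
    have w: "w \<noteq> x" "w div 2 = x div 2" "w < 2 * n" "2 \<le> w"
      using x unfolding w_def by (auto elim!: evenE oddE)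
    have "u div 2 \<noteq> x div 2" if "u \<noteq> x" "u \<noteq> w" for u using w that same_half[of x w u] by auto
    then show "\<exists>z\<in>{2..<2 * n}. z \<noteq> x \<and> \<not> adjG (cocktail_party_graph n) x z \<and>
        (\<forall>u\<in>{2..<2 * n}. u \<noteq> x \<longrightarrow> u \<noteq> z \<longrightarrow> adjG (cocktail_party_graph n) x u)"
      using x w by (intro bexI[of _ w]) (auto simp: cocktail_party_graph_def graph_on_def)
  qed
qed

subsection \<open>The Gosset and Schlaefli graphs\<close>

lemma pairs_meet:
  assumes "card S = 2" "card T = 2" "card (S \<inter> T) = 1"
  obtains a b c where "S = {a, b}" "T = {a, c}" "a \<noteq> b" "a \<noteq> c" "b \<noteq> c"
proof -
  obtain a where a: "S \<inter> T = {a}" using assms(3) by (auto simp: card_1_singleton_iff)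
  have split: "\<exists>b. X = {a, b} \<and> a \<noteq> b" if "card X = 2" "a \<in> X" for X
    using that by (auto simp: card_2_iff)
  obtain b where b: "S = {a, b}" "a \<noteq> b" using split[OF assms(1)] a by blast
  obtain c where c: "T = {a, c}" "a \<noteq> c" using split[OF assms(2)] a by blast
  have "b \<noteq> c" using a b c by auto
  then show ?thesis using that b c by blast
qed

lemma card_Int_pair: "a \<noteq> b \<Longrightarrow> card (P \<inter> {a, b}) = of_bool (a \<in> P) + of_bool (b \<in> P)"
  by (auto simp: Int_insert_right)

text \<open>In the vector model \<open>(s, S)\<close> is the vector with sign s and 4 on S minus the
  all-one vector, and the corner is y + z - x. The three sign patterns give T + U - S, then S + U -
  T with the other sign, then the complement of S, T, U. Assumption \<open>o\<close> chooses one of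
  two patterns that differ by exchanging y and z.\<close>

lemma gosset_par:
  assumes xyz: "x \<in> gosset_verts" "y \<in> gosset_verts" "z \<in> gosset_verts"
    "gosset_dist x y = 1" "gosset_dist x z = 1" "gosset_dist y z = 2"
    and o: "fst y = fst x \<or> fst z \<noteq> fst x"
  shows "\<exists>w\<in>gosset_verts. \<forall>p\<in>gosset_verts. gosset_dist p w + gosset_dist p x = gosset_dist p y + gosset_dist p z"
proof -
  obtain s S t T u U where st: "x = (s, S)" "y = (t, T)" "z = (u, U)" by (cases x; cases y; cases z)
  have c: "S \<subseteq> {..<8}" "T \<subseteq> {..<8}" "U \<subseteq> {..<8}" "card S = 2" "card T = 2" "card U = 2"
    using xyz unfolding st by (simp_all add: mem_gosset)
  have fin: "finite S" "finite T" "finite U" using c finite_subset by blast+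
  consider "t = s" "u = s" | "t = s" "u \<noteq> s" | "t \<noteq> s" "u \<noteq> s" using o st by auto
  then show ?thesis
  proof cases
    case 1
    then have "card (S \<inter> T) = 1" "card (S \<inter> U) = 1" "card (T \<inter> U) = 0" using xyz by (auto simp: st)
    then have h: "card (S \<inter> T) = 1" "card (S \<inter> U) = 1" "T \<inter> U = {}" using fin by auto
    obtain a b e where e: "S = {a, b}" "T = {a, e}" "a \<noteq> b" "a \<noteq> e" "b \<noteq> e"
      using pairs_meet[OF c(4,5) h(1)] .
    obtain f where f: "U = {b, f}" "f \<noteq> a" "f \<noteq> b" "f \<noteq> e"
      using pairs_meet[OF c(4,6) h(2)] h(3) unfolding e
      by (smt (verit) disjoint_iff doubleton_eq_iff insert_iff)
    have "(s, {e, f}) \<in> gosset_verts" using c e f by (auto simp: mem_gosset)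
    moreover have "gosset_dist p (s, {e, f}) + gosset_dist p x = gosset_dist p y + gosset_dist p z" for p
      using e f by (cases p) (auto simp: st 1 card_Int_pair)
    ultimately show ?thesis by blast
  next
    case 2
    then have h: "card (S \<inter> T) = 1" "S \<inter> U = {}" "card (T \<inter> U) = 1" using xyz fin by (auto simp: st)
    obtain a b e where e: "S = {a, b}" "T = {a, e}" "a \<noteq> b" "a \<noteq> e" "b \<noteq> e"
      using pairs_meet[OF c(4,5) h(1)] .
    obtain f where f: "U = {e, f}" "f \<noteq> a" "f \<noteq> b" "f \<noteq> e"
      using pairs_meet[OF c(5,6) h(3)] h(2) unfolding e
      by (smt (verit) disjoint_iff doubleton_eq_iff insert_iff)
    have "(u, {b, f}) \<in> gosset_verts" using c e f by (auto simp: mem_gosset)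
    moreover have "gosset_dist p (u, {b, f}) + gosset_dist p x = gosset_dist p y + gosset_dist p z" for p
      using e f 2 by (cases p) (auto simp: st card_Int_pair)
    ultimately show ?thesis by blast
  next
    case 3
    then have "card (S \<inter> T) = 0" "card (S \<inter> U) = 0" "card (T \<inter> U) = 0" using xyz by (auto simp: st)
    then have h: "S \<inter> T = {}" "S \<inter> U = {}" "T \<inter> U = {}" using fin by auto
    \<comment> \<open>Three disjoint pairs leave exactly one further pair of the eight points; every
      P meets the four pairs in two points altogether.\<close>
    define R where "R = {..<8} - (S \<union> T \<union> U)"
    have "card (S \<union> T \<union> U) = 6"
      using h c fin by (simp add: card_Un_disjoint Int_Un_distrib2)
    then have "card R = 2" unfolding R_def using c fin by (subst card_Diff_subset) auto
    then have "(s, R) \<in> gosset_verts" by (auto simp: mem_gosset R_def)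
    moreover have "gosset_dist p (s, R) + gosset_dist p x = gosset_dist p y + gosset_dist p z"
      if p: "p \<in> gosset_verts" for p
    proof -
      obtain q P where q: "p = (q, P)" by (cases p)
      have P: "P \<subseteq> {..<8}" "card P = 2" using p by (auto simp: q mem_gosset)
      have finP: "finite P" using P finite_subset by blast
      have "P = (P \<inter> R) \<union> (P \<inter> S) \<union> (P \<inter> T) \<union> (P \<inter> U)" using P by (auto simp: R_def)
      moreover have "card ((P \<inter> R) \<union> (P \<inter> S) \<union> (P \<inter> T) \<union> (P \<inter> U)) =
          card (P \<inter> R) + card (P \<inter> S) + card (P \<inter> T) + card (P \<inter> U)"
        using h finP by (subst card_Un_disjoint, auto simp: R_def)+
      ultimately have "card (P \<inter> R) + card (P \<inter> S) + card (P \<inter> T) + card (P \<inter> U) = 2" using P by simp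
      then show ?thesis using 3 by (auto simp: q st)
    qed
    ultimately show ?thesis by blast
  qed
qed

lemma minuscule_gosset: "minuscule gosset_verts (adjG gosset_graph) (\<lambda>x y. real (gosset_dist x y))"
proof (rule minusculeI)
  show A: "adjG gosset_graph x y \<longleftrightarrow> x \<in> gosset_verts \<and> y \<in> gosset_verts \<and> gosset_dist x y = 1" for x y
    by (rule parcs_gosset)
  show "gosset_dist x z \<le> 2" if "adjG gosset_graph x y" "adjG gosset_graph y z" for x y z
    using gosset_counts[of x y] that unfolding gosset_counts_def A by force
  show "\<exists>z. adjG gosset_graph x z \<and> gosset_dist z y < gosset_dist x y"
    if xy: "x \<in> gosset_verts" "y \<in> gosset_verts" "1 < gosset_dist x y" for x y
  proof -
    have "gosset_dist y x \<in> {2, 3}" using gosset_dist_le[OF xy(1,2)] xy(3) by (auto simp: gosset_dist_commute)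
    then have "[0, 1, 10, 27] ! gosset_dist y x \<noteq> (0 :: nat)" by auto
    then have "card {z \<in> gosset_verts. gosset_dist x z = 1 \<and> Suc (gosset_dist y z) = gosset_dist y x} \<noteq> 0"
      using gosset_counts[OF xy(2,1)] unfolding gosset_counts_def by metis
    then have "{z \<in> gosset_verts. gosset_dist x z = 1 \<and> Suc (gosset_dist y z) = gosset_dist y x} \<noteq> {}"
      by (metis card.empty)
    then obtain z where "z \<in> gosset_verts" "gosset_dist x z = 1" "Suc (gosset_dist y z) = gosset_dist y x" by blast
    then show ?thesis using xy A by (metis gosset_dist_commute lessI)
  qed
  show "\<exists>w\<in>gosset_verts. \<forall>s\<in>gosset_verts. gosset_dist s w + gosset_dist s x = gosset_dist s y + gosset_dist s z"
    if "adjG gosset_graph x y" "adjG gosset_graph x z" "gosset_dist y z = 2" for x y z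
  proof (cases "fst y = fst x \<or> fst z \<noteq> fst x")
    case True
    then show ?thesis using gosset_par[of x y z] that A by blast
  next
    case False
    then show ?thesis using gosset_par[of x z y] that A by (simp add: gosset_dist_commute add.commute)
  qed
qed (auto simp: finite_gosset gosset_dist_eq_0 gosset_dist_commute simp del: gosset_dist.simps)

subsection \<open>Local graphs of the concrete graphs\<close>

text \<open>This shape is the neighbourhood of a cell in a grid, and grids are the local graphs of
  Johnson graphs.\<close>

lemma two_cliques_iso:
  assumes N: "N = C1 \<union> C2" "C1 \<inter> C2 = {}" "finite C1" "finite C2"
    and A: "\<And>y z. y \<in> C1 \<Longrightarrow> z \<in> C1 \<Longrightarrow> A y z \<longleftrightarrow> y \<noteq> z" "\<And>y z. y \<in> C2 \<Longrightarrow> z \<in> C2 \<Longrightarrow> A y z \<longleftrightarrow> y \<noteq> z"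
      "\<And>y z. y \<in> C1 \<Longrightarrow> z \<in> C2 \<Longrightarrow> \<not> A y z \<and> \<not> A z y"
    and N': "N' = C1' \<union> C2'" "C1' \<inter> C2' = {}" "finite C1'" "finite C2'"
    and B: "\<And>y z. y \<in> C1' \<Longrightarrow> z \<in> C1' \<Longrightarrow> B y z \<longleftrightarrow> y \<noteq> z" "\<And>y z. y \<in> C2' \<Longrightarrow> z \<in> C2' \<Longrightarrow> B y z \<longleftrightarrow> y \<noteq> z"
      "\<And>y z. y \<in> C1' \<Longrightarrow> z \<in> C2' \<Longrightarrow> \<not> B y z \<and> \<not> B z y"
    and card: "card C1 = card C1'" "card C2 = card C2'"
  shows "iso_on N A N' B"
proof -
  obtain f1 where f1: "bij_betw f1 C1 C1'" using finite_same_card_bij[OF N(3) N'(3) card(1)] by blast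
  obtain f2 where f2: "bij_betw f2 C2 C2'" using finite_same_card_bij[OF N(4) N'(4) card(2)] by blast
  define f where "f x = (if x \<in> C1 then f1 x else f2 x)" for x
  have b1: "bij_betw f C1 C1'" using f1 by (subst bij_betw_cong[of _ f f1]) (auto simp: f_def)
  have b2: "bij_betw f C2 C2'" using f2 N(2) by (subst bij_betw_cong[of _ f f2]) (auto simp: f_def)
  have m: "\<And>x. x \<in> C1 \<Longrightarrow> f x \<in> C1'" "\<And>x. x \<in> C2 \<Longrightarrow> f x \<in> C2'"
    using bij_betwE[OF b1] bij_betwE[OF b2] by blast+
  have b: "bij_betw f N N'" unfolding N(1) N'(1) using b1 b2 N'(2) by (rule bij_betw_combine)
  show ?thesis
  proof (rule iso_onI[OF b])
    fix x y assume xy: "x \<in> N" "y \<in> N"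
    have e: "f x = f y \<longleftrightarrow> x = y" using b xy by (auto simp: bij_betw_def inj_on_def)
    consider "x \<in> C1" "y \<in> C1" | "x \<in> C1" "y \<in> C2" | "x \<in> C2" "y \<in> C1" | "x \<in> C2" "y \<in> C2"
      using xy N(1) by blast
    then show "A x y \<longleftrightarrow> B (f x) (f y)" by cases (simp_all add: A B m e)
  qed
qed

lemma johnson_adj:
  "adjG (johnson_graph n k) S T \<longleftrightarrow>
     S \<subseteq> {..<n} \<and> card S = k \<and> T \<subseteq> {..<n} \<and> card T = k \<and> card (S \<inter> T) + 1 = k"
  by (auto simp: johnson_graph_def graph_on_def)

text \<open>A neighbour of \<open>{..<k}\<close> arises by removing some a and adding some b, so it
  is a cell (a, b) of a k by n - k grid. The cell of \<open>{1..k}\<close> is (0, k):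
  \<open>C1\<close> keeps a = 0 and varies b, \<open>C2\<close> keeps b = k and varies a.\<close>

lemma johnson_local_local:
  assumes "1 \<le> k" "k < n"
  defines "C1 \<equiv> (\<lambda>b. insert b {1..<k}) ` {k<..<n}" and "C2 \<equiv> (\<lambda>a. {..k} - {a}) ` {1..<k}"
  shows "adjG (johnson_graph n k) {..<k} {1..k}"
    and "nb (loc (adjG (johnson_graph n k)) {..<k}) {1..k} = C1 \<union> C2"
    and "C1 \<inter> C2 = {}" "card C1 = n - k - 1" "card C2 = k - 1"
    and "\<And>S T. S \<in> C1 \<Longrightarrow> T \<in> C1 \<Longrightarrow> adjG (johnson_graph n k) S T \<longleftrightarrow> S \<noteq> T"
    and "\<And>S T. S \<in> C2 \<Longrightarrow> T \<in> C2 \<Longrightarrow> adjG (johnson_graph n k) S T \<longleftrightarrow> S \<noteq> T"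
    and "\<And>S T. S \<in> C1 \<Longrightarrow> T \<in> C2 \<Longrightarrow> \<not> adjG (johnson_graph n k) S T \<and> \<not> adjG (johnson_graph n k) T S"
proof -
  define M where "M = {1..<k}"
  have M: "finite M" "card M = k - 1" "0 \<notin> M" "k \<notin> M" by (auto simp: M_def)
  have x0: "{..<k} = insert 0 M" and y0: "{1..k} = insert k M" and z0: "{..k} = insert 0 (insert k M)"
    using assms by (auto simp: M_def)
  have 1: "card ({..<k} \<inter> {1..k}) + 1 = k"
  proof -
    have "{..<k} \<inter> {1..k} = M" using assms by (auto simp: M_def)
    then show ?thesis using M assms by simp
  qed
  show xy: "adjG (johnson_graph n k) {..<k} {1..k}"
    unfolding johnson_adj using 1 assms by auto
  have T1: "insert b M \<subseteq> {..<n}" "card (insert b M) = k" "{..<k} \<inter> insert b M = M" "{1..k} \<inter> insert b M = M"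
    if "b \<in> {k<..<n}" for b
    using that assms M by (auto simp: M_def)
  have T2: "{..k} - {a} \<subseteq> {..<n}" "card ({..k} - {a}) = k" "card ({..<k} \<inter> ({..k} - {a})) + 1 = k"
     "card ({1..k} \<inter> ({..k} - {a})) + 1 = k"
    if "a \<in> {1..<k}" for a
  proof -
    show "{..k} - {a} \<subseteq> {..<n}" "card ({..k} - {a}) = k" using that assms by auto
    have "{..<k} \<inter> ({..k} - {a}) = {..<k} - {a}" "{1..k} \<inter> ({..k} - {a}) = {1..k} - {a}" by auto
    then show "card ({..<k} \<inter> ({..k} - {a})) + 1 = k" "card ({1..k} \<inter> ({..k} - {a})) + 1 = k"
      using that by auto
  qed
  show N: "nb (loc (adjG (johnson_graph n k)) {..<k}) {1..k} = C1 \<union> C2"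
  proof (intro equalityI subsetI)
    fix T assume "T \<in> nb (loc (adjG (johnson_graph n k)) {..<k}) {1..k}"
    then have T: "T \<subseteq> {..<n}" "card T = k" "card ({..<k} \<inter> T) + 1 = k" "card ({1..k} \<inter> T) + 1 = k"
      unfolding nb_def loc_def johnson_adj by auto
    have fT: "finite T" by (rule finite_subset[OF T(1)]) simp
    have c: "of_bool (0 \<in> T) + card (M \<inter> T) + 1 = k" "of_bool (k \<in> T) + card (M \<inter> T) + 1 = k"
      using T(3,4) M unfolding x0 y0 by (auto simp: Int_insert_left)
    \<comment> \<open>Both counts share the term for \<open>M\<close>, so 0 and k are both in T or
      both outside.\<close>
    then consider "0 \<in> T" "k \<in> T" "card (M \<inter> T) + 2 = k" | "0 \<notin> T" "k \<notin> T" "card (M \<inter> T) + 1 = k"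
      by (auto simp: of_bool_def split: if_splits)
    then show "T \<in> C1 \<union> C2"
    proof cases
      case 1
      have "card (M - M \<inter> T) = 1" using 1 M by (subst card_Diff_subset) auto
      then obtain a where a: "M - M \<inter> T = {a}" by (auto simp: card_1_singleton_iff)
      then have "a \<in> {1..<k}" by (auto simp: M_def)
      have "{..k} - {a} \<subseteq> T" using a 1(1,2) unfolding z0 by blast
      then have "{..k} - {a} = T" using card_subset_eq[OF fT] T2(2)[OF \<open>a \<in> {1..<k}\<close>] T(2) by simp
      then show ?thesis using \<open>a \<in> {1..<k}\<close> unfolding C2_def by blast
    next
      case 2
      have "M \<inter> T = M" using card_subset_eq[OF M(1), of "M \<inter> T"] 2 M assms by auto
      then have "M \<subseteq> T" by blast
      then have "card (T - M) = 1" using M T assms by (subst card_Diff_subset) auto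
      then obtain b where b: "T - M = {b}" by (auto simp: card_1_singleton_iff)
      then have "T = insert b M" "b \<noteq> 0" "b \<noteq> k" "b \<notin> M" "b < n" using \<open>M \<subseteq> T\<close> 2 T(1) by auto
      then have "T = insert b {1..<k}" "b \<in> {k<..<n}" by (auto simp: M_def)
      then show ?thesis unfolding C1_def by blast
    qed
  next
    fix T assume "T \<in> C1 \<union> C2"
    then consider b where "b \<in> {k<..<n}" "T = insert b M" | a where "a \<in> {1..<k}" "T = {..k} - {a}"
      unfolding C1_def C2_def M_def by blast
    then have "T \<subseteq> {..<n} \<and> card T = k \<and> card ({..<k} \<inter> T) + 1 = k \<and> card ({1..k} \<inter> T) + 1 = k"
    proof cases
      case 1 then show ?thesis using T1[of b] M assms by auto
    next
      case 2 then show ?thesis using T2[of a] by blast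
    qed
    then show "T \<in> nb (loc (adjG (johnson_graph n k)) {..<k}) {1..k}"
      using xy unfolding nb_def loc_def johnson_adj by auto
  qed
  show "C1 \<inter> C2 = {}"
  proof -
    have "0 \<notin> S" if "S \<in> C1" for S using that by (auto simp: C1_def)
    moreover have "0 \<in> S" if "S \<in> C2" for S using that by (auto simp: C2_def)
    ultimately show ?thesis by blast
  qed
  have inj1: "inj_on (\<lambda>b. insert b {1..<k}) {k<..<n}"
  proof (rule inj_onI)
    fix b c assume bc: "b \<in> {k<..<n}" "c \<in> {k<..<n}" "insert b {1..<k} = insert c {1..<k}"
    then have "b \<in> insert c {1..<k}" by blast
    then show "b = c" using bc(1) by auto
  qed
  show "card C1 = n - k - 1" unfolding C1_def by (subst card_image[OF inj1]) simp
  have inj2: "inj_on (\<lambda>a. {..k} - {a}) {1..<k}"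
  proof (rule inj_onI)
    fix b c assume bc: "b \<in> {1..<k}" "c \<in> {1..<k}" "{..k} - {b} = {..k} - {c}"
    then have "b \<notin> {..k} - {c}" by blast
    then show "b = c" using bc(1) by auto
  qed
  show "card C2 = k - 1" unfolding C2_def by (subst card_image[OF inj2]) simp
  show "adjG (johnson_graph n k) S T \<longleftrightarrow> S \<noteq> T" if ST: "S \<in> C1" "T \<in> C1" for S T
  proof -
    obtain b c where b: "b \<in> {k<..<n}" "S = insert b M" "c \<in> {k<..<n}" "T = insert c M"
      using ST unfolding C1_def M_def by blast
    have "card (S \<inter> T) + 1 = k \<longleftrightarrow> S \<noteq> T"
    proof (cases "b = c")
      case True then show ?thesis using b T1(2)[of b] by auto
    next
      case False
      have "b \<notin> M" "c \<notin> M" using b by (auto simp: M_def)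
      then have "S \<inter> T = M" "b \<in> S" "b \<notin> T" using b False by auto
      then show ?thesis using M assms(1) by auto
    qed
    moreover have "S \<subseteq> {..<n} \<and> card S = k" "T \<subseteq> {..<n} \<and> card T = k"
      using T1(1,2)[OF b(1)] T1(1,2)[OF b(3)] unfolding b(2,4) by simp_all
    ultimately show ?thesis unfolding johnson_adj by simp
  qed
  show "adjG (johnson_graph n k) S T \<longleftrightarrow> S \<noteq> T" if ST: "S \<in> C2" "T \<in> C2" for S T
  proof -
    obtain b c where b: "b \<in> {1..<k}" "S = {..k} - {b}" "c \<in> {1..<k}" "T = {..k} - {c}"
      using ST unfolding C2_def by blast
    have "card (S \<inter> T) + 1 = k \<longleftrightarrow> S \<noteq> T"
    proof (cases "b = c")
      case True then show ?thesis using b T2(2)[of b] by auto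
    next
      case False
      then have "S \<inter> T = {..k} - {b, c}" using b by auto
      moreover have "b \<in> T" "b \<notin> S" using b False by auto
      moreover have "card ({..k} - {b, c}) = k - 1" using b False by (subst card_Diff_subset) auto
      ultimately show ?thesis using assms(1) by auto
    qed
    moreover have "S \<subseteq> {..<n} \<and> card S = k" "T \<subseteq> {..<n} \<and> card T = k"
      using T2(1,2)[OF b(1)] T2(1,2)[OF b(3)] unfolding b(2,4) by simp_all
    ultimately show ?thesis unfolding johnson_adj by simp
  qed
  show "\<not> adjG (johnson_graph n k) S T \<and> \<not> adjG (johnson_graph n k) T S" if ST: "S \<in> C1" "T \<in> C2" for S T
  proof -
    obtain b c where b: "b \<in> {k<..<n}" "S = insert b M" "c \<in> {1..<k}" "T = {..k} - {c}"
      using ST unfolding C1_def C2_def M_def by blast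
    then have "S \<inter> T = M - {c}" "c \<in> M" by (auto simp: M_def)
    then have "card (S \<inter> T) = card M - 1" "card M > 0" using M(1) card_gt_0_iff by auto
    then have "card (S \<inter> T) + 1 \<noteq> k" using M(2) by linarith
    moreover from this have "card (T \<inter> S) + 1 \<noteq> k" by (simp add: Int_commute)
    ultimately show ?thesis unfolding johnson_adj by blast
  qed
qed

text \<open>In the grid, the cells (a, b) and (e, c) are joined through the cell (a, c), which is
  \<open>U\<close> below.\<close>

lemma johnson_local_connected:
  assumes "A = adjG (johnson_graph n k)" "A {..<k} S" "A {..<k} T"
  shows "(loc A {..<k})\<^sup>*\<^sup>* S T"
proof -
  have ex: "\<exists>a b. a < k \<and> k \<le> b \<and> b < n \<and> S = insert b ({..<k} - {a})" if "A {..<k} S" for S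
  proof -
    have S: "S \<subseteq> {..<n}" "card S = k" "card ({..<k} \<inter> S) + 1 = k" using that assms(1) johnson_adj by auto
    have fS: "finite S" by (rule finite_subset[OF S(1)]) simp
    have "card ({..<k} - {..<k} \<inter> S) = 1" using S by (subst card_Diff_subset) auto
    then obtain a where a: "{..<k} - {..<k} \<inter> S = {a}" by (auto simp: card_1_singleton_iff)
    have "card (S - {..<k} \<inter> S) = 1" using S by (subst card_Diff_subset) auto
    then obtain b where b: "S - {..<k} \<inter> S = {b}" by (auto simp: card_1_singleton_iff)
    have "b \<in> S" "b \<notin> {..<k}" using b by auto
    moreover have "S = insert b ({..<k} - {a})" using a b by blast
    moreover have "a < k" using a by auto
    ultimately show ?thesis using S(1) by (intro exI[of _ a] exI[of _ b]) auto
  qed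
  have adj: "A (insert b ({..<k} - {a})) (insert c ({..<k} - {e}))"
    if "a < k" "k \<le> b" "b < n" "e < k" "k \<le> c" "c < n" "a = e \<and> b \<noteq> c \<or> a \<noteq> e \<and> b = c" for a b c e
  proof -
    have cd: "card (insert b ({..<k} - {a})) = k" if "a < k" "k \<le> b" for a b
      using that by (subst card_insert_disjoint) auto
    have "card (insert b ({..<k} - {a}) \<inter> insert c ({..<k} - {e})) + 1 = k"
    proof (cases "a = e")
      case True
      then have "insert b ({..<k} - {a}) \<inter> insert c ({..<k} - {e}) = {..<k} - {a}" using that by auto
      then show ?thesis using that by auto
    next
      case False
      then have "insert b ({..<k} - {a}) \<inter> insert c ({..<k} - {e}) = insert b ({..<k} - {a, e})" using that by auto
      moreover have "card (insert b ({..<k} - {a, e})) = Suc (k - 2)" using that False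
        by (subst card_insert_disjoint) (auto simp: card_Diff_subset)
      ultimately show ?thesis using that False by auto
    qed
    moreover have "insert b ({..<k} - {a}) \<subseteq> {..<n}" "insert c ({..<k} - {e}) \<subseteq> {..<n}" using that by auto
    ultimately show ?thesis using cd[OF that(1,2)] cd[OF that(4,5)] unfolding assms(1) johnson_adj by blast
  qed
  have xadj: "A {..<k} (insert b ({..<k} - {a}))" if "a < k" "k \<le> b" "b < n" for a b
  proof -
    have "{..<k} \<inter> insert b ({..<k} - {a}) = {..<k} - {a}" using that by auto
    then have "card ({..<k} \<inter> insert b ({..<k} - {a})) + 1 = k" using that by simp
    moreover have "card (insert b ({..<k} - {a})) = k" using that by (subst card_insert_disjoint) auto
    moreover have "insert b ({..<k} - {a}) \<subseteq> {..<n}" "{..<k} \<subseteq> {..<n}" using that by auto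
    moreover have "card {..<k} = k" by simp
    ultimately show ?thesis unfolding assms(1) johnson_adj by blast
  qed
  obtain a b where S: "a < k" "k \<le> b" "b < n" "S = insert b ({..<k} - {a})" using ex[OF assms(2)] by blast
  obtain e c where T: "e < k" "k \<le> c" "c < n" "T = insert c ({..<k} - {e})" using ex[OF assms(3)] by blast
  define U where "U = insert c ({..<k} - {a})"
  have "A {..<k} U" using xadj S T by (simp add: U_def)
  have "S = U \<or> loc A {..<k} S U"
    using adj[of a b a c] S T \<open>A {..<k} U\<close> assms(2) unfolding U_def loc_def by (cases "b = c") auto
  moreover have "U = T \<or> loc A {..<k} U T"
    using adj[of a c e c] S T \<open>A {..<k} U\<close> assms(3) unfolding U_def loc_def by (cases "a = e") auto
  ultimately show ?thesis by (metis r_into_rtranclp rtranclp.rtrancl_refl rtranclp_trans)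
qed

lemma demicube_local:
  shows "replicate n False \<in> pverts (demicube_graph n)"
    and "iso_on (pverts (johnson_graph n 2)) (adjG (johnson_graph n 2))
      (nb (adjG (demicube_graph n)) (replicate n False)) (adjG (demicube_graph n))"
proof -
  have wt0: "wt n ((!) (replicate n False)) = 0" by (simp add: wt_def)
  show o: "replicate n False \<in> pverts (demicube_graph n)" by (simp add: pverts_demicube wt0)
  have hm0: "hm n ((!) (replicate n False)) x = wt n x" for x
    unfolding hm_def wt_def by (intro sum.cong) auto
  have nb: "w \<in> nb (adjG (demicube_graph n)) (replicate n False) \<longleftrightarrow> length w = n \<and> wt n ((!) w) = 2" for w
    using o unfolding nb_def by (auto simp: adj_demicube hm0) (auto simp: pverts_demicube)
  define f where "f S = map (\<lambda>i. i \<in> S) [0..<n]" for S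
  have wtf: "wt n ((!) (f S)) = wt n (\<lambda>i. i \<in> S)" for S
    unfolding wt_def by (intro sum.cong) (auto simp: f_def)
  have hmf: "hm n ((!) (f S)) ((!) (f T)) = hm n (\<lambda>i. i \<in> S) (\<lambda>i. i \<in> T)" for S T
    by (rule hm_cong) (auto simp: f_def)
  have fV: "f S \<in> nb (adjG (demicube_graph n)) (replicate n False)" if "S \<in> pverts (johnson_graph n 2)" for S
    using that card_wt[of S n] unfolding nb by (simp add: wtf pverts_johnson) (simp add: f_def)
  show "iso_on (pverts (johnson_graph n 2)) (adjG (johnson_graph n 2))
      (nb (adjG (demicube_graph n)) (replicate n False)) (adjG (demicube_graph n))"
  proof (rule iso_onI)
    show "bij_betw f (pverts (johnson_graph n 2)) (nb (adjG (demicube_graph n)) (replicate n False))"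
    proof (rule bij_betwI[where g = "\<lambda>w. {i. i < n \<and> w ! i}"])
      show "(\<lambda>w. {i. i < n \<and> w ! i}) \<in> nb (adjG (demicube_graph n)) (replicate n False) \<rightarrow> pverts (johnson_graph n 2)"
      proof
        fix w assume "w \<in> nb (adjG (demicube_graph n)) (replicate n False)"
        then have w: "wt n ((!) w) = 2" using nb by blast
        have "{i. i < n \<and> w ! i} \<subseteq> {..<n}" by auto
        moreover have "wt n (\<lambda>i. i \<in> {i. i < n \<and> w ! i}) = wt n ((!) w)"
          unfolding wt_def by (intro sum.cong) auto
        ultimately have "card {i. i < n \<and> w ! i} = 2" using w card_wt by simp
        then show "{i. i < n \<and> w ! i} \<in> pverts (johnson_graph n 2)" unfolding pverts_johnson by auto
      qed
      show "{i. i < n \<and> f S ! i} = S" if "S \<in> pverts (johnson_graph n 2)" for S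
        using that by (auto simp: f_def pverts_johnson)
      show "f {i. i < n \<and> w ! i} = w" if "w \<in> nb (adjG (demicube_graph n)) (replicate n False)" for w
        using that unfolding nb by (auto simp: f_def intro!: nth_equalityI)
    qed (use fV in blast)
    fix S T assume ST: "S \<in> pverts (johnson_graph n 2)" "T \<in> pverts (johnson_graph n 2)"
    then have "f S \<in> pverts (demicube_graph n)" "f T \<in> pverts (demicube_graph n)"
      using fV adj_demicube unfolding nb_def by blast+
    then show "adjG (johnson_graph n 2) S T \<longleftrightarrow> adjG (demicube_graph n) (f S) (f T)"
      using ST by (simp add: adj_johnson adj_demicube hmf)
  qed
qed

section \<open>Descent along the number of common neighbours\<close>

definition complete_on :: "'a set \<Rightarrow> ('a \<Rightarrow> 'a \<Rightarrow> bool) \<Rightarrow> bool" where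
  "complete_on V A \<longleftrightarrow> (\<forall>x\<in>V. \<forall>y\<in>V. x \<noteq> y \<longrightarrow> A x y)"

text \<open>The intersection number c2 as a property of the relation. It is vacuous for a complete
  graph, where every e qualifies; hence the accompanying assumption that the graph is not
  complete.\<close>

definition mu_on :: "('a \<Rightarrow> 'a \<Rightarrow> bool) \<Rightarrow> nat \<Rightarrow> bool" where
  "mu_on A e \<longleftrightarrow> (\<forall>x y z. A x y \<longrightarrow> A x z \<longrightarrow> y \<noteq> z \<longrightarrow> \<not> A y z \<longrightarrow> card {t. A y t \<and> A z t} = e)"

context minuscule
begin

lemma local_not_complete:
  assumes "\<not> complete_on V A" "x \<in> V"
  obtains y z where "A x y" "A x z" "y \<noteq> z" "\<not> A y z"
  using assms complete_if_local_complete[OF assms(2)] unfolding complete_on_def by blast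

lemma mu_ge_2:
  assumes "\<not> complete_on V A" "mu_on A e" shows "e \<ge> 2"
proof -
  obtain x where "x \<in> V" using assms(1) unfolding complete_on_def by blast
  then obtain y z where yz: "A x y" "A x z" "y \<noteq> z" "\<not> A y z" using local_not_complete[OF assms(1)] by blast
  then have "card {t. A y t \<and> A z t} = e" using assms(2) unfolding mu_on_def by blast
  then show ?thesis using card_common_neighbours[OF yz] by simp
qed

text \<open>For \<open>e \<ge> 3\<close> two nonadjacent neighbours of x have e - 2 > 0 common
  neighbours inside the local graph, which connects it. The bound on \<open>D\<close> is what prunes
  the candidates at the next level.\<close>

lemma local_step:
  assumes "\<not> complete_on V A" "mu_on A e" "e \<ge> 3" "x \<in> V"
  shows "minuscule (nb A x) (loc A x) D" "\<not> complete_on (nb A x) (loc A x)" "mu_on (loc A x) (e - 2)"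
    "\<forall>y\<in>nb A x. \<forall>z\<in>nb A x. D y z \<le> 2"
proof -
  have card: "card {t. A x t \<and> A y t \<and> A z t} = e - 2" if "A x y" "A x z" "y \<noteq> z" "\<not> A y z" for y z
  proof -
    have "card {t. A y t \<and> A z t} = e" using assms(2) that unfolding mu_on_def by blast
    then show ?thesis using card_common_neighbours[OF that] by simp
  qed
  show "minuscule (nb A x) (loc A x) D"
  proof (rule local_minuscule[OF assms(4)])
    fix y z assume yz: "A x y" "A x z"
    consider "y = z" | "A y z" | "y \<noteq> z" "\<not> A y z" by blast
    then show "(loc A x)\<^sup>*\<^sup>* y z"
    proof cases
      case 2 then have "loc A x y z" using yz by (simp add: loc_def)
      then show ?thesis by blast
    next
      case 3
      then have "{t. A x t \<and> A y t \<and> A z t} \<noteq> {}" using card[OF yz 3] assms(3)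
        by (metis card.empty diff_is_0_eq le_trans not_less_eq_eq numeral_2_eq_2 numeral_3_eq_3)
      then obtain t where "A x t" "A y t" "A z t" by blast
      then have "loc A x y t" "loc A x t z" using yz A_sym by (auto simp: loc_def)
      then show ?thesis by (meson r_into_rtranclp rtranclp_trans)
    qed simp
  qed
  show "\<not> complete_on (nb A x) (loc A x)"
  proof -
    obtain y z where "A x y" "A x z" "y \<noteq> z" "\<not> A y z" using local_not_complete[OF assms(1,4)] .
    then show ?thesis unfolding complete_on_def nb_def loc_def by blast
  qed
  show "mu_on (loc A x) (e - 2)"
    unfolding mu_on_def
  proof (intro allI impI)
    fix u y z assume as: "loc A x u y" "loc A x u z" "y \<noteq> z" "\<not> loc A x y z"
    then have 1: "A x y" "A x z" "\<not> A y z" by (auto simp: loc_def)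
    have "{t. loc A x y t \<and> loc A x z t} = {t. A x t \<and> A y t \<and> A z t}"
      using 1 by (auto simp: loc_def)
    then show "card {t. loc A x y t \<and> loc A x z t} = e - 2" using card[OF 1(1,2) as(3) 1(3)] by simp
  qed
  show "\<forall>y\<in>nb A x. \<forall>z\<in>nb A x. D y z \<le> 2"
    using D_near[of x] by (simp add: nb_def)
qed

end

text \<open>Carries the bound two from a local graph to the concrete graph it is identified with,
  where an explicit pair at distance three can refute it.\<close>

lemma iso_on_D_le:
  assumes "minuscule V A D" "minuscule W B E" "iso_on V A W B"
    and D: "\<forall>x\<in>V. \<forall>y\<in>V. D x y \<le> c" and W: "u \<in> W" "v \<in> W"
  shows "E u v \<le> c"
proof -
  obtain f where f: "bij_betw f V W" "\<And>x y. x \<in> V \<Longrightarrow> y \<in> V \<Longrightarrow> A x y \<longleftrightarrow> B (f x) (f y)"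
    using assms(3) unfolding iso_on_def by blast
  obtain x y where "x \<in> V" "y \<in> V" "u = f x" "v = f y" using f(1) W unfolding bij_betw_def by blast
  then show ?thesis using minuscule_iso_D[OF assms(1,2) f] D by simp
qed

subsection \<open>Neighbourhoods in the Gosset and Schlaefli graphs\<close>

lemma mu_gosset: "mu_on (adjG gosset_graph) 10"
  unfolding mu_on_def
proof (intro allI impI)
  interpret minuscule gosset_verts "adjG gosset_graph" "\<lambda>x y. real (gosset_dist x y)" by (rule minuscule_gosset)
  fix x y z assume as: "adjG gosset_graph x y" "adjG gosset_graph x z" "y \<noteq> z" "\<not> adjG gosset_graph y z"
  have V: "y \<in> gosset_verts" "z \<in> gosset_verts" using as A_V2 by blast+
  have "gosset_dist y z = 2" using D_near_eq(3)[OF as(1,2)] as by simp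
  moreover have "{t. adjG gosset_graph y t \<and> adjG gosset_graph z t} =
      {t \<in> gosset_verts. gosset_dist z t = 1 \<and> gosset_dist y t = 1}"
    using V by (auto simp: parcs_gosset)
  ultimately show "card {t. adjG gosset_graph y t \<and> adjG gosset_graph z t} = 10"
    using gosset_counts[OF V] unfolding gosset_counts_def by simp
qed

lemma not_complete_gosset: "\<not> complete_on gosset_verts (adjG gosset_graph)"
proof -
  have "(True, {0, 1}) \<in> gosset_verts" "(False, {0, 1}) \<in> gosset_verts" by (simp_all add: mem_gosset)
  moreover have "\<not> adjG gosset_graph (True, {0, 1}) (False, {0, 1})" by (simp add: parcs_gosset)
  ultimately show ?thesis unfolding complete_on_def by blast
qed

text \<open>The 27 neighbours of \<open>(True, {6, 7})\<close>: six pairs through 6 and six through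
  7 with the same sign, and the fifteen pairs disjoint from {6, 7} with the other sign.\<close>

fun schlaefli_to_gosset :: "cubic_line \<Rightarrow> bool \<times> nat set" where
  "schlaefli_to_gosset (LineA i) = (True, {6, i})"
| "schlaefli_to_gosset (LineB i) = (True, {7, i})"
| "schlaefli_to_gosset (LineC S) = (False, S)"

lemma verts_schlaefli:
  "x \<in> pverts schlaefli_graph \<longleftrightarrow>
    (case x of LineA i \<Rightarrow> i < 6 | LineB i \<Rightarrow> i < 6 | LineC S \<Rightarrow> S \<subseteq> {..<6} \<and> card S = 2)"
  by (auto simp: schlaefli_graph_def graph_on_def split: cubic_line.splits)

lemma adj_schlaefli:
  "adjG schlaefli_graph x y \<longleftrightarrow> x \<in> pverts schlaefli_graph \<and> y \<in> pverts schlaefli_graph \<and> skew_lines x y"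
  by (auto simp: schlaefli_graph_def graph_on_def)

lemma gosset_local:
  shows "(True, {6, 7}) \<in> gosset_verts"
    and "bij_betw schlaefli_to_gosset (pverts schlaefli_graph) (nb (adjG gosset_graph) (True, {6, 7}))"
    and "\<And>x y. x \<in> pverts schlaefli_graph \<Longrightarrow> y \<in> pverts schlaefli_graph \<Longrightarrow>
      adjG schlaefli_graph x y \<longleftrightarrow> adjG gosset_graph (schlaefli_to_gosset x) (schlaefli_to_gosset y)"
proof -
  let ?f = schlaefli_to_gosset
  show o: "(True, {6, 7}) \<in> gosset_verts" by (simp add: mem_gosset)
  have adj: "adjG gosset_graph (s, S) (t, T) \<longleftrightarrow> S \<subseteq> {..<8} \<and> card S = 2 \<and> T \<subseteq> {..<8} \<and> card T = 2 \<and>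
      (if s = t then card (S \<inter> T) = 1 else S \<inter> T = {})" for s S t T
    by (auto simp: gosset_graph_def graph_on_def)
  have fV: "?f x \<in> nb (adjG gosset_graph) (True, {6, 7})" if "x \<in> pverts schlaefli_graph" for x
    using that by (cases x) (auto simp: verts_schlaefli nb_def adj Int_insert_left)
  show "bij_betw ?f (pverts schlaefli_graph) (nb (adjG gosset_graph) (True, {6, 7}))"
    unfolding bij_betw_def
  proof
    show "inj_on ?f (pverts schlaefli_graph)"
    proof (rule inj_onI)
      fix x y assume "x \<in> pverts schlaefli_graph" "y \<in> pverts schlaefli_graph" "?f x = ?f y"
      then show "x = y" by (cases x; cases y) (auto simp: verts_schlaefli doubleton_eq_iff)
    qed
    show "?f ` pverts schlaefli_graph = nb (adjG gosset_graph) (True, {6, 7})"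
    proof (intro equalityI subsetI)
      fix p assume "p \<in> nb (adjG gosset_graph) (True, {6, 7})"
      then obtain s S where p: "p = (s, S)" "adjG gosset_graph (True, {6, 7}) (s, S)"
        by (cases p) (auto simp: nb_def)
      have S: "S \<subseteq> {..<8}" "card S = 2" using p adj by auto
      have small: "i < 6" if "i \<in> S" "i \<noteq> 6" "i \<noteq> 7" for i using S(1) that by fastforce
      show "p \<in> ?f ` pverts schlaefli_graph"
      proof (cases s)
        case True
        then have "card ({6, 7} \<inter> S) = 1" using p adj by auto
        then obtain a b c where abc: "{6, 7} = {a, b}" "S = {a, c}" "a \<noteq> b" "a \<noteq> c" "b \<noteq> c"
          using pairs_meet[of "{6, 7}" S] S(2) by auto
        then have "c < 6" using small[of c] by (metis insertCI insert_iff singletonD)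
        moreover have "a = 6 \<or> a = 7" using abc(1) by (metis insertCI insertE singletonD)
        ultimately have "p = ?f (LineA c) \<and> LineA c \<in> pverts schlaefli_graph \<or> p = ?f (LineB c) \<and> LineB c \<in> pverts schlaefli_graph"
          using p abc(2) True by (auto simp: verts_schlaefli)
        then show ?thesis by blast
      next
        case False
        then have "{6, 7} \<inter> S = {}" using p adj by auto
        then have "S \<subseteq> {..<6}" using small by auto
        then have "p = ?f (LineC S)" "LineC S \<in> pverts schlaefli_graph"
          using p False S by (auto simp: verts_schlaefli)
        then show ?thesis by blast
      qed
    qed (use fV in auto)
  qed
  show "adjG schlaefli_graph x y \<longleftrightarrow> adjG gosset_graph (?f x) (?f y)"
    if "x \<in> pverts schlaefli_graph" "y \<in> pverts schlaefli_graph" for x y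
    using that by (cases x; cases y) (auto simp: adj_schlaefli verts_schlaefli adj Int_insert_left)
qed

text \<open>Inherited as a local graph of the Gosset graph, which is why the kernel is pulled back
  from there.\<close>

lemma minuscule_schlaefli:
  "minuscule (pverts schlaefli_graph) (adjG schlaefli_graph)
    (\<lambda>x y. real (gosset_dist (schlaefli_to_gosset x) (schlaefli_to_gosset y)))"
proof -
  interpret minuscule gosset_verts "adjG gosset_graph" "\<lambda>x y. real (gosset_dist x y)" by (rule minuscule_gosset)
  have "minuscule (nb (adjG gosset_graph) (True, {6, 7})) (loc (adjG gosset_graph) (True, {6, 7}))
      (\<lambda>x y. real (gosset_dist x y))"
    using local_step(1)[OF not_complete_gosset mu_gosset _ gosset_local(1)] by simp
  then show ?thesis
  proof (rule minuscule_iso[OF _ gosset_local(2)])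
    fix x y
    show "adjG schlaefli_graph x y \<longleftrightarrow> x \<in> pverts schlaefli_graph \<and> y \<in> pverts schlaefli_graph \<and>
        loc (adjG gosset_graph) (True, {6, 7}) (schlaefli_to_gosset x) (schlaefli_to_gosset y)"
      using gosset_local(3)[of x y] bij_betwE[OF gosset_local(2)] adj_schlaefli[of x y]
      by (auto simp: loc_def nb_def)
  qed
qed

lemma gosset_local_iso:
  "iso_on (pverts schlaefli_graph) (adjG schlaefli_graph) (nb (adjG gosset_graph) (True, {6, 7})) (adjG gosset_graph)"
  using gosset_local(2,3) by (rule iso_onI)

text \<open>The 16 lines skew to \<open>LineA 5\<close> become the even words of length five:
  \<open>LineB 5\<close> the zero word, the ten \<open>LineC\<close> within 0..4 the words of weight
  two, the five other \<open>LineA\<close> those of weight four.\<close>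

fun schlaefli_to_demicube :: "cubic_line \<Rightarrow> bool list" where
  "schlaefli_to_demicube (LineA i) = map (\<lambda>j. j \<noteq> i) [0..<5]"
| "schlaefli_to_demicube (LineB i) = replicate 5 False"
| "schlaefli_to_demicube (LineC S) = map (\<lambda>j. j \<in> S) [0..<5]"

definition schlaefli_nb_list :: "cubic_line list" where
  "schlaefli_nb_list = filter (skew_lines (LineA 5)) schlaefli_list"

definition demicube_list :: "bool list list" where
  "demicube_list = filter (\<lambda>w. even (count_list w True)) (List.n_lists 5 [True, False])"

definition differing :: "bool list \<Rightarrow> bool list \<Rightarrow> nat" where
  "differing v w = length (filter (\<lambda>i. v ! i \<noteq> w ! i) [0..<5])"

lemma schlaefli_local_check:
  "distinct (map schlaefli_to_demicube schlaefli_nb_list)"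
  "list_all (\<lambda>w. w \<in> set demicube_list) (map schlaefli_to_demicube schlaefli_nb_list)"
  "list_all (\<lambda>w. w \<in> set (map schlaefli_to_demicube schlaefli_nb_list)) demicube_list"
  "list_all (\<lambda>x. list_all (\<lambda>y. skew_lines x y \<longleftrightarrow>
      differing (schlaefli_to_demicube x) (schlaefli_to_demicube y) = 2) schlaefli_nb_list) schlaefli_nb_list"
  by code_simp+

lemma schlaefli_local_iso:
  shows "LineA 5 \<in> pverts schlaefli_graph"
    and "iso_on (pverts (demicube_graph 5)) (adjG (demicube_graph 5))
      (nb (adjG schlaefli_graph) (LineA 5)) (adjG schlaefli_graph)"
proof -
  let ?f = schlaefli_to_demicube
  show o: "LineA 5 \<in> pverts schlaefli_graph" by (simp add: verts_schlaefli)
  have N: "nb (adjG schlaefli_graph) (LineA 5) = set schlaefli_nb_list"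
    using o by (auto simp: nb_def adj_schlaefli schlaefli_nb_list_def pverts_schlaefli)
  have W: "pverts (demicube_graph 5) = set demicube_list"
    by (auto simp: demicube_graph_def graph_on_def demicube_list_def set_n_lists)
  have b: "bij_betw ?f (set schlaefli_nb_list) (set demicube_list)"
    unfolding bij_betw_def
    using schlaefli_local_check(1-3) by (auto simp: distinct_map list_all_iff image_iff)
  have d: "differing v w = hm 5 ((!) v) ((!) w)" for v w
  proof -
    have "differing v w = card {i. i < 5 \<and> v ! i \<noteq> w ! i}"
      unfolding differing_def by (subst distinct_length_filter) (auto intro: arg_cong[of _ _ card])
    then show ?thesis unfolding hm_card .
  qed
  have "iso_on (nb (adjG schlaefli_graph) (LineA 5)) (adjG schlaefli_graph)
      (pverts (demicube_graph 5)) (adjG (demicube_graph 5))"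
  proof (rule iso_onI)
    show "bij_betw ?f (nb (adjG schlaefli_graph) (LineA 5)) (pverts (demicube_graph 5))"
      using b N W by simp
    fix x y assume xy: "x \<in> nb (adjG schlaefli_graph) (LineA 5)" "y \<in> nb (adjG schlaefli_graph) (LineA 5)"
    have "x \<in> pverts schlaefli_graph" "y \<in> pverts schlaefli_graph"
      using xy adj_schlaefli unfolding nb_def by blast+
    moreover have "?f x \<in> pverts (demicube_graph 5)" "?f y \<in> pverts (demicube_graph 5)"
      using bij_betwE[OF b] xy N W by auto
    moreover have "skew_lines x y \<longleftrightarrow> differing (?f x) (?f y) = 2"
      using schlaefli_local_check(4) xy unfolding N list_all_iff by blast
    ultimately show "adjG schlaefli_graph x y \<longleftrightarrow> adjG (demicube_graph 5) (?f x) (?f y)"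
      by (simp add: adj_schlaefli adj_demicube d)
  qed
  then show "iso_on (pverts (demicube_graph 5)) (adjG (demicube_graph 5))
      (nb (adjG schlaefli_graph) (LineA 5)) (adjG schlaefli_graph)" by (rule iso_on_sym)
qed


subsection \<open>Recognition\<close>

text \<open>One rung of the ladder: the local graph W of the unknown graph is also the local graph
  of a known one, so uniqueness identifies the two.\<close>

lemma local_lift:
  assumes M: "minuscule V A D" and N: "minuscule X C E" and x: "x \<in> V" "x' \<in> X"
    and i1: "iso_on (nb A x) (loc A x) W B" and i2: "iso_on W B (nb C x') C"
  shows "iso_on V A X C"
  using minuscule_unique[OF M N x] iso_on_trans[OF i1 i2] unfolding iso_on_loc by blast

text \<open>The local graph L has c2 = 2, so a neighbourhood in L is a disjoint union of cliques.
  There are at least two because L is not complete, and no three because \<open>D \<le> 2\<close>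
  forbids claws. Their sizes fix n and k; uniqueness then makes L a grid, and a second time makes
  the graph a Johnson graph.\<close>

lemma johnson_recognition:
  assumes M: "minuscule V A D" and nc: "\<not> complete_on V A" and mu: "mu_on A 4"
  shows "\<exists>n k. 2 \<le> k \<and> 2 * k \<le> n \<and> iso_on V A (pverts (johnson_graph n k)) (adjG (johnson_graph n k))"
proof -
  interpret M: minuscule V A D by fact
  obtain x where x: "x \<in> V" using nc unfolding complete_on_def by blast
  note st = M.local_step[OF nc mu _ x]
  interpret L: minuscule "nb A x" "loc A x" D using st(1) by simp
  have nc': "\<not> complete_on (nb A x) (loc A x)" and mu': "mu_on (loc A x) 2" using st(2,3) by simp_all
  have le2: "D u v \<le> 2" if "u \<in> nb A x" "v \<in> nb A x" for u v using st(4) that by simp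
  let ?L = "loc A x"
  obtain y where y: "y \<in> nb A x" using nc' unfolding complete_on_def by blast
  obtain p q where pq: "?L y p" "?L y q" "p \<noteq> q" "\<not> ?L p q" using L.local_not_complete[OF nc' y] .
  have nopath: "\<not> (?L y t \<and> ?L a t \<and> ?L b t)" if "?L y a" "?L y b" "a \<noteq> b" "\<not> ?L a b" for a b t
  proof -
    have "card {t. ?L a t \<and> ?L b t} = 2" using mu' that unfolding mu_on_def by blast
    then have "card {t. ?L y t \<and> ?L a t \<and> ?L b t} = 0" using L.card_common_neighbours[OF that] by simp
    moreover have "finite {t. ?L y t \<and> ?L a t \<and> ?L b t}"
      by (rule finite_subset[OF _ L.finite_V]) (use L.A_V2 in blast)
    ultimately show ?thesis by auto
  qed
  define C1 where "C1 = {a. ?L y a \<and> (a = p \<or> ?L p a)}"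
  define C2 where "C2 = {a. ?L y a \<and> a \<noteq> p \<and> \<not> ?L p a}"
  have fin: "finite C1" "finite C2"
    by (rule finite_subset[OF _ L.finite_V]; use L.A_V2 in \<open>auto simp: C1_def C2_def\<close>)+
  have N2: "nb ?L y = C1 \<union> C2" "nb ?L y = C2 \<union> C1" "C1 \<inter> C2 = {}" "C2 \<inter> C1 = {}"
    by (auto simp: nb_def C1_def C2_def)
  have c1: "?L a b \<longleftrightarrow> a \<noteq> b" if "a \<in> C1" "b \<in> C1" for a b
  proof (cases "a = b")
    case True then show ?thesis using L.A_irrefl by simp
  next
    case False
    have "?L a b"
    proof (rule ccontr)
      assume n: "\<not> ?L a b"
      then have "?L p a" "?L p b" using that False L.A_sym unfolding C1_def by blast+
      then show False using nopath[of a b p] that n False pq(1) L.A_sym unfolding C1_def by blast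
    qed
    then show ?thesis using False by simp
  qed
  have c2: "?L a b \<longleftrightarrow> a \<noteq> b" if "a \<in> C2" "b \<in> C2" for a b
  proof (cases "a = b")
    case True then show ?thesis using L.A_irrefl by simp
  next
    case False
    have "?L a b"
    proof (rule ccontr)
      assume n: "\<not> ?L a b"
      have ab: "?L y a" "?L y b" "p \<noteq> a" "p \<noteq> b" "\<not> ?L p a" "\<not> ?L p b" using that unfolding C2_def by blast+
      \<comment> \<open>Nonadjacent members of \<open>C2\<close> together with p would form a claw
        at y.\<close>
      obtain w where w: "w \<in> nb A x" "D b w = 3"
        using L.three_independent_neighbours[OF pq(1) ab(1,2,3,4) False ab(5,6) n] .
      then show False using le2[OF L.A_V2[OF ab(2)] w(1)] by simp
    qed
    then show ?thesis using False by simp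
  qed
  have c12: "\<not> ?L a b \<and> \<not> ?L b a" if "a \<in> C1" "b \<in> C2" for a b
  proof -
    have "\<not> ?L a b"
    proof
      assume ab: "?L a b"
      then have "a \<noteq> p" "?L p a" using that unfolding C1_def C2_def by blast+
      then show False
        using nopath[of p b a] that ab pq(1) L.A_sym unfolding C1_def C2_def by blast
    qed
    then show ?thesis using L.A_sym by blast
  qed
  have c21: "\<not> ?L a b \<and> \<not> ?L b a" if "a \<in> C2" "b \<in> C1" for a b
    using c12 that by blast
  have ne: "p \<in> C1" "q \<in> C2" using pq by (auto simp: C1_def C2_def)
  \<comment> \<open>In J(n,k) the cliques have sizes n - k - 1 and k - 1. Taking the smaller one for
    k - 1 chooses between J(n,k) and J(n,n-k), so that \<open>2 * k \<le> n\<close>; the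
    classification relies on this when it excludes k > 2.\<close>
  define k where "k = min (card C1) (card C2) + 1"
  define n where "n = card C1 + card C2 + 2"
  have "card C1 > 0" "card C2 > 0" using ne fin card_gt_0_iff by blast+
  then have k: "2 \<le> k" "2 * k \<le> n" "1 \<le> k" "k < n" by (auto simp: k_def n_def)
  let ?J = "adjG (johnson_graph n k)"
  define J1 where "J1 = (\<lambda>b. insert b {1..<k}) ` {k<..<n}"
  define J2 where "J2 = (\<lambda>a. {..k} - {a}) ` {1..<k}"
  note J = johnson_local_local[OF k(3,4), folded J1_def J2_def]
  have finJ: "finite J1" "finite J2" by (auto simp: J1_def J2_def)
  have "iso_on (nb ?L y) ?L (nb (loc ?J {..<k}) {1..k}) ?J"
  proof (cases "card C2 \<le> card C1")
    case True
    show ?thesis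
      by (rule two_cliques_iso[OF N2(1,3) fin c1 c2 c12 J(2,3) finJ J(6,7,8)])
        (use True J(4,5) in \<open>simp_all add: k_def n_def\<close>)
  next
    case False
    show ?thesis
      by (rule two_cliques_iso[OF N2(2,4) fin(2,1) c2 c1 c21 J(2,3) finJ J(6,7,8)])
        (use False J(4,5) in \<open>simp_all add: k_def n_def\<close>)
  qed
  then have i: "iso_on (nb ?L y) ?L (nb (loc ?J {..<k}) {1..k}) (loc ?J {..<k})"
    by (rule iso_on_cong) (auto simp: nb_def loc_def)
  interpret J: minuscule "pverts (johnson_graph n k)" ?J "\<lambda>S T. real (hm n (\<lambda>i. i \<in> S) (\<lambda>i. i \<in> T) div 2)"
    by (rule minuscule_johnson)
  have x0: "{..<k} \<in> pverts (johnson_graph n k)" using J.A_V[OF J(1)] .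
  have "minuscule (nb ?J {..<k}) (loc ?J {..<k}) (\<lambda>S T. real (hm n (\<lambda>i. i \<in> S) (\<lambda>i. i \<in> T) div 2))"
    by (rule J.local_minuscule[OF x0]) (rule johnson_local_connected[OF refl])
  then have "iso_on (nb A x) ?L (nb ?J {..<k}) (loc ?J {..<k})"
    using minuscule_unique[OF L.minuscule_axioms _ y _ i] J(1) by (simp add: nb_def)
  then have "iso_on (nb A x) A (nb ?J {..<k}) ?J" by (simp only: iso_on_loc)
  then have "iso_on V A (pverts (johnson_graph n k)) ?J"
    using minuscule_unique[OF M minuscule_johnson x x0] by blast
  then show ?thesis using k by blast
qed

lemma matching_complement_even:
  assumes "finite N" "matching_complement N A" and A: "\<And>x y. A x y \<Longrightarrow> A y x"
  shows "even (card N)"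
  using assms(1,2)
proof (induction "card N" arbitrary: N rule: less_induct)
  case less
  show ?case
  proof (cases "N = {}")
    case False
    then obtain y z where y: "y \<in> N" "z \<in> N" "z \<noteq> y" "\<not> A y z"
      using less.prems(2) unfolding matching_complement_def by blast
    have c: "card (N - {y, z}) + 2 = card N"
      using card_Diff_subset[of "{y, z}" N] card_mono[of N "{y, z}"] y less.prems(1) by simp
    have "matching_complement (N - {y, z}) A"
      using matching_complement_remove(1)[OF less.prems(2) A y] by blast
    then have "even (card (N - {y, z}))" using less.hyps[of "N - {y, z}"] c less.prems by simp
    then show ?thesis using c by (metis even_add even_numeral)
  qed simp
qed

lemma cocktail_party_recognition:
  assumes M: "minuscule V A D" and x: "x \<in> V" and i: "iso_on (nb A x) (loc A x) W B"
    and W: "matching_complement W B" "finite W" "W \<noteq> {}" "\<And>x y. B x y \<Longrightarrow> B y x" "\<And>x. \<not> B x x"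
  shows "\<exists>n\<ge>2. iso_on V A (pverts (cocktail_party_graph n)) (adjG (cocktail_party_graph n))"
proof -
  \<comment> \<open>A neighbourhood in CP(n) omits the vertex and its partner, so it has 2n - 2
    vertices.\<close>
  define n where "n = card W div 2 + 1"
  have ev: "even (card W)" using matching_complement_even[OF W(2,1,4)] by blast
  have "card W > 0" using W by (simp add: card_gt_0_iff)
  then have n: "n \<ge> 2" "card W = 2 * n - 2" using ev by (auto simp: n_def elim!: evenE)
  let ?C = "adjG (cocktail_party_graph n)"
  interpret C: minuscule "pverts (cocktail_party_graph n)" ?C
    "\<lambda>x y. real (if x = y then 0 else if x div 2 = y div 2 then 2 else 1)"
    by (rule minuscule_cocktail_party[OF n(1)])
  have c: "0 \<in> pverts (cocktail_party_graph n)" "card (nb ?C 0) = 2 * n - 2" "matching_complement (nb ?C 0) ?C"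
    using cocktail_party_local[of n] n by auto
  have fin: "finite (nb ?C 0)" using c(2) n by (intro card_ge_0_finite) simp
  have "card W = card (nb ?C 0)" using c(2) n(2) by simp
  then have "iso_on W B (nb ?C 0) ?C"
    by (rule matching_complement_iso[OF W(2) fin _ W(1) c(3) W(4,5) C.A_sym C.A_irrefl])
  then have "iso_on V A (pverts (cocktail_party_graph n)) ?C"
    using local_lift[OF M minuscule_cocktail_party[OF n(1)] x c(1) i] by blast
  then show ?thesis using n by blast
qed

lemma matching_complement_cocktail_party:
  "matching_complement (pverts (cocktail_party_graph n)) (adjG (cocktail_party_graph n))"
  unfolding matching_complement_def
proof
  have V: "pverts (cocktail_party_graph n) = {..<2 * n}" by (simp add: cocktail_party_graph_def graph_on_def)
  fix x :: nat assume x: "x \<in> pverts (cocktail_party_graph n)"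
  then have xn: "x < 2 * n" by (simp add: V)
  define w where "w = (if even x then x + 1 else x - 1)"
  have w: "w \<noteq> x" "w div 2 = x div 2" "w < 2 * n"
    using xn unfolding w_def by (auto elim!: evenE oddE)
  have "u div 2 \<noteq> x div 2" if "u \<noteq> x" "u \<noteq> w" for u using w that same_half[of x w u] by auto
  then show "\<exists>z\<in>pverts (cocktail_party_graph n). z \<noteq> x \<and> \<not> adjG (cocktail_party_graph n) x z \<and>
      (\<forall>u\<in>pverts (cocktail_party_graph n). u \<noteq> x \<longrightarrow> u \<noteq> z \<longrightarrow> adjG (cocktail_party_graph n) x u)"
    using x w unfolding V by (intro bexI[of _ w]) (auto simp: cocktail_party_graph_def graph_on_def)
qed

lemma hm_le: "hm n x y \<le> n"
  unfolding hm_card using card_mono[of "{..<n}" "{i. i < n \<and> x i \<noteq> y i}"] by auto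

lemma hm_full: "hm n x y = n \<Longrightarrow> i < n \<Longrightarrow> x i \<noteq> y i"
proof -
  assume "hm n x y = n" "i < n"
  moreover from this have "{i. i < n \<and> x i \<noteq> y i} = {..<n}"
    unfolding hm_card by (intro card_subset_eq) auto
  ultimately show ?thesis by blast
qed

text \<open>Distances are even and at most four, so a word that is neither x nor its complement is
  at distance two from x: the 4-demicube is the 16-cell graph CP(4).\<close>

lemma matching_complement_demicube:
  "matching_complement (pverts (demicube_graph 4)) (adjG (demicube_graph 4))"
  unfolding matching_complement_def
proof
  fix x assume x: "x \<in> pverts (demicube_graph 4)"
  let ?m = "map Not x"
  have lx: "length x = 4" "even (wt 4 ((!) x))" using x pverts_demicube by blast+
  have h: "hm 4 ((!) x) ((!) ?m) = 4"
  proof -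
    have "{i. i < 4 \<and> x ! i \<noteq> ?m ! i} = {..<4}" using lx by auto
    then show ?thesis unfolding hm_card by simp
  qed
  have m: "?m \<in> pverts (demicube_graph 4)"
    using even_wt[OF lx(2), of "(!) ?m"] h lx by (simp add: pverts_demicube)
  have "adjG (demicube_graph 4) x u" if u: "u \<in> pverts (demicube_graph 4)" "u \<noteq> x" "u \<noteq> ?m" for u
  proof -
    have lu: "length u = 4" "even (wt 4 ((!) u))" using u pverts_demicube by blast+
    have "hm 4 ((!) x) ((!) u) \<noteq> 0" using hm_list_0[OF lx(1) lu(1)] u by auto
    moreover have "hm 4 ((!) x) ((!) u) \<noteq> 4"
    proof
      assume "hm 4 ((!) x) ((!) u) = 4"
      then have "x ! i \<noteq> u ! i" if "i < 4" for i using hm_full[of 4 "(!) x" "(!) u" i] that by simp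
      then have "u = ?m" using lx lu by (intro nth_equalityI) auto
      then show False using u by simp
    qed
    moreover have "even (hm 4 ((!) x) ((!) u))" using even_hm lx lu by blast
    moreover have "hm 4 ((!) x) ((!) u) \<le> 4" by (rule hm_le)
    ultimately have "hm 4 ((!) x) ((!) u) = 2" by (auto elim!: evenE)
    then show ?thesis using adj_demicube x u by blast
  qed
  moreover have "?m \<noteq> x" using h hm_self[of 4 "(!) x"] by auto
  moreover have "\<not> adjG (demicube_graph 4) x ?m" using h adj_demicube[of x ?m 4] by simp
  ultimately show "\<exists>z\<in>pverts (demicube_graph 4). z \<noteq> x \<and> \<not> adjG (demicube_graph 4) x z \<and>
      (\<forall>u\<in>pverts (demicube_graph 4). u \<noteq> x \<longrightarrow> u \<noteq> z \<longrightarrow> adjG (demicube_graph 4) x u)"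
    using m by blast
qed

text \<open>The local graph has parameter e - 2, and \<open>D \<le> 2\<close> on it leaves only k =
  2 among the Johnson graphs, n = 4 or 5 among the demicubes, and excludes the Gosset graph.
  Cocktail party graphs appear as a separate family from e = 8 on: CP(3) is J(4,2) with e = 4, and
  CP(4) is the 4-demicube with e = 6. The case e = 2 is left to
  \<open>hamming_recognition\<close>.\<close>

theorem minuscule_classification:
  assumes "minuscule V A D" "\<not> complete_on V A" "mu_on A e"
  shows "e = 2 \<or>
    e = 4 \<and> (\<exists>n k. 2 \<le> k \<and> 2 * k \<le> n \<and> iso_on V A (pverts (johnson_graph n k)) (adjG (johnson_graph n k))) \<or>
    e = 6 \<and> (\<exists>n\<ge>4. iso_on V A (pverts (demicube_graph n)) (adjG (demicube_graph n))) \<or>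
    8 \<le> e \<and> (\<exists>n\<ge>2. iso_on V A (pverts (cocktail_party_graph n)) (adjG (cocktail_party_graph n))) \<or>
    e = 8 \<and> iso_on V A (pverts schlaefli_graph) (adjG schlaefli_graph) \<or>
    e = 10 \<and> iso_on V A gosset_verts (adjG gosset_graph)"
  using assms
proof (induction e arbitrary: V A rule: less_induct)
  case (less e)
  interpret M: minuscule V A D by (rule less.prems(1))
  have e2: "e \<ge> 2" using M.mu_ge_2 less.prems by blast
  show ?case
  proof (cases "e = 2")
    case False
    then have e3: "e \<ge> 3" using e2 by simp
    obtain x where x: "x \<in> V" using less.prems(2) unfolding complete_on_def by blast
    note st = M.local_step[OF less.prems(2,3) e3 x]
    interpret L: minuscule "nb A x" "loc A x" D by (rule st(1))
    note le2 = iso_on_D_le[OF st(1) _ _ st(4)]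
    have "e - 2 < e" using e2 by simp
    from less.IH[OF this st(1-3)] consider (two) "e - 2 = 2"
      | (four) n k where "e - 2 = 4" "2 \<le> k" "2 * k \<le> n"
         "iso_on (nb A x) (loc A x) (pverts (johnson_graph n k)) (adjG (johnson_graph n k))"
      | (six) n where "e - 2 = 6" "n \<ge> 4" "iso_on (nb A x) (loc A x) (pverts (demicube_graph n)) (adjG (demicube_graph n))"
      | (cp) n where "8 \<le> e - 2" "n \<ge> 2" "iso_on (nb A x) (loc A x) (pverts (cocktail_party_graph n)) (adjG (cocktail_party_graph n))"
      | (schl) "e - 2 = 8" "iso_on (nb A x) (loc A x) (pverts schlaefli_graph) (adjG schlaefli_graph)"
      | (goss) "e - 2 = 10" "iso_on (nb A x) (loc A x) gosset_verts (adjG gosset_graph)"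
      by blast
    then show ?thesis
    proof cases
      case two
      then have "e = 4" by simp
      then show ?thesis using johnson_recognition[OF less.prems(1,2)] less.prems(3) by blast
    next
      case four
      have "k = 2"
      proof (rule ccontr)
        assume "k \<noteq> 2"
        then have k: "3 \<le> k" using four by simp
        \<comment> \<open>These sets meet in k - 3 elements, so they are at distance three; both fit
          since k + 3 \<le> 2k \<le> n.\<close>
        let ?S = "{..<k}" and ?T = "{3..<k+3}"
        have V: "?S \<in> pverts (johnson_graph n k)" "?T \<in> pverts (johnson_graph n k)"
          using four k by (auto simp: pverts_johnson)
        have "?S \<inter> ?T = {3..<k}" by auto
        then have "hm n (\<lambda>i. i \<in> ?S) (\<lambda>i. i \<in> ?T) = 6" using card_Int_hm[OF V] k by simp
        then show False using le2[OF minuscule_johnson four(4) V] by simp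
      qed
      then have i: "iso_on (nb A x) (loc A x) (pverts (johnson_graph n 2)) (adjG (johnson_graph n 2))"
        and n: "n \<ge> 4" using four by auto
      have "iso_on V A (pverts (demicube_graph n)) (adjG (demicube_graph n))"
        using local_lift[OF less.prems(1) minuscule_demicube x demicube_local(1) i demicube_local(2)] .
      then show ?thesis using n four(1) by auto
    next
      case six
      have "n \<le> 5"
      proof (rule ccontr)
        assume "\<not> n \<le> 5"
        then have n: "n \<ge> 6" by simp
        \<comment> \<open>A word of weight six is at distance three from the zero word.\<close>
        define w where "w = map (\<lambda>i. i < (6::nat)) [0..<n]"
        have s: "{i. i < n \<and> replicate n False ! i \<noteq> w ! i} = {..<6}" using n by (auto simp: w_def)
        have h: "hm n ((!) (replicate n False)) ((!) w) = 6" unfolding hm_card s by simp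
        have V: "replicate n False \<in> pverts (demicube_graph n)" by (rule demicube_local(1))
        have "even (wt n ((!) w))"
          using even_wt[of n "(!) (replicate n False)" "(!) w"] V h by (simp add: pverts_demicube)
        then have "w \<in> pverts (demicube_graph n)" by (simp add: pverts_demicube w_def)
        then show False using le2[OF minuscule_demicube six(3) V] h by fastforce
      qed
      then consider "n = 4" | "n = 5" using six by linarith
      then show ?thesis
      proof cases
        case 1
        interpret C: minuscule "pverts (demicube_graph 4)" "adjG (demicube_graph 4)" "\<lambda>x y. real (hm 4 ((!) x) ((!) y) div 2)"
          by (rule minuscule_demicube)
        have "pverts (demicube_graph 4) \<noteq> {}" using demicube_local(1)[of 4] by blast
        then have "\<exists>n\<ge>2. iso_on V A (pverts (cocktail_party_graph n)) (adjG (cocktail_party_graph n))"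
          using cocktail_party_recognition[OF less.prems(1) x six(3)[unfolded 1] matching_complement_demicube]
            C.finite_V C.A_sym C.A_irrefl by blast
        then show ?thesis using six(1) by auto
      next
        case 2
        then have "iso_on V A (pverts schlaefli_graph) (adjG schlaefli_graph)"
          using local_lift[OF less.prems(1) minuscule_schlaefli x schlaefli_local_iso(1) six(3)[unfolded 2] schlaefli_local_iso(2)]
          by blast
        then show ?thesis using six(1) by auto
      qed
    next
      case cp
      interpret C: minuscule "pverts (cocktail_party_graph n)" "adjG (cocktail_party_graph n)" 
        "\<lambda>x y. real (if x = y then 0 else if x div 2 = y div 2 then 2 else 1)"
        by (rule minuscule_cocktail_party[OF cp(2)])
      have "pverts (cocktail_party_graph n) \<noteq> {}" using cocktail_party_local(1)[of n] cp(2) by auto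
      then have "\<exists>n\<ge>2. iso_on V A (pverts (cocktail_party_graph n)) (adjG (cocktail_party_graph n))"
        using cocktail_party_recognition[OF less.prems(1) x cp(3) matching_complement_cocktail_party]
          C.finite_V C.A_sym C.A_irrefl by blast
      then show ?thesis using cp(1) by auto
    next
      case schl
      have "iso_on V A gosset_verts (adjG gosset_graph)"
        using local_lift[OF less.prems(1) minuscule_gosset x gosset_local(1) schl(2) gosset_local_iso] .
      then show ?thesis using schl(1) by auto
    next
      case goss
      \<comment> \<open>An antipodal pair at distance three: the Gosset graph is not a local graph,
        so this branch of the ladder ends.\<close>
      have V: "(True, {0, 1}) \<in> gosset_verts" "(False, {0, 1}) \<in> gosset_verts" by (simp_all add: mem_gosset)
      have "real (gosset_dist (True, {0, 1}) (False, {0, 1})) \<le> 2"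
        using le2[OF minuscule_gosset goss(2) V] .
      then show ?thesis by simp
    qed
  qed simp
qed

text \<open>By \<open>path\<close> the neighbourhood of x is a disjoint union of cliques, all of
  size l + 1. The zero word of a Hamming graph has such a neighbourhood: one clique per coordinate,
  formed by its l + 1 nonzero letters. So the alphabet has l + 2 letters and d is the number of
  cliques.\<close>

lemma hamming_recognition:
  assumes M: "minuscule V A D" and x: "x \<in> V" and ne: "nb A x \<noteq> {}"
    and path: "\<And>a b c. A x a \<Longrightarrow> A x b \<Longrightarrow> A x c \<Longrightarrow> A a b \<Longrightarrow> A b c \<Longrightarrow> a \<noteq> c \<Longrightarrow> A a c"
    and l: "\<And>y. A x y \<Longrightarrow> card {t. A x t \<and> A y t} = l"
  shows "\<exists>d\<ge>1. iso_on V A (pverts (hamming_graph d (l + 2))) (adjG (hamming_graph d (l + 2)))"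
proof -
  interpret M: minuscule V A D by fact
  let ?N = "nb A x"
  have finN: "finite ?N" by (rule finite_subset[OF _ M.finite_V]) (auto simp: nb_def M.A_V2)
  define cl where "cl y = {t \<in> ?N. t = y \<or> A y t}" for y
  have cl_self: "y \<in> cl y" if "y \<in> ?N" for y using that by (simp add: cl_def)
  have cl_eq: "cl y = cl z" if "y \<in> ?N" "z \<in> ?N" "y = z \<or> A y z" for y z
    using that path M.A_sym unfolding cl_def nb_def by blast
  have cl_iff: "cl y = cl z \<longleftrightarrow> y = z \<or> A y z" if "y \<in> ?N" "z \<in> ?N" for y z
  proof
    assume "cl y = cl z"
    then have "z \<in> cl y" using cl_self[OF that(2)] by simp
    then show "y = z \<or> A y z" by (auto simp: cl_def)
  qed (rule cl_eq[OF that])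
  have cl_card: "card (cl y) = l + 1" if "y \<in> ?N" for y
  proof -
    have "cl y = insert y {t. A x t \<and> A y t}" using that by (auto simp: cl_def nb_def)
    moreover have "finite {t. A x t \<and> A y t}" by (rule finite_subset[OF _ finN]) (auto simp: nb_def)
    ultimately show ?thesis using l[of y] that M.A_irrefl by (simp add: nb_def)
  qed
  define d where "d = card (cl ` ?N)"
  have d1: "d \<ge> 1" using ne finN by (simp add: d_def Suc_le_eq card_gt_0_iff)
  have "\<exists>h. bij_betw h (cl ` ?N) {..<d}"
    by (rule finite_same_card_bij) (use finN in \<open>simp_all add: d_def\<close>)
  then obtain h where h: "bij_betw h (cl ` ?N) {..<d}" by blast
  define g where "g C = (SOME f. bij_betw f C {1..<l + 2})" for C :: "'a set"
  have g: "bij_betw (g C) C {1..<l + 2}" if "C \<in> cl ` ?N" for C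
  proof -
    have "finite C" "card C = l + 1" using that finN cl_card by (auto simp: cl_def)
    then have "\<exists>f. bij_betw f C {1..<l + 2}" using finite_same_card_bij[of C "{1..<l + 2}"] by simp
    then show ?thesis unfolding g_def by (rule someI_ex)
  qed
  let ?H = "adjG (hamming_graph d (l + 2))" and ?W = "pverts (hamming_graph d (l + 2))"
  let ?o = "replicate d (0::nat)"
  interpret H: minuscule ?W ?H "\<lambda>x y. real (hm d ((!) x) ((!) y))" by (rule minuscule_hamming)
  have W: "w \<in> ?W \<longleftrightarrow> length w = d \<and> set w \<subseteq> {..<l + 2}" for w
    by (simp add: hamming_graph_def graph_on_def)
  have adjH: "?H v w \<longleftrightarrow> v \<in> ?W \<and> w \<in> ?W \<and> hm d ((!) v) ((!) w) = 1" for v w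
    using H.D_eq_1_iff[of v w] H.A_V[of v w] H.A_V2[of v w] by auto
  have o: "?o \<in> ?W" unfolding W by auto
  have upW: "?o[i := c] \<in> ?W" if "c < l + 2" for i c
    using that set_update_subset_insert[of ?o i c] unfolding W by (auto dest!: subsetD)
  have hmo: "hm d ((!) ?o) ((!) (?o[i := c])) = 1" if "i < d" "0 < c" for i c
  proof -
    have "{j. j < d \<and> ?o ! j \<noteq> ?o[i := c] ! j} = {i}" using that by (auto simp: nth_list_update)
    then show ?thesis unfolding hm_card by simp
  qed
  have hmu: "hm d ((!) (?o[i := c])) ((!) (?o[j := e])) = 1 \<longleftrightarrow> i = j \<and> c \<noteq> e"
    if "i < d" "j < d" "0 < c" "0 < e" for i j c e
  proof -
    have "{m. m < d \<and> ?o[i := c] ! m \<noteq> ?o[j := e] ! m} = (if i = j then if c = e then {} else {i} else {i, j})"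
      using that by (auto simp: nth_list_update split: if_splits)
    then show ?thesis unfolding hm_card by simp
  qed
  \<comment> \<open>The clique of y selects the coordinate, and the position of y in its clique
    selects the nonzero letter.\<close>
  define f where "f y = ?o[h (cl y) := g (cl y) y]" for y
  have hl: "h (cl y) < d" if "y \<in> ?N" for y using bij_betwE[OF h] that by auto
  have gl: "g (cl y) y \<in> {1..<l + 2}" if "y \<in> ?N" for y
    using bij_betwE[OF g[of "cl y"]] cl_self[OF that] that by blast
  have hi: "h (cl y) = h (cl z) \<longleftrightarrow> cl y = cl z" if "y \<in> ?N" "z \<in> ?N" for y z
    using h that by (auto simp: bij_betw_def inj_on_def)
  have gi: "g (cl y) y = g (cl y) z \<longleftrightarrow> y = z" if "y \<in> ?N" "z \<in> ?N" "cl y = cl z" for y z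
    using g[of "cl y"] that cl_self[of y] cl_self[of z] unfolding bij_betw_def inj_on_def by blast
  have fN: "f y \<in> nb ?H ?o" if "y \<in> ?N" for y
    using hmo[OF hl[OF that]] gl[OF that] upW o unfolding nb_def adjH f_def by auto
  have fadj: "A y z \<longleftrightarrow> ?H (f y) (f z)" if "y \<in> ?N" "z \<in> ?N" for y z
  proof -
    have "?H (f y) (f z) \<longleftrightarrow> hm d ((!) (f y)) ((!) (f z)) = 1"
      unfolding adjH f_def using upW gl that by auto
    also have "\<dots> \<longleftrightarrow> cl y = cl z \<and> g (cl y) y \<noteq> g (cl z) z"
      unfolding f_def using hmu[OF hl[OF that(1)] hl[OF that(2)], of "g (cl y) y" "g (cl z) z"] gl[OF that(1)] gl[OF that(2)] hi[OF that]
      by auto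
    also have "\<dots> \<longleftrightarrow> A y z" using gi[OF that] cl_iff[OF that] M.A_irrefl by auto
    finally show ?thesis by simp
  qed
  have "iso_on ?N A (nb ?H ?o) ?H"
  proof (rule iso_onI[where \<phi> = f])
    show "bij_betw f ?N (nb ?H ?o)"
    proof (rule bij_betwI')
      fix y z assume yz: "y \<in> ?N" "z \<in> ?N"
      show "f y = f z \<longleftrightarrow> y = z"
      proof
        assume eq: "f y = f z"
        have "f y ! h (cl y) = g (cl y) y" using hl[OF yz(1)] by (simp add: f_def)
        then have "f z ! h (cl y) \<noteq> 0" using gl[OF yz(1)] eq by auto
        then have "h (cl y) = h (cl z)" 
          using hl[OF yz(1)] by (cases "h (cl z) = h (cl y)") (simp_all add: f_def)
        then have "cl y = cl z" using hi[OF yz] by simp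
        moreover have "g (cl y) y = g (cl y) z"
          using arg_cong[OF eq, of "\<lambda>w. w ! h (cl y)"] hl[OF yz(1)] \<open>cl y = cl z\<close> by (simp add: f_def)
        ultimately show "y = z" using gi[OF yz] by simp
      qed simp
    next
      fix w assume "w \<in> nb ?H ?o"
      then have w: "w \<in> ?W" "hm d ((!) ?o) ((!) w) = 1" unfolding nb_def adjH by auto
      have "card {j. j < d \<and> ?o ! j \<noteq> w ! j} = 1" using w(2) unfolding hm_card .
      then obtain i where "{j. j < d \<and> ?o ! j \<noteq> w ! j} = {i}" by (rule card_1_singletonE)
      then have i: "j < d \<and> ?o ! j \<noteq> w ! j \<longleftrightarrow> j = i" for j by (metis (mono_tags) mem_Collect_eq singleton_iff)
      have lw: "length w = d" "set w \<subseteq> {..<l + 2}" using w(1) W by auto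
      have id: "i < d" "w ! i \<noteq> 0" using i[of i] by auto
      have other: "w ! j = 0" if "j < d" "j \<noteq> i" for j using i[of j] that by auto
      have "w ! i \<in> {..<l + 2}" using subsetD[OF lw(2) nth_mem] id(1) lw(1) by blast
      then have wi: "w ! i \<in> {1..<l + 2}" using id(2) by simp
      have w_eq: "w = ?o[i := w ! i]"
        using lw id other by (intro nth_equalityI) (auto simp: nth_list_update)
      obtain C where C: "C \<in> cl ` ?N" "h C = i" using bij_betw_imp_surj_on[OF h] id by (metis (no_types) imageE lessThan_iff)
      obtain y where y: "y \<in> C" "g C y = w ! i" using bij_betw_imp_surj_on[OF g[OF C(1)]] wi by (metis (no_types) imageE)
      obtain z where z: "z \<in> ?N" "C = cl z" using C by blast
      have yN: "y \<in> ?N" "y = z \<or> A z y" using y z by (auto simp: cl_def)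
      then have "cl y = C" using cl_eq[of z y] z by auto
      then have "w = f y" using w_eq C y by (simp add: f_def)
      then show "\<exists>y\<in>?N. w = f y" using yN by blast
    qed (rule fN)
  qed (rule fadj)
  then have "iso_on V A ?W ?H" using minuscule_unique[OF M minuscule_hamming x o] by blast
  then show ?thesis using d1 by blast
qed

subsection \<open>Eigenvalues of finite matrices\<close>

text \<open>\<open>lambda1\<close> is a \<open>Min\<close>, which has its meaning only for a finite
  set of eigenvalues.\<close>

lemma finite_matrix_eigenvalues:
  assumes "finite V" shows "finite {l. matrix_eigenvalue_on V M l}"
proof -
  define n where "n = card V"
  obtain h where h: "bij_betw h {0..<n} V" using ex_bij_betw_nat_finite[OF assms] n_def by blast
  define B where "B = mat n n (\<lambda>(i, j). M (h i) (h j))"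
  have B: "B \<in> carrier_mat n n" by (simp add: B_def)
  have "eigenvalue B l" if l: "matrix_eigenvalue_on V M l" for l
  proof -
    obtain f x where f: "x \<in> V" "f x \<noteq> 0" "\<And>x. x \<in> V \<Longrightarrow> (\<Sum>y\<in>V. M x y * f y) = l * f x"
      using l unfolding matrix_eigenvalue_on_def by blast
    define v where "v = vec n (\<lambda>i. f (h i))"
    have "v \<noteq> 0\<^sub>v n"
    proof
      assume v0: "v = 0\<^sub>v n"
      obtain i where "i < n" "h i = x" using h f(1) unfolding bij_betw_def by auto
      then have "v $ i = f x" by (simp add: v_def)
      then show False using v0 f(2) \<open>i < n\<close> by simp
    qed
    moreover have "B *\<^sub>v v = l \<cdot>\<^sub>v v"
    proof (rule eq_vecI)
      fix i assume i: "i < dim_vec (l \<cdot>\<^sub>v v)"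
      then have hi: "i < n" "h i \<in> V" using bij_betwE[OF h] by (auto simp: v_def)
      have "(B *\<^sub>v v) $ i = (\<Sum>j = 0..<n. M (h i) (h j) * f (h j))"
        using hi by (simp add: B_def v_def scalar_prod_def)
      also have "\<dots> = (\<Sum>y\<in>V. M (h i) y * f y)"
        using sum.reindex_bij_betw[OF h, of "\<lambda>y. M (h i) y * f y"] by simp
      also have "\<dots> = l * f (h i)" using f(3) hi by blast
      finally show "(B *\<^sub>v v) $ i = (l \<cdot>\<^sub>v v) $ i" using hi by (simp add: v_def)
    qed (simp add: B_def v_def)
    ultimately have "eigenvector B v l" unfolding eigenvector_def by (simp add: B_def v_def)
    then show ?thesis unfolding eigenvalue_def by blast
  qed
  then have "{l. matrix_eigenvalue_on V M l} \<subseteq> spectrum B" unfolding spectrum_def by blast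
  then show ?thesis using card_finite_spectrum(1)[OF B] finite_subset by blast
qed

text \<open>
  On the functions with sum zero the matrix acts through the coordinates of all vertices but the last.
\<close>

lemma ex_complex_eigenvector_sum_zero:
  fixes M :: "'a \<Rightarrow> 'a \<Rightarrow> complex"
  assumes V: "finite V" "card V \<ge> 2" and col: "\<And>y. y \<in> V \<Longrightarrow> (\<Sum>x\<in>V. M x y) = s"
  shows "\<exists>g l. (\<exists>x\<in>V. g x \<noteq> 0) \<and> (\<Sum>x\<in>V. g x) = 0 \<and> (\<forall>x\<in>V. (\<Sum>y\<in>V. M x y * g y) = l * g x)"
proof -
  define m where "m = card V - 1"
  obtain h where h: "bij_betw h {0..<Suc m} V" using ex_bij_betw_nat_finite[OF V(1)] V(2) by (auto simp: m_def)
  \<comment> \<open>Eliminating the last value, which is minus the sum of the others, subtracts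
    column m from every other column.\<close>
  define B where "B = mat m m (\<lambda>(i, j). M (h i) (h j) - M (h i) (h m))"
  have B: "B \<in> carrier_mat m m" by (simp add: B_def)
  have m: "m > 0" using V(2) by (simp add: m_def)
  obtain l v where lv: "eigenvector B v l"
    using spectrum_non_empty[OF B m] unfolding spectrum_def eigenvalue_def by blast
  then have v: "dim_vec v = m" "v \<noteq> 0\<^sub>v m" "B *\<^sub>v v = l \<cdot>\<^sub>v v" by (auto simp: eigenvector_def B_def)
  define c where "c i = (if i < m then v $ i else - (\<Sum>j<m. v $ j))" for i
  define g where "g x = c (the_inv_into {0..<Suc m} h x)" for x
  have gh: "g (h i) = c i" if "i < Suc m" for i
    using that h by (simp add: g_def bij_betw_def the_inv_into_f_f)
  have sumV: "(\<Sum>y\<in>V. F y) = (\<Sum>j<m. F (h j)) + F (h m)" for F :: "'a \<Rightarrow> complex"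
    using sum.reindex_bij_betw[OF h, of F] by (simp add: atLeast0LessThan)
  have g0: "(\<Sum>x\<in>V. g x) = 0" unfolding sumV by (simp add: gh c_def)
  have row: "(\<Sum>y\<in>V. M (h i) y * g y) = l * g (h i)" if i: "i < m" for i
  proof -
    have "(\<Sum>y\<in>V. M (h i) y * g y) = (\<Sum>j<m. (M (h i) (h j) - M (h i) (h m)) * v $ j)"
      unfolding sumV by (simp add: gh c_def algebra_simps sum_subtractf sum_distrib_left sum_distrib_right)
    also have "\<dots> = (B *\<^sub>v v) $ i"
      using i v(1) by (simp add: B_def scalar_prod_def atLeast0LessThan)
    also have "\<dots> = l * g (h i)" using i v by (simp add: gh c_def)
    finally show ?thesis .
  qed
  \<comment> \<open>The last row is recovered from the rest: constant column sums make the image of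
    g have sum zero as well.\<close>
  have rowm: "(\<Sum>y\<in>V. M (h m) y * g y) = l * g (h m)"
  proof -
    have "(\<Sum>x\<in>V. \<Sum>y\<in>V. M x y * g y) = (\<Sum>y\<in>V. s * g y)"
      by (subst sum.swap, rule sum.cong) (simp_all add: sum_distrib_right[symmetric] col)
    also have "\<dots> = 0" using g0 by (simp add: sum_distrib_left[symmetric])
    finally have "(\<Sum>j<m. \<Sum>y\<in>V. M (h j) y * g y) + (\<Sum>y\<in>V. M (h m) y * g y) = 0"
      by (simp only: sumV[of "\<lambda>x. \<Sum>y\<in>V. M x y * g y"])
    then have "(\<Sum>y\<in>V. M (h m) y * g y) = - (\<Sum>j<m. l * g (h j))"
      using row by (simp add: eq_neg_iff_add_eq_0 add.commute)
    then show ?thesis by (simp add: gh c_def sum_distrib_left)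
  qed
  have "\<exists>x\<in>V. g x \<noteq> 0"
  proof -
    have "\<exists>i<m. v $ i \<noteq> 0" using v(1,2) by (metis eq_vecI index_zero_vec(1,2))
    then obtain i where i: "i < m" "v $ i \<noteq> 0" by blast
    then have "g (h i) \<noteq> 0" "h i \<in> V" using gh[of i] bij_betwE[OF h] by (auto simp: c_def)
    then show ?thesis by blast
  qed
  moreover have "(\<Sum>y\<in>V. M x y * g y) = l * g x" if x: "x \<in> V" for x
  proof -
    obtain i where "i < Suc m" "h i = x" using h x unfolding bij_betw_def by auto
    then show ?thesis using row[of i] rowm by (cases "i = m") auto
  qed
  ultimately show ?thesis using g0 by blast
qed

text \<open>For a real symmetric matrix the Hermitian form \<open>q\<close> is real, hence so is l;
  then the real and the imaginary part of g satisfy the same equations, and one of them is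
  nonzero.\<close>

lemma ex_real_eigenvector_sum_zero:
  fixes M :: "'a \<Rightarrow> 'a \<Rightarrow> real"
  assumes V: "finite V" "card V \<ge> 2" and col: "\<And>y. y \<in> V \<Longrightarrow> (\<Sum>x\<in>V. M x y) = s"
    and sym: "\<And>x y. x \<in> V \<Longrightarrow> y \<in> V \<Longrightarrow> M x y = M y x"
  shows "\<exists>f l. (\<exists>x\<in>V. f x \<noteq> 0) \<and> (\<Sum>x\<in>V. f x) = 0 \<and> (\<forall>x\<in>V. (\<Sum>y\<in>V. M x y * f y) = l * f x)"
proof -
  have col': "(\<Sum>x\<in>V. complex_of_real (M x y)) = complex_of_real s" if "y \<in> V" for y
    using col[OF that] by (metis of_real_sum)
  have "\<exists>g l. (\<exists>x\<in>V. g x \<noteq> 0) \<and> (\<Sum>x\<in>V. g x) = 0 \<and>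
      (\<forall>x\<in>V. (\<Sum>y\<in>V. complex_of_real (M x y) * g y) = l * g x)"
    by (rule ex_complex_eigenvector_sum_zero[OF V col'])
  then obtain g l where g: "\<exists>x\<in>V. g x \<noteq> 0" "(\<Sum>x\<in>V. g x) = 0"
    and g': "\<forall>x\<in>V. (\<Sum>y\<in>V. complex_of_real (M x y) * g y) = l * g x" by blast
  note g3 = bspec[OF g']
  define q where "q = (\<Sum>x\<in>V. \<Sum>y\<in>V. cnj (g x) * (complex_of_real (M x y) * g y))"
  define r where "r = (\<Sum>x\<in>V. (cmod (g x))\<^sup>2)"
  have ql: "q = l * complex_of_real r"
  proof -
    have "q = (\<Sum>x\<in>V. cnj (g x) * (l * g x))"
      unfolding q_def by (rule sum.cong) (simp_all add: sum_distrib_left[symmetric] g3)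
    also have "\<dots> = (\<Sum>x\<in>V. l * complex_of_real ((cmod (g x))\<^sup>2))"
      by (rule sum.cong) (simp_all only: complex_norm_square, simp_all add: algebra_simps)
    finally show ?thesis by (simp add: r_def sum_distrib_left)
  qed
  have "cnj q = q"
  proof -
    have "cnj q = (\<Sum>x\<in>V. \<Sum>y\<in>V. cnj (g y) * (complex_of_real (M x y) * g x))"
      unfolding q_def by (simp add: algebra_simps)
    also have "\<dots> = (\<Sum>y\<in>V. \<Sum>x\<in>V. cnj (g y) * (complex_of_real (M x y) * g x))" by (rule sum.swap)
    also have "\<dots> = q" unfolding q_def by (intro sum.cong refl) (use sym in auto)
    finally show ?thesis .
  qed
  have "r > 0"
  proof -
    obtain x where x: "x \<in> V" "g x \<noteq> 0" using g(1) by blast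
    have "(cmod (g x))\<^sup>2 \<le> r" unfolding r_def by (rule member_le_sum) (use x V in auto)
    moreover have "(cmod (g x))\<^sup>2 > 0" using x by simp
    ultimately show ?thesis by linarith
  qed
  then have "cnj l = l" using \<open>cnj q = q\<close> ql by simp
  then have lr: "l = complex_of_real (Re l)" by (simp add: complex_eq_iff)
  have parts: "(\<Sum>y\<in>V. M x y * Re (g y)) = Re l * Re (g x)" "(\<Sum>y\<in>V. M x y * Im (g y)) = Re l * Im (g x)"
    if "x \<in> V" for x
    using arg_cong[OF g3[OF that], of Re] arg_cong[OF g3[OF that], of Im] lr
    by (simp_all add: complex_eq_iff)
  have sums: "(\<Sum>x\<in>V. Re (g x)) = 0" "(\<Sum>x\<in>V. Im (g x)) = 0"
    using g(2) by (simp_all add: complex_eq_iff Re_sum Im_sum)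
  obtain x where x: "x \<in> V" "Re (g x) \<noteq> 0 \<or> Im (g x) \<noteq> 0" using g(1) by (auto simp: complex_eq_iff)
  then show ?thesis
  proof (cases "Re (g x) = 0")
    case True
    then show ?thesis using x parts sums by (intro exI[of _ "\<lambda>x. Im (g x)"] exI[of _ "Re l"]) auto
  next
    case False
    then show ?thesis using x parts sums by (intro exI[of _ "\<lambda>x. Re (g x)"] exI[of _ "Re l"]) auto
  qed
qed

subsection \<open>Distance in connected graphs\<close>

locale connected_graph = pair_graph G for G :: "'a pair_pre_digraph" +
  assumes conn: "Digraph_Component.connected (with_proj G)"
begin

abbreviation "V \<equiv> pverts G"
abbreviation "A \<equiv> (\<lambda>x y. (x, y) \<in> parcs G)"
abbreviation "dd \<equiv> gdist G"
abbreviation "N \<equiv> neighbours G"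

lemma adj_sym: "A x y \<Longrightarrow> A y x"
  using pair_sym_arcs unfolding Digraph.symmetric_def by (auto dest: symD)

lemma adj_irrefl: "\<not> A x x" using no_loops' by blast

lemma adjV: "A x y \<Longrightarrow> x \<in> V" "A x y \<Longrightarrow> y \<in> V" by (auto dest: in_arcsD1 in_arcsD2)

lemma N_V: "N x \<subseteq> V" unfolding neighbours_def using adjV by blast

lemma finite_N: "finite (N x)" using N_V pair_finite_verts finite_subset by blast

lemma mem_N: "y \<in> N x \<longleftrightarrow> A x y" by (simp add: neighbours_def)

lemma V_nonempty: "V \<noteq> {}"
  using conn unfolding Digraph_Component.connected_def strongly_connected_def by simp

lemma ex_walk: assumes "x \<in> V" "y \<in> V" shows "\<exists>p. awalk x p y"
proof -
  have "reachable (with_proj (mk_symmetric (with_proj G))) x y"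
    using conn assms unfolding Digraph_Component.connected_def strongly_connected_def by auto
  \<comment> \<open>Connectedness is defined through the symmetric closure, which adds nothing to a
    symmetric arc set.\<close>
  moreover have "mk_symmetric (with_proj G) = G"
  proof -
    have "(\<Union>e\<in>parcs G. {e, (snd e, fst e)}) = parcs G" using adj_sym by auto
    then show ?thesis by (intro pair_pre_digraph.equality) (simp_all add: mk_symmetric_def)
  qed
  ultimately have "reachable (with_proj G) x y" by simp
  then show ?thesis using reachable_awalk by blast
qed

lemma dd_walk: assumes "x \<in> V" "y \<in> V" shows "\<exists>p. awalk x p y \<and> length p = dd x y"
proof -
  have "\<exists>n p. awalk x p y \<and> length p = n" using ex_walk[OF assms] by blast
  then show ?thesis unfolding gdist_def by (rule LeastI_ex)
qed

lemma dd_le: "awalk x p y \<Longrightarrow> dd x y \<le> length p"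
  unfolding gdist_def by (rule Least_le) blast

lemma dd_self: "x \<in> V \<Longrightarrow> dd x x = 0" using dd_le[of x "[]" x] by (simp add: awalk_Nil_iff)

lemma dd_0: "x \<in> V \<Longrightarrow> y \<in> V \<Longrightarrow> dd x y = 0 \<longleftrightarrow> x = y"
proof
  assume V: "x \<in> V" "y \<in> V" and "dd x y = 0"
  then obtain p where "awalk x p y" "length p = 0" using dd_walk[OF V] by auto
  then show "x = y" by (simp add: awalk_Nil_iff)
next
  assume "x \<in> V" "x = y"
  then show "dd x y = 0" using dd_self by simp
qed

lemma dd_step_left: assumes "A x y" "z \<in> V" shows "dd x z \<le> Suc (dd y z)"
proof -
  obtain p where p: "awalk y p z" "length p = dd y z" using dd_walk[OF adjV(2)[OF assms(1)] assms(2)] by blast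
  then have w: "awalk x ((x, y) # p) z" using assms by (simp add: awalk_Cons_iff)
  show ?thesis using dd_le[OF w] p(2) by simp
qed

lemma dd_Suc_left: assumes "x \<in> V" "z \<in> V" "dd x z = Suc n" obtains y where "A x y" "dd y z = n"
proof -
  obtain p where p: "awalk x p z" "length p = Suc n" using dd_walk[OF assms(1,2)] assms(3) by auto
  then obtain e q where q: "p = e # q" "length q = n" by (cases p) auto
  then have e: "e \<in> parcs G" "x = fst e" "awalk (snd e) q z" using p by (auto simp: awalk_Cons_iff)
  then have A: "A x (snd e)" by simp
  have "dd (snd e) z \<le> n" using dd_le[OF e(3)] q(2) by simp
  moreover have "Suc n \<le> Suc (dd (snd e) z)" using dd_step_left[OF A assms(2)] assms(3) by simp
  ultimately show ?thesis using that A by simp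
qed

lemma dd_sym_le: "x \<in> V \<Longrightarrow> y \<in> V \<Longrightarrow> dd y x \<le> dd x y"
proof (induction "dd x y" arbitrary: x)
  case 0
  then have "x = y" using dd_0[of x y] by simp
  then show ?case by simp
next
  case (Suc n)
  obtain z where z: "A x z" "dd z y = n" using dd_Suc_left[OF Suc.prems Suc.hyps(2)[symmetric]] .
  have zV: "z \<in> V" using z adjV by blast
  have le: "dd y z \<le> n" using Suc.hyps(1)[of z] z zV Suc.prems by simp
  obtain p where p: "awalk y p z" "length p = dd y z" using dd_walk[OF Suc.prems(2) zV] by blast
  have "awalk z [(z, x)] x" using z adj_sym adjV by (simp add: awalk_Cons_iff awalk_Nil_iff)
  then have w: "awalk y (p @ [(z, x)]) x" using p(1) by (rule_tac awalk_appendI)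
  have "dd y x \<le> Suc (dd y z)" using dd_le[OF w] p(2) by simp
  then show ?case using le Suc.hyps(2) by simp
qed

lemma dd_sym: "x \<in> V \<Longrightarrow> y \<in> V \<Longrightarrow> dd x y = dd y x"
  using dd_sym_le by (simp add: le_antisym)

lemma dd_step: "A y z \<Longrightarrow> x \<in> V \<Longrightarrow> dd x z \<le> Suc (dd x y)"
proof -
  assume yz: "A y z" and x: "x \<in> V"
  have "dd z x \<le> Suc (dd y x)" using dd_step_left[OF adj_sym[OF yz] x] .
  then show ?thesis using dd_sym[OF x adjV(1)[OF yz]] dd_sym[OF x adjV(2)[OF yz]] by simp
qed

lemma dd_Suc: assumes "x \<in> V" "y \<in> V" "dd x y = Suc n" obtains z where "A z y" "dd x z = n"
proof -
  have "dd y x = Suc n" using assms dd_sym by simp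
  then obtain z where z: "A y z" "dd z x = n" using dd_Suc_left[OF assms(2,1)] by blast
  have "dd x z = n" using z(2) dd_sym[OF assms(1) adjV(2)[OF z(1)]] by simp
  then show ?thesis using that adj_sym[OF z(1)] by blast
qed

lemma dd_1: assumes "x \<in> V" "y \<in> V" shows "dd x y = 1 \<longleftrightarrow> A x y"
proof
  assume "dd x y = 1"
  then obtain z where "A z y" "dd x z = 0" using dd_Suc[OF assms, of 0] by auto
  then show "A x y" using dd_0 assms adjV by blast
next
  assume xy: "A x y"
  have "dd x y \<le> 1" using dd_step[OF xy assms(1)] dd_self[OF assms(1)] by simp
  moreover have "dd x y \<noteq> 0" using dd_0[OF assms] xy adj_irrefl by auto
  ultimately show "dd x y = 1" by simp
qed

lemma dd_adj: "A x y \<Longrightarrow> dd x y = 1" using dd_1 adjV by blast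

lemma dd_two: assumes "A x y" "A y z" "x \<noteq> z" "\<not> A x z" shows "dd x z = 2"
proof -
  have V: "x \<in> V" "z \<in> V" using assms adjV by auto
  have "dd x z \<le> 2" using dd_step[OF assms(2) V(1)] dd_adj[OF assms(1)] by simp
  moreover have "dd x z \<noteq> 0" "dd x z \<noteq> 1" using dd_0[OF V] dd_1[OF V] assms by auto
  ultimately show ?thesis by simp
qed

lemma rtranclp_adj: assumes "x \<in> V" "y \<in> V" shows "A\<^sup>*\<^sup>* x y"
  using assms
proof (induction "dd x y" arbitrary: x)
  case 0 then show ?case using dd_0 by auto
next
  case (Suc n)
  obtain z where z: "A x z" "dd z y = n" using dd_Suc_left[OF Suc.prems Suc.hyps(2)[symmetric]] .
  have "A\<^sup>*\<^sup>* z y" using Suc.hyps(1)[of z] z adjV(2)[OF z(1)] Suc.prems(2) by simp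
  then show ?case using z(1) by (rule converse_rtranclp_into_rtranclp[rotated])
qed

lemma lipschitz:
  fixes f :: "'a \<Rightarrow> real"
  assumes L: "\<And>x y. A x y \<Longrightarrow> f x - f y \<le> L" and "x \<in> V" "y \<in> V"
  shows "f x - f y \<le> L * dd x y"
  using assms(2,3)
proof (induction "dd x y" arbitrary: x)
  case 0
  then have "x = y" using dd_0[of x y] by simp
  then show ?case using dd_self 0 by simp
next
  case (Suc n)
  obtain z where z: "A x z" "dd z y = n" using dd_Suc_left[OF Suc.prems Suc.hyps(2)[symmetric]] .
  have "f z - f y \<le> L * dd z y" using Suc.hyps(1)[of z] z adjV(2)[OF z(1)] Suc.prems(2) by simp
  moreover have "real (dd x y) = real n + 1" using Suc.hyps(2) by simp
  ultimately show ?case using L[OF z(1)] z(2) by (simp add: algebra_simps)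
qed

lemma constant_if_locally_constant:
  assumes "\<And>x y. A x y \<Longrightarrow> f x = f y" "x \<in> V" "y \<in> V" shows "f x = f y"
proof -
  have "A\<^sup>*\<^sup>* x y" using rtranclp_adj assms by blast
  then show ?thesis by (induction rule: rtranclp_induct) (use assms in auto)
qed

end

subsection \<open>Transport between lazy walks on regular graphs\<close>

locale regular_graph = connected_graph +
  fixes k :: nat
  assumes regular: "x \<in> pverts G \<Longrightarrow> deg G x = k" and k_pos: "k > 0"
begin

lemma card_N: "x \<in> V \<Longrightarrow> card (N x) = k" using regular by (simp add: deg_def)

lemma sum_adjacency: "x \<in> V \<Longrightarrow> (\<Sum>y\<in>V. adjacency G x y * f y) = (\<Sum>y\<in>N x. f y)"
proof -
  have "(\<Sum>y\<in>V. adjacency G x y * f y) = (\<Sum>y\<in>V. if y \<in> N x then f y else 0)"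
    by (rule sum.cong) (auto simp: adjacency_def mem_N)
  also have "\<dots> = (\<Sum>y\<in>N x. f y)"
    using N_V[of x] pair_finite_verts by (simp add: sum.inter_restrict[symmetric] Int_absorb1)
  finally show ?thesis .
qed

definition adj_eigen :: "('a \<Rightarrow> real) \<Rightarrow> real \<Rightarrow> bool" where
  "adj_eigen f \<theta> \<longleftrightarrow> (\<forall>x\<in>V. (\<Sum>y\<in>N x. f y) = \<theta> * f x)"

lemma laplacian_row:
  assumes "x \<in> V"
  shows "(\<Sum>y\<in>V. normalized_laplacian G x y * f y) = f x - (\<Sum>y\<in>N x. f y) / k"
proof -
  have kk: "real k powr (-1/2) * real k powr (-1/2) = 1 / k"
    using k_pos by (simp add: powr_add[symmetric] powr_minus_divide)
  have "(\<Sum>y\<in>V. normalized_laplacian G x y * f y) =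
      (\<Sum>y\<in>V. (if x = y then f y else 0) - 1 / k * (adjacency G x y * f y))"
  proof (rule sum.cong)
    fix y assume y: "y \<in> V"
    have "real k powr (-1/2) * adjacency G x y * real k powr (-1/2) = 1 / k * adjacency G x y"
      using kk by (metis mult.assoc mult.commute)
    then show "normalized_laplacian G x y * f y = (if x = y then f y else 0) - 1 / k * (adjacency G x y * f y)"
      using regular[OF assms] regular[OF y] by (simp add: normalized_laplacian_def left_diff_distrib)
  qed simp
  also have "\<dots> = f x - 1 / k * (\<Sum>y\<in>V. adjacency G x y * f y)"
    using pair_finite_verts assms by (simp add: sum_subtractf sum_distrib_left sum.delta)
  finally show ?thesis using sum_adjacency[OF assms] by simp
qed

text \<open>On a k-regular graph the normalized Laplacian is I - A/k.\<close>

lemma laplacian_eigenvalue_iff: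
  fixes l :: real
  shows
  "matrix_eigenvalue_on V (normalized_laplacian G) l \<longleftrightarrow> (\<exists>f. (\<exists>x\<in>V. f x \<noteq> 0) \<and> adj_eigen f (k * (1 - l)))"
proof -
  have "f x - s / k = l * f x \<longleftrightarrow> s = k * (1 - l) * f x" for f :: "'a \<Rightarrow> real" and x s and l :: real
    using k_pos by (auto simp: field_simps)
  then show ?thesis unfolding matrix_eigenvalue_on_def adj_eigen_def using laplacian_row by simp
qed

text \<open>Maximum principle: where f is maximal it is the mean of its neighbouring values, so
  these are maximal too.\<close>

lemma adj_eigen_k_constant:
  assumes "adj_eigen f k" "x \<in> V" "y \<in> V" shows "f x = f y"
proof -
  define m where "m = Max (f ` V)"
  have le: "f z \<le> m" if "z \<in> V" for z unfolding m_def using that pair_finite_verts by simp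
  have "m \<in> f ` V" unfolding m_def using V_nonempty pair_finite_verts by (intro Max_in) auto
  then obtain z where z: "z \<in> V" "f z = m" by blast
  have step: "f v = m" if "A u v" "f u = m" for u v
  proof (rule ccontr)
    assume n: "f v \<noteq> m"
    have uV: "u \<in> V" using that adjV by blast
    have "(\<Sum>y\<in>N u. f y) < (\<Sum>y\<in>N u. m)"
    proof (rule sum_strict_mono_ex1[OF finite_N])
      show "\<forall>y\<in>N u. f y \<le> m" using le N_V by blast
      show "\<exists>y\<in>N u. f y < m" using n le[of v] that adjV mem_N by (intro bexI[of _ v]) auto
    qed
    then show False using assms(1) uV card_N that unfolding adj_eigen_def by simp
  qed
  have "f w = m" if w: "w \<in> V" for w
  proof -
    have "A\<^sup>*\<^sup>* z w" using rtranclp_adj z w by blast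
    then show ?thesis by (induction rule: rtranclp_induct) (use z step in auto)
  qed
  then show ?thesis using assms by simp
qed

text \<open>A nonzero function with sum zero is not constant, so its eigenvalue cannot be k. This
  makes the set defining \<open>lambda1\<close> nonempty.\<close>

lemma ex_adj_eigen:
  assumes "parcs G \<noteq> {}"
  shows "\<exists>f \<theta>. (\<exists>x\<in>V. f x \<noteq> 0) \<and> adj_eigen f \<theta> \<and> \<theta> \<noteq> k"
proof -
  obtain x y where xy: "A x y" using assms by auto
  have "card {x, y} \<le> card V" using xy adjV pair_finite_verts by (intro card_mono) auto
  then have c: "card V \<ge> 2" using xy adj_irrefl by (cases "x = y") auto
  have symm: "adjacency G u v = adjacency G v u" for u v using adj_sym by (auto simp: adjacency_def)
  have "\<exists>f l. (\<exists>x\<in>V. f x \<noteq> 0) \<and> (\<Sum>x\<in>V. f x) = 0 \<and> (\<forall>x\<in>V. (\<Sum>y\<in>V. adjacency G x y * f y) = l * f x)"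
  proof (rule ex_real_eigenvector_sum_zero[OF pair_finite_verts c])
    fix y assume y: "y \<in> V"
    have "(\<Sum>x\<in>V. adjacency G x y) = (\<Sum>x\<in>V. adjacency G y x * 1)" using symm by simp
    then show "(\<Sum>x\<in>V. adjacency G x y) = k" using sum_adjacency[OF y, of "\<lambda>_. 1"] card_N[OF y] by simp
  qed (rule symm)
  then obtain f l where f: "\<exists>x\<in>V. f x \<noteq> 0" "(\<Sum>x\<in>V. f x) = 0" "\<forall>x\<in>V. (\<Sum>y\<in>V. adjacency G x y * f y) = l * f x"
    by blast
  have e: "adj_eigen f l" unfolding adj_eigen_def using f(3) sum_adjacency by simp
  have "l \<noteq> k"
  proof
    assume "l = k"
    then have "f u = f x" if "u \<in> V" for u using adj_eigen_k_constant e that adjV[OF xy] by blast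
    then have "(\<Sum>u\<in>V. f u) = card V * f x" by simp
    then have "f x = 0" using f(2) c V_nonempty by simp
    then show False using f(1) \<open>\<And>u. u \<in> V \<Longrightarrow> f u = f x\<close> by auto
  qed
  then show ?thesis using f(1) e by blast
qed

lemma lambda1_set:
  defines "S \<equiv> {l. matrix_eigenvalue_on V (normalized_laplacian G) l \<and> l \<noteq> 0}"
  shows "finite S" "parcs G \<noteq> {} \<Longrightarrow> S \<noteq> {}"
proof -
  show "finite S" unfolding S_def
    by (rule finite_subset[OF _ finite_matrix_eigenvalues[OF pair_finite_verts]]) blast
  assume "parcs G \<noteq> {}"
  then obtain f \<theta> where f: "\<exists>x\<in>V. f x \<noteq> 0" "adj_eigen f \<theta>" "\<theta> \<noteq> k" using ex_adj_eigen by blast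
  define l where "l = 1 - \<theta> / k"
  have "k * (1 - l) = \<theta>" "l \<noteq> 0" using k_pos f(3) by (auto simp: l_def)
  then have "l \<in> S" unfolding S_def laplacian_eigenvalue_iff using f by auto
  then show "S \<noteq> {}" by blast
qed

lemma lazy_sum:
  assumes "x \<in> V"
  shows "(\<Sum>y\<in>V. lazy_walk_measure G p x y * f y) = p * f x + (1 - p) / k * (\<Sum>y\<in>N x. f y)"
proof -
  have "(\<Sum>y\<in>V. lazy_walk_measure G p x y * f y) =
      (\<Sum>y\<in>V. (if y = x then p * f y else 0) + (1 - p) / k * (adjacency G x y * f y))"
    by (rule sum.cong) (auto simp: lazy_walk_measure_def adjacency_def regular[OF assms] adj_irrefl)
  also have "\<dots> = p * f x + (1 - p) / k * (\<Sum>y\<in>V. adjacency G x y * f y)"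
    using pair_finite_verts assms by (simp add: sum.distrib sum_distrib_left sum.delta)
  finally show ?thesis using sum_adjacency[OF assms] by simp
qed

lemma lazy_prob:
  assumes "x \<in> V" shows "(\<Sum>y\<in>V. lazy_walk_measure G p x y) = 1"
  using lazy_sum[OF assms, of p "\<lambda>_. 1"] card_N[OF assms] k_pos by (simp add: field_simps)

lemma lazy_nonneg: "x \<in> V \<Longrightarrow> 0 \<le> p \<Longrightarrow> p \<le> 1 \<Longrightarrow> 0 \<le> lazy_walk_measure G p x y"
  by (simp add: lazy_walk_measure_def)

definition cost :: "('a \<Rightarrow> 'a \<Rightarrow> real) \<Rightarrow> real" where
  "cost \<pi> = (\<Sum>x\<in>V. \<Sum>y\<in>V. real (dd x y) * \<pi> x y)"

text \<open>The product coupling. It ensures that the infimum in \<open>wasserstein\<close> is over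
  a nonempty set.\<close>

lemma ex_coupling:
  assumes "x \<in> V" "y \<in> V" "0 \<le> p" "p \<le> 1"
  shows "\<exists>\<pi>. coupling G (lazy_walk_measure G p x) (lazy_walk_measure G p y) \<pi>"
proof -
  let ?\<mu> = "lazy_walk_measure G p x" and ?\<nu> = "lazy_walk_measure G p y"
  have le: "?\<mu> u \<le> 1" "?\<nu> u \<le> 1" if "u \<in> V" for u
    using member_le_sum[of u V ?\<mu>] member_le_sum[of u V ?\<nu>] that pair_finite_verts lazy_nonneg[of _ p]
      lazy_prob assms by auto
  have "coupling G ?\<mu> ?\<nu> (\<lambda>u v. ?\<mu> u * ?\<nu> v)"
    unfolding coupling_def
    using le lazy_nonneg[OF assms(1,3,4)] lazy_nonneg[OF assms(2,3,4)] lazy_prob[OF assms(1)] lazy_prob[OF assms(2)]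
    by (auto simp: sum_distrib_left[symmetric] sum_distrib_right[symmetric] mult_le_one)
  then show ?thesis by blast
qed

lemma cost_nonneg: "coupling G m1 m2 \<pi> \<Longrightarrow> 0 \<le> cost \<pi>"
  unfolding cost_def coupling_def by (intro sum_nonneg mult_nonneg_nonneg) auto

lemma wasserstein_le: "coupling G m1 m2 \<pi> \<Longrightarrow> wasserstein G m1 m2 \<le> cost \<pi>"
  unfolding wasserstein_def cost_def[symmetric]
  by (rule cINF_lower) (auto intro!: bdd_belowI2[of _ 0] cost_nonneg)

lemma wasserstein_ge:
  assumes "\<exists>\<pi>. coupling G m1 m2 \<pi>" "\<And>\<pi>. coupling G m1 m2 \<pi> \<Longrightarrow> c \<le> cost \<pi>"
  shows "c \<le> wasserstein G m1 m2"
  unfolding wasserstein_def cost_def[symmetric] by (rule cINF_greatest) (use assms in auto)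

lemma coupling_sum:
  assumes "coupling G m1 m2 \<pi>"
  shows "(\<Sum>x\<in>V. \<Sum>y\<in>V. \<pi> x y * (f x - f y)) = (\<Sum>x\<in>V. m1 x * f x) - (\<Sum>y\<in>V. m2 y * f y)"
proof -
  have "(\<Sum>x\<in>V. \<Sum>y\<in>V. \<pi> x y * f x) = (\<Sum>x\<in>V. m1 x * f x)"
    using assms unfolding coupling_def by (simp add: sum_distrib_right[symmetric])
  moreover have "(\<Sum>x\<in>V. \<Sum>y\<in>V. \<pi> x y * f y) = (\<Sum>y\<in>V. m2 y * f y)"
    using assms unfolding coupling_def by (subst sum.swap) (simp add: sum_distrib_right[symmetric])
  ultimately show ?thesis by (simp add: right_diff_distrib sum_subtractf)
qed

text \<open>Kantorovich duality written as an identity. Nonnegativity of the last sum is weak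
  duality, and its individual terms are the slacks of a transport plan.\<close>

lemma cost_excess:
  fixes f :: "'a \<Rightarrow> real"
  assumes "coupling G m1 m2 \<pi>"
  shows "L * cost \<pi> = (\<Sum>x\<in>V. m1 x * f x) - (\<Sum>y\<in>V. m2 y * f y) +
    (\<Sum>x\<in>V. \<Sum>y\<in>V. \<pi> x y * (L * dd x y - (f x - f y)))"
  unfolding coupling_sum[OF assms, symmetric] cost_def
  by (simp add: algebra_simps sum_distrib_left sum.distrib[symmetric] sum_subtractf[symmetric])

lemma lazy_potential_diff:
  assumes "adj_eigen f \<theta>" "x \<in> V" "y \<in> V"
  shows "(\<Sum>u\<in>V. lazy_walk_measure G p x u * f u) - (\<Sum>u\<in>V. lazy_walk_measure G p y u * f u) =
    (p + (1 - p) * \<theta> / k) * (f x - f y)"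
  using assms unfolding lazy_sum[OF assms(2)] lazy_sum[OF assms(3)] adj_eigen_def
  by (simp add: algebra_simps diff_divide_distrib add_divide_distrib)

lemma excess_nonneg:
  fixes f :: "'a \<Rightarrow> real"
  assumes "coupling G m1 m2 \<pi>" "\<And>x y. A x y \<Longrightarrow> f x - f y \<le> L"
  shows "x \<in> V \<Longrightarrow> y \<in> V \<Longrightarrow> 0 \<le> \<pi> x y * (L * dd x y - (f x - f y))"
    and "0 \<le> (\<Sum>x\<in>V. \<Sum>y\<in>V. \<pi> x y * (L * dd x y - (f x - f y)))"
proof -
  show 1: "0 \<le> \<pi> x y * (L * dd x y - (f x - f y))" if "x \<in> V" "y \<in> V" for x y
    using lipschitz[of f L, OF assms(2) that] assms(1) that unfolding coupling_def by simp
  show "0 \<le> (\<Sum>x\<in>V. \<Sum>y\<in>V. \<pi> x y * (L * dd x y - (f x - f y)))" by (intro sum_nonneg 1)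
qed

subsection \<open>Existence of the Lin--Lu--Yau curvature\<close>

text \<open>The measure of idleness q mixes that of idleness p, with weight t = (1 - q) / (1 - p),
  and a point mass. The point masses are at distance one, so mixing plans gives W_q \<le> t W_p + (1
  - t).\<close>

lemma curvature_mono:
  assumes xy: "A x y" and pq: "0 \<le> p" "p \<le> q" "q < 1"
  shows "lazy_curvature G p x y / (1 - p) \<le> lazy_curvature G q x y / (1 - q)"
proof -
  have V: "x \<in> V" "y \<in> V" using xy adjV by auto
  define t where "t = (1 - q) / (1 - p)"
  have t: "0 < t" "t \<le> 1" "1 - q = t * (1 - p)" using pq by (auto simp: t_def)
  let ?W = "\<lambda>r. wasserstein G (lazy_walk_measure G r x) (lazy_walk_measure G r y)"
  have "(?W q - (1 - t)) / t \<le> ?W p"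
  proof (rule wasserstein_ge)
    show "\<exists>\<pi>. coupling G (lazy_walk_measure G p x) (lazy_walk_measure G p y) \<pi>"
      using ex_coupling[OF V] pq by simp
    fix \<pi> assume \<pi>: "coupling G (lazy_walk_measure G p x) (lazy_walk_measure G p y) \<pi>"
    define \<rho> where "\<rho> u v = t * \<pi> u v + (1 - t) * (if u = x \<and> v = y then 1 else 0)" for u v
    have mu: "lazy_walk_measure G q z u = t * lazy_walk_measure G p z u + (1 - t) * (if u = z then 1 else 0)" for z u
    proof -
      have "q = t * p + (1 - t)" using t(3) by (simp add: algebra_simps)
      then show ?thesis using t(3) by (simp add: lazy_walk_measure_def)
    qed
    have ind: "(\<Sum>v\<in>V. if u = x \<and> v = y then 1 else 0 :: real) = (if u = x then 1 else 0)"
      "(\<Sum>v\<in>V. if v = x \<and> u = y then 1 else 0 :: real) = (if u = y then 1 else 0)" for u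
      using V pair_finite_verts by (auto simp: sum.delta)
    have "coupling G (lazy_walk_measure G q x) (lazy_walk_measure G q y) \<rho>"
      unfolding coupling_def
    proof (intro conjI ballI)
      fix u v assume uv: "u \<in> V" "v \<in> V"
      have b: "0 \<le> \<pi> u v" "\<pi> u v \<le> 1" using \<pi> uv unfolding coupling_def by auto
      show "0 \<le> \<rho> u v" unfolding \<rho>_def using b t by simp
      have "t * \<pi> u v + (1 - t) * (if u = x \<and> v = y then 1 else 0) \<le> t * 1 + (1 - t) * 1"
        using b t by (intro add_mono mult_left_mono) auto
      then show "\<rho> u v \<le> 1" unfolding \<rho>_def by simp
    next
      fix u assume u: "u \<in> V"
      show "(\<Sum>v\<in>V. \<rho> u v) = lazy_walk_measure G q x u"
        using \<pi> u unfolding coupling_def \<rho>_def mu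
        by (simp only: sum.distrib sum_distrib_left[symmetric] ind)
    next
      fix u assume u: "u \<in> V"
      show "(\<Sum>v\<in>V. \<rho> v u) = lazy_walk_measure G q y u"
        using \<pi> u unfolding coupling_def \<rho>_def mu
        by (simp only: sum.distrib sum_distrib_left[symmetric] ind)
    qed
    then have "?W q \<le> cost \<rho>" by (rule wasserstein_le)
    also have "cost \<rho> = t * cost \<pi> + (1 - t)"
    proof -
      have "cost \<rho> = (\<Sum>u\<in>V. \<Sum>v\<in>V. t * (real (dd u v) * \<pi> u v) +
          (1 - t) * (if u = x \<and> v = y then real (dd u v) else 0))"
        unfolding cost_def \<rho>_def by (intro sum.cong refl) (simp add: algebra_simps)
      also have "\<dots> = t * cost \<pi> + (1 - t) * (\<Sum>u\<in>V. \<Sum>v\<in>V. if u = x \<and> v = y then real (dd u v) else 0)"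
        unfolding cost_def sum.distrib sum_distrib_left ..
      also have "(\<Sum>u\<in>V. \<Sum>v\<in>V. if u = x \<and> v = y then real (dd u v) else 0) =
          (\<Sum>u\<in>V. if u = x then real (dd u y) else 0)"
        by (rule sum.cong) (use V pair_finite_verts in \<open>auto simp: sum.delta\<close>)
      also have "\<dots> = 1" using V pair_finite_verts dd_adj[OF xy] by (simp add: sum.delta)
      finally show ?thesis by simp
    qed
    finally show "(?W q - (1 - t)) / t \<le> cost \<pi>" using t by (simp add: field_simps)
  qed
  then have "t * (1 - ?W p) \<le> 1 - ?W q" using t by (simp add: field_simps)
  then have "t * (1 - ?W p) / (1 - q) \<le> (1 - ?W q) / (1 - q)" using pq by (intro divide_right_mono) auto
  moreover have "t * (1 - ?W p) / (1 - q) = (1 - ?W p) / (1 - p)" using t by simp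
  ultimately have "(1 - ?W p) / (1 - p) \<le> (1 - ?W q) / (1 - q)" by simp
  then show ?thesis unfolding lazy_curvature_def using dd_adj[OF xy] by simp
qed

text \<open>Tested with the distance to y as potential: its mean is 1 - p at y and at least p at x,
  so W_p \<ge> 2p - 1.\<close>

lemma curvature_bounded:
  assumes xy: "A x y" and p: "0 \<le> p" "p < 1"
  shows "lazy_curvature G p x y / (1 - p) \<le> 2"
proof -
  have V: "x \<in> V" "y \<in> V" using xy adjV by auto
  let ?f = "\<lambda>u. real (dd u y)"
  have lip: "?f u - ?f v \<le> 1" if "A u v" for u v
    using dd_step_left[OF that V(2)] by simp
  have "2 * p - 1 \<le> wasserstein G (lazy_walk_measure G p x) (lazy_walk_measure G p y)"
  proof (rule wasserstein_ge)
    show "\<exists>\<pi>. coupling G (lazy_walk_measure G p x) (lazy_walk_measure G p y) \<pi>"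
      using ex_coupling[OF V] p by simp
    fix \<pi> assume \<pi>: "coupling G (lazy_walk_measure G p x) (lazy_walk_measure G p y) \<pi>"
    have "?f u = 1" if "u \<in> N y" for u using that dd_adj[of u y] adj_sym[of y u] by (simp add: mem_N)
    then have "(\<Sum>u\<in>N y. ?f u) = k" using card_N[OF V(2)] by simp
    then have "(\<Sum>u\<in>V. lazy_walk_measure G p y u * ?f u) = 1 - p"
      using lazy_sum[OF V(2), of p ?f] dd_self[OF V(2)] k_pos by simp
    moreover have "(\<Sum>u\<in>V. lazy_walk_measure G p x u * ?f u) \<ge> p"
      using lazy_sum[OF V(1), of p ?f] dd_adj[OF xy] p by (simp add: sum_nonneg)
    ultimately show "2 * p - 1 \<le> cost \<pi>"
      using cost_excess[OF \<pi>, of 1 ?f] excess_nonneg(2)[of _ _ \<pi> ?f 1, OF \<pi> lip] by simp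
  qed
  then show ?thesis unfolding lazy_curvature_def using dd_adj[OF xy] p by (simp add: field_simps)
qed

text \<open>\<open>Lim\<close> has its intended value only if the limit exists; here it is the
  supremum of a bounded monotone function.\<close>

lemma lly_tendsto:
  assumes xy: "A x y"
  shows "((\<lambda>p. lazy_curvature G p x y / (1 - p)) \<longlongrightarrow> lly_curvature G x y) (at_left 1)"
proof -
  define F where "F = (\<lambda>p. lazy_curvature G p x y / (1 - p))"
  define s where "s = Sup (F ` {0..<1})"
  have bdd: "bdd_above (F ` {0..<1})"
    by (rule bdd_aboveI[of _ 2]) (use curvature_bounded[OF xy] in \<open>auto simp: F_def\<close>)
  have "(F \<longlongrightarrow> s) (at_left 1)"
  proof (rule tendstoI)
    fix e :: real assume e: "0 < e"
    have "s - e < s" using e by simp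
    then obtain p where p: "0 \<le> p" "p < 1" "s - e < F p"
      unfolding s_def using less_cSup_iff[OF _ bdd, of "Sup (F ` {0..<1}) - e"] by auto
    have "dist (F q) s < e" if "p < q" "q < 1" for q
    proof -
      have "F p \<le> F q" using curvature_mono[OF xy, of p q] p that by (simp add: F_def)
      moreover have "F q \<le> s" unfolding s_def by (rule cSup_upper[OF _ bdd]) (use p that in auto)
      ultimately show ?thesis using p by (simp add: dist_real_def)
    qed
    then show "\<forall>\<^sub>F q in at_left 1. dist (F q) s < e"
      unfolding eventually_at_left_field using p by blast
  qed
  moreover from this have "lly_curvature G x y = s"
    unfolding lly_curvature_def F_def by (intro tendsto_Lim) auto
  ultimately show ?thesis by (simp add: F_def)
qed

lemma lly_le:
  assumes "A x y" "q < 1" "\<And>p. q < p \<Longrightarrow> p < 1 \<Longrightarrow> lazy_curvature G p x y / (1 - p) \<le> c"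
  shows "lly_curvature G x y \<le> c"
  by (rule tendsto_upperbound[OF lly_tendsto[OF assms(1)]])
    (use assms in \<open>auto simp: eventually_at_left_field\<close>)

lemma lly_ge:
  assumes "A x y" "q < 1" "\<And>p. q < p \<Longrightarrow> p < 1 \<Longrightarrow> c \<le> lazy_curvature G p x y / (1 - p)"
  shows "c \<le> lly_curvature G x y"
  by (rule tendsto_lowerbound[OF lly_tendsto[OF assms(1)]])
    (use assms in \<open>auto simp: eventually_at_left_field\<close>)

text \<open>An eigenfunction that is steepest at x y is a potential whose mean difference is scaled
  by p + (1 - p) \<theta> / k, so weak duality bounds the curvature.\<close>

lemma lly_le_eigen:
  assumes xy: "A x y" and f: "adj_eigen f \<theta>" and L: "\<And>u v. A u v \<Longrightarrow> f u - f v \<le> L" "f x - f y = L" "L > 0"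
  shows "lly_curvature G x y \<le> 1 - \<theta> / k"
proof (rule lly_le[OF xy, of 0])
  fix p :: real assume p: "0 < p" "p < 1"
  have V: "x \<in> V" "y \<in> V" using xy adjV by auto
  have "p + (1 - p) * \<theta> / k \<le> wasserstein G (lazy_walk_measure G p x) (lazy_walk_measure G p y)"
  proof (rule wasserstein_ge)
    show "\<exists>\<pi>. coupling G (lazy_walk_measure G p x) (lazy_walk_measure G p y) \<pi>"
      using ex_coupling[OF V] p by simp
    fix \<pi> assume \<pi>: "coupling G (lazy_walk_measure G p x) (lazy_walk_measure G p y) \<pi>"
    have "L * (p + (1 - p) * \<theta> / k) \<le> L * cost \<pi>"
      using cost_excess[OF \<pi>, of L f] excess_nonneg(2)[of _ _ \<pi> f L, OF \<pi> L(1)] lazy_potential_diff[OF f V, of p] L(2)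
      by (simp add: mult.commute)
    then show "p + (1 - p) * \<theta> / k \<le> cost \<pi>" using L(3) by simp
  qed
  then show "lazy_curvature G p x y / (1 - p) \<le> 1 - \<theta> / k"
    unfolding lazy_curvature_def using dd_adj[OF xy] p k_pos by (simp add: field_simps)
qed simp

end

lemma mult_if_add_if:
  "r * ((if P then c else 0) + (if Q then e else 0)) = (if P then c * r else 0) + (if Q then e * r else (0::real))"
  by (simp add: algebra_simps)

context regular_graph
begin

subsection \<open>Minuscule graphs are sharp\<close>

abbreviation "NN x \<equiv> insert x (N x)"

lemma NN: "x \<in> V \<Longrightarrow> NN x \<subseteq> V" "finite (NN x)" "x \<in> V \<Longrightarrow> card (NN x) = Suc k"
  using N_V finite_N card_N adj_irrefl by (auto simp: mem_N)

text \<open>At idleness 1 / (k + 1) both measures are uniform on closed neighbourhoods, and a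
  bijection is a transport plan. Beyond that only the surplus \<open>c\<close> at x has to move,
  along the edge to y.\<close>

lemma lly_ge_bij:
  assumes xy: "A x y" and \<sigma>: "bij_betw \<sigma> (NN x) (NN y)"
  shows "(real k + 1 - (\<Sum>u\<in>NN x. real (dd u (\<sigma> u)))) / k \<le> lly_curvature G x y"
proof (rule lly_ge[OF xy, of "1 / (real k + 1)"])
  show "1 / (real k + 1) < 1" using k_pos by simp
  fix p :: real assume p: "1 / (real k + 1) < p" "p < 1"
  have V: "x \<in> V" "y \<in> V" using xy adjV by auto
  define e where "e = (1 - p) / k"
  define c where "c = p - e"
  define S where "S = (\<Sum>u\<in>NN x. real (dd u (\<sigma> u)))"
  have p0: "0 < p" using p(1) by (rule less_trans[rotated]) simp
  have e0: "0 \<le> e" using p by (simp add: e_def)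
  have c0: "0 \<le> c" using p k_pos by (simp add: c_def e_def field_simps)
  define \<pi> where "\<pi> u v = (if u = x \<and> v = y then c else 0) + (if u \<in> NN x \<and> v = \<sigma> u then e else 0)" for u v
  have mu: "lazy_walk_measure G p z u = (if u = z then c else 0) + (if u \<in> NN z then e else 0)" if "z \<in> V" for z u
    using regular[OF that] adj_irrefl by (auto simp: lazy_walk_measure_def c_def e_def mem_N)
  have nonneg: "0 \<le> \<pi> u v" for u v using c0 e0 by (simp add: \<pi>_def)
  have \<sigma>V: "\<sigma> u \<in> V" if "u \<in> NN x" for u using bij_betwE[OF \<sigma>] NN(1)[OF V(2)] that by blast
  have row: "(\<Sum>v\<in>V. \<pi> u v) = lazy_walk_measure G p x u" if u: "u \<in> V" for u
  proof -
    have "(\<Sum>v\<in>V. if u = x \<and> v = y then c else 0) = (if u = x then c else 0)"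
      using V pair_finite_verts by (cases "u = x") (simp_all add: sum.delta)
    moreover have "(\<Sum>v\<in>V. if u \<in> NN x \<and> v = \<sigma> u then e else 0) = (if u \<in> NN x then e else 0)"
      using \<sigma>V[of u] pair_finite_verts by (cases "u \<in> NN x") (simp_all add: sum.delta del: insert_iff)
    ultimately show ?thesis unfolding \<pi>_def sum.distrib mu[OF V(1)] by simp
  qed
  have inv: "u \<in> NN x \<and> v = \<sigma> u \<longleftrightarrow> v \<in> NN y \<and> u = inv_into (NN x) \<sigma> v" for u v
    using bij_betwE[OF \<sigma>] bij_betwE[OF bij_betw_inv_into[OF \<sigma>]] bij_betw_inv_into_left[OF \<sigma>] bij_betw_inv_into_right[OF \<sigma>]
    by metis
  have iV: "inv_into (NN x) \<sigma> v \<in> V" if "v \<in> NN y" for v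
    using bij_betwE[OF bij_betw_inv_into[OF \<sigma>]] that NN(1)[OF V(1)] by blast
  have col: "(\<Sum>u\<in>V. \<pi> u v) = lazy_walk_measure G p y v" if v: "v \<in> V" for v
  proof -
    have "(\<Sum>u\<in>V. if u = x \<and> v = y then c else 0) = (if v = y then c else 0)"
      using V pair_finite_verts by (cases "v = y") (simp_all add: sum.delta)
    moreover have "(\<Sum>u\<in>V. if u \<in> NN x \<and> v = \<sigma> u then e else 0) = (if v \<in> NN y then e else 0)"
      unfolding inv using iV[of v] pair_finite_verts by (cases "v \<in> NN y") (simp_all add: sum.delta del: insert_iff)
    ultimately show ?thesis unfolding \<pi>_def sum.distrib mu[OF V(2)] by simp
  qed
  have le1: "\<pi> u v \<le> 1" if uv: "u \<in> V" "v \<in> V" for u v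
  proof -
    have "\<pi> u v \<le> (\<Sum>v\<in>V. \<pi> u v)" by (rule member_le_sum[OF uv(2)]) (use nonneg pair_finite_verts in auto)
    also have "\<dots> \<le> (\<Sum>u\<in>V. lazy_walk_measure G p x u)"
      unfolding row[OF uv(1)] by (rule member_le_sum[OF uv(1)]) (use pair_finite_verts lazy_nonneg[OF V(1)] p p0 in auto)
    finally show ?thesis using lazy_prob[OF V(1)] by simp
  qed
  have cp: "coupling G (lazy_walk_measure G p x) (lazy_walk_measure G p y) \<pi>"
    unfolding coupling_def using nonneg le1 row col by auto
  have "cost \<pi> = (\<Sum>u\<in>V. \<Sum>v\<in>V. (if u = x \<and> v = y then c * dd u v else 0)) +
      (\<Sum>u\<in>V. \<Sum>v\<in>V. (if u \<in> NN x \<and> v = \<sigma> u then e * dd u v else 0))"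
    unfolding cost_def \<pi>_def mult_if_add_if sum.distrib ..
  also have "(\<Sum>u\<in>V. \<Sum>v\<in>V. (if u = x \<and> v = y then c * dd u v else 0)) = (\<Sum>u\<in>V. if u = x then c * dd u y else 0)"
    by (rule sum.cong) (use V pair_finite_verts in \<open>auto simp: sum.delta\<close>)
  also have "\<dots> = c" using V pair_finite_verts dd_adj[OF xy] by (simp add: sum.delta)
  also have "(\<Sum>u\<in>V. \<Sum>v\<in>V. (if u \<in> NN x \<and> v = \<sigma> u then e * dd u v else 0)) =
      (\<Sum>u\<in>V. if u \<in> NN x then e * dd u (\<sigma> u) else 0)"
  proof (rule sum.cong[OF refl])
    fix u assume "u \<in> V"
    show "(\<Sum>v\<in>V. (if u \<in> NN x \<and> v = \<sigma> u then e * dd u v else 0)) = (if u \<in> NN x then e * dd u (\<sigma> u) else 0)"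
      using \<sigma>V[of u] pair_finite_verts by (cases "u \<in> NN x") (simp_all add: sum.delta del: insert_iff)
  qed
  also have "\<dots> = e * S"
    using NN(1)[OF V(1)] pair_finite_verts
    by (simp add: S_def sum_distrib_left sum.inter_restrict[symmetric] Int_absorb1 del: insert_iff)
  finally have "wasserstein G (lazy_walk_measure G p x) (lazy_walk_measure G p y) \<le> c + e * S"
    using wasserstein_le[OF cp] by simp
  then have "1 - (c + e * S) \<le> lazy_curvature G p x y" unfolding lazy_curvature_def using dd_adj[OF xy] by simp
  moreover have "1 - (c + e * S) = (real k + 1 - S) / k * (1 - p)"
    using k_pos by (simp add: c_def e_def field_simps)
  ultimately show "(real k + 1 - (\<Sum>u\<in>NN x. real (dd u (\<sigma> u)))) / real k \<le> lazy_curvature G p x y / (1 - p)"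
    using p unfolding S_def[symmetric] by (simp add: pos_le_divide_eq add.commute)
qed

text \<open>A Lichnerowicz estimate without curvature: the eigenvalue equations at x and y are
  subtracted, and the sums over closed neighbourhoods are compared through the bijection. The final
  - 1 accounts for x and y themselves.\<close>

lemma sum_bij_eigen_bound:
  assumes xy: "A x y" and \<sigma>: "bij_betw \<sigma> (NN x) (NN y)" and f: "adj_eigen f \<theta>"
    and L: "\<And>u v. A u v \<Longrightarrow> f u - f v \<le> L" "f x - f y = L" "L > 0"
  shows "\<theta> \<le> (\<Sum>u\<in>NN x. real (dd u (\<sigma> u))) - 1"
proof -
  have V: "x \<in> V" "y \<in> V" using xy adjV by auto
  have "\<theta> * L = (\<Sum>u\<in>N x. f u) - (\<Sum>u\<in>N y. f u)"
    using f V L(2) unfolding adj_eigen_def by (simp add: right_diff_distrib[symmetric])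
  also have "\<dots> = (\<Sum>u\<in>NN x. f u) - (\<Sum>u\<in>NN y. f u) - L"
    using L(2) finite_N adj_irrefl by (simp add: mem_N)
  also have "(\<Sum>u\<in>NN y. f u) = (\<Sum>u\<in>NN x. f (\<sigma> u))" using sum.reindex_bij_betw[OF \<sigma>, of f] by simp
  also have "(\<Sum>u\<in>NN x. f u) - \<dots> = (\<Sum>u\<in>NN x. f u - f (\<sigma> u))" by (simp only: sum_subtractf)
  also have "\<dots> \<le> (\<Sum>u\<in>NN x. L * dd u (\<sigma> u))"
  proof (rule sum_mono)
    fix u assume u: "u \<in> NN x"
    then have "u \<in> V" "\<sigma> u \<in> V" using NN(1) V bij_betwE[OF \<sigma>] by blast+
    then show "f u - f (\<sigma> u) \<le> L * dd u (\<sigma> u)" using lipschitz[of f L] L(1) by blast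
  qed
  also have "\<dots> = (\<Sum>u\<in>NN x. real (dd u (\<sigma> u))) * L" by (simp only: sum_distrib_left[symmetric] mult.commute)
  finally have "\<theta> * L \<le> ((\<Sum>u\<in>NN x. real (dd u (\<sigma> u))) - 1) * L" by (simp only: left_diff_distrib) simp
  then show ?thesis using L(3) mult_right_le_imp_le by blast
qed

text \<open>The common part of the closed neighbourhoods stays fixed and every other vertex moves by
  y - x, one step. So the total cost is (k + 1) - (a + 2).\<close>

lemma translation_bij:
  assumes M: "minuscule V A D" and a: "card (N x \<inter> N y) = a" and xy: "A x y"
  obtains \<sigma> where "bij_betw \<sigma> (NN x) (NN y)" "(\<Sum>u\<in>NN x. real (dd u (\<sigma> u))) = real k - 1 - real a"
proof -
  interpret M: minuscule V A D by fact
  have V: "x \<in> V" "y \<in> V" using xy adjV by auto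
  define \<tau> where "\<tau> u = (SOME w. A y w \<and> A u w \<and> M.par x y u w \<and> w \<noteq> x \<and> \<not> A x w)" for u
  have \<tau>: "A y (\<tau> u) \<and> A u (\<tau> u) \<and> M.par x y u (\<tau> u) \<and> \<tau> u \<noteq> x \<and> \<not> A x (\<tau> u)"
    if "A x u" "u \<noteq> y" "\<not> A y u" for u
  proof -
    have "\<exists>w. A y w \<and> A u w \<and> M.par x y u w \<and> w \<noteq> x \<and> \<not> A x w" using M.ex_translate[OF xy that] by blast
    then show ?thesis unfolding \<tau>_def by (rule someI_ex)
  qed
  define \<sigma> where "\<sigma> u = (if u \<in> NN y then u else \<tau> u)" for u
  have nf: "A x u" "u \<noteq> y" "\<not> A y u" if "u \<in> NN x" "u \<notin> NN y" for u
    using that adj_sym[OF xy] by (auto simp: mem_N)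
  have im: "\<sigma> u \<in> NN y" if "u \<in> NN x" for u
  proof (cases "u \<in> NN y")
    case True then show ?thesis unfolding \<sigma>_def by simp
  next
    case False
    then show ?thesis using \<tau>[OF nf[OF that False]] unfolding \<sigma>_def by (simp add: mem_N)
  qed
  have out: "\<tau> u \<notin> NN x" if "u \<in> NN x" "u \<notin> NN y" for u
    using \<tau>[OF nf[OF that]] by (simp add: mem_N)
  \<comment> \<open>Moved vertices land outside the closed neighbourhood of x, so they do not meet
    fixed ones; two moved ones are separated by undoing the translation.\<close>
  have inj: "inj_on \<sigma> (NN x)"
  proof (rule inj_onI)
    fix u v assume uv: "u \<in> NN x" "v \<in> NN x" "\<sigma> u = \<sigma> v"
    consider "u \<in> NN y" "v \<in> NN y" | "u \<in> NN y" "v \<notin> NN y" | "u \<notin> NN y" "v \<in> NN y" | "u \<notin> NN y" "v \<notin> NN y" by blast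
    then show "u = v"
    proof cases
      case 1 then show ?thesis using uv unfolding \<sigma>_def by simp
    next
      case 2 then have "\<tau> v \<in> NN x" using uv unfolding \<sigma>_def by simp
      then show ?thesis using out[of v] uv 2 by blast
    next
      case 3 then have "\<tau> u \<in> NN x" using uv unfolding \<sigma>_def by simp
      then show ?thesis using out[of u] uv 3 by blast
    next
      case 4
      then have t: "\<tau> u = \<tau> v" using uv unfolding \<sigma>_def by simp
      have "M.par y x (\<tau> u) u" "M.par y x (\<tau> u) v"
        using \<tau>[OF nf[OF uv(1) 4(1)]] \<tau>[OF nf[OF uv(2) 4(2)]] M.par_swap t by metis+
      then show ?thesis using M.par_unique NN(1)[OF V(1)] uv by blast
    qed
  qed
  have "\<sigma> ` NN x = NN y"
  proof (rule card_subset_eq)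
    show "card (\<sigma> ` NN x) = card (NN y)" using card_image[OF inj] NN(3) V by simp
  qed (use im finite_N in auto)
  then have bij: "bij_betw \<sigma> (NN x) (NN y)" using inj unfolding bij_betw_def by blast
  have "(\<Sum>u\<in>NN x. real (dd u (\<sigma> u))) = (\<Sum>u\<in>NN x. if u \<in> NN x - NN y then 1 else 0)"
  proof (rule sum.cong[OF refl])
    fix u assume u: "u \<in> NN x"
    show "real (dd u (\<sigma> u)) = (if u \<in> NN x - NN y then 1 else 0)"
    proof (cases "u \<in> NN y")
      case True
      then show ?thesis using u NN(1) V dd_self[of u] by (auto simp: \<sigma>_def)
    next
      case False
      then have "dd u (\<sigma> u) = 1" using \<tau>[OF nf[OF u False]] dd_adj by (simp add: \<sigma>_def)
      then show ?thesis using u False by simp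
    qed
  qed
  also have "\<dots> = card (NN x - NN y)"
    using NN(2)[of x] by (simp add: sum.inter_restrict[symmetric] Int_absorb1 Diff_subset del: Diff_iff insert_iff insert_Diff_if)
  also have "\<dots> = real (Suc k) - card (NN x \<inter> NN y)"
  proof -
    have "card (NN x \<inter> NN y) \<le> card (NN x)" by (rule card_mono[OF NN(2)]) blast
    moreover have "card (NN x - NN y) = card (NN x) - card (NN x \<inter> NN y)"
      by (rule card_Diff_subset_Int) (use NN(2)[of x] in blast)
    ultimately show ?thesis unfolding NN(3)[OF V(1)] by (simp only: of_nat_diff)
  qed
  also have "NN x \<inter> NN y = insert x (insert y (N x \<inter> N y))" using xy adj_sym[OF xy] by (auto simp: mem_N)
  also have "card \<dots> = a + 2"
    using a finite_N adj_irrefl xy by (subst card_insert_disjoint) (auto simp: mem_N)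
  finally show ?thesis using that bij by simp
qed

text \<open>Three estimates meet at l = (2 + a) / k: the translation bounds every curvature from
  below, the root of the edge as potential bounds it from above, and for any other eigenfunction the
  translation along its steepest edge bounds the eigenvalue.\<close>

theorem sharp_if_minuscule:
  assumes M: "minuscule V A D" and a: "\<And>x y. A x y \<Longrightarrow> card (N x \<inter> N y) = a" and ne: "parcs G \<noteq> {}"
  shows "lichnerowicz_sharp G"
proof -
  interpret M: minuscule V A D by fact
  define \<theta> where "\<theta> = real k - 2 - real a"
  define l where "l = 1 - \<theta> / k"
  have kl: "k * (1 - l) = \<theta>" using k_pos by (simp add: l_def)
  \<comment> \<open>Among the k neighbours of t, v itself contributes 0, the a common neighbours
    contribute 1, and all others 2.\<close>
  have sumD: "(\<Sum>w\<in>N t. D w v) = 2 * real k - 2 - a" if tv: "A t v" for t v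
  proof -
    have "(\<Sum>w\<in>N t. D w v) = (\<Sum>w\<in>N t. 2 - (if w = v then 2 else 0) - (if w \<in> N v then 1 else 0))"
    proof (rule sum.cong[OF refl])
      fix w assume "w \<in> N t"
      then have "A t w" by (simp add: mem_N)
      then show "D w v = 2 - (if w = v then 2 else 0) - (if w \<in> N v then 1 else 0)"
        using M.D_near[OF _ tv, of w] adj_sym adj_irrefl by (auto simp: mem_N)
    qed
    also have "\<dots> = 2 * real (card (N t)) - 2 - real (card (N t \<inter> N v))"
    proof -
      have "v \<in> N t" using tv by (simp add: mem_N)
      then show ?thesis using finite_N by (simp add: sum_subtractf sum.delta sum.inter_restrict[symmetric])
    qed
    finally show ?thesis using card_N a[OF tv] adjV(1)[OF tv] by simp
  qed
  have root: "adj_eigen (\<lambda>t. D t y - D t x) \<theta> \<and> lly_curvature G x y \<le> l" if xy: "A x y" for x y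
  proof -
    have V: "x \<in> V" "y \<in> V" using xy adjV by auto
    have "adj_eigen (\<lambda>t. D t y - D t x) \<theta>"
      unfolding adj_eigen_def
    proof
      fix t assume t: "t \<in> V"
      have NV: "w \<in> V" "D w t = 1" if "w \<in> N t" for w
        using that adjV M.D_adj adj_sym by (auto simp: mem_N)
      \<comment> \<open>The trichotomy rewrites the root as a difference of kernel sections at t and
        its neighbours, whose sums over \<open>N t\<close> are given by \<open>sumD\<close>.\<close>
      have "M.tri x y t" using M.tri[OF xy t] .
      then consider t' where "D t x - D t y = -1" "A t t'" "M.par x y t t'"
        | t' where "D t x - D t y = 1" "A t t'" "M.par x y t' t"
        | u u' where "D t x - D t y = 0" "A t u" "A t u'" "M.par x y u u'"
        unfolding M.tri_def by blast
      then show "(\<Sum>w\<in>N t. D w y - D w x) = \<theta> * (D t y - D t x)"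
      proof cases
        case 1
        have v: "D t y - D t x = 1" using 1(1) by simp
        have "(\<Sum>w\<in>N t. D w y - D w x) = (\<Sum>w\<in>N t. D w t' - 1)"
        proof (rule sum.cong[OF refl])
          fix w assume w: "w \<in> N t"
          show "D w y - D w x = D w t' - 1" using M.parD[OF 1(3) NV(1)[OF w]] NV(2)[OF w] by simp
        qed
        also have "\<dots> = \<theta>" using sumD[OF 1(2)] card_N[OF t] by (simp add: sum_subtractf \<theta>_def)
        finally show ?thesis using v by simp
      next
        case 2
        have v: "D t y - D t x = -1" using 2(1) by simp
        have "(\<Sum>w\<in>N t. D w y - D w x) = (\<Sum>w\<in>N t. 1 - D w t')"
        proof (rule sum.cong[OF refl])
          fix w assume w: "w \<in> N t"
          show "D w y - D w x = 1 - D w t'" using M.parD[OF 2(3) NV(1)[OF w]] NV(2)[OF w] by simp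
        qed
        also have "\<dots> = - \<theta>" using sumD[OF 2(2)] card_N[OF t] by (simp add: sum_subtractf \<theta>_def)
        finally show ?thesis using v by simp
      next
        case 3
        have v: "D t y - D t x = 0" using 3(1) by simp
        have "(\<Sum>w\<in>N t. D w y - D w x) = (\<Sum>w\<in>N t. D w u' - D w u)"
        proof (rule sum.cong[OF refl])
          fix w assume w: "w \<in> N t"
          show "D w y - D w x = D w u' - D w u" using M.parD[OF 3(4) NV(1)[OF w]] NV(2)[OF w] by simp
        qed
        also have "\<dots> = 0" using sumD[OF 3(2)] sumD[OF 3(3)] by (simp add: sum_subtractf)
        finally show ?thesis using v by simp
      qed
    qed
    moreover from this have "lly_curvature G x y \<le> 1 - \<theta> / k"
    proof (rule lly_le_eigen[OF xy, of _ _ 2])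
      show "D u y - D u x - (D v y - D v x) \<le> 2" if "A u v" for u v
        using M.root_values[OF xy, of u] M.root_values[OF xy, of v] adjV[OF that] by auto
      show "D x y - D x x - (D y y - D y x) = 2"
        using M.D_adj[OF xy] M.D_adj[OF adj_sym[OF xy]] M.D_self V by simp
    qed simp
    ultimately show ?thesis by (simp add: l_def)
  qed
  have ge: "l \<le> lly_curvature G x y" if xy: "A x y" for x y
  proof -
    obtain \<sigma> where s: "bij_betw \<sigma> (NN x) (NN y)" "(\<Sum>u\<in>NN x. real (dd u (\<sigma> u))) = real k - 1 - real a"
      using translation_bij[OF M a[OF xy] xy] .
    have "(real k + 1 - (real k - 1 - real a)) / k \<le> lly_curvature G x y" using lly_ge_bij[OF xy s(1)] unfolding s(2) .
    moreover have "(real k + 1 - (real k - 1 - real a)) / k = l" using k_pos by (simp add: l_def \<theta>_def field_simps)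
    ultimately show ?thesis by simp
  qed
  obtain x0 y0 where xy0: "A x0 y0" using ne by auto
  have "{lly_curvature G x y |x y. A x y} = {l}" using root ge xy0 by (auto intro!: antisym) (metis antisym)
  then have mincurv: "Min {lly_curvature G x y |x y. A x y} = l" by simp
  have "lambda1 G = l"
    unfolding lambda1_def
  proof (rule Min_eqI)
    show "finite {l. matrix_eigenvalue_on V (normalized_laplacian G) l \<and> l \<noteq> 0}" by (rule lambda1_set(1))
    have "D x0 y0 - D x0 x0 \<noteq> 0" using M.D_adj[OF xy0] M.D_self adjV[OF xy0] by simp
    then have "matrix_eigenvalue_on V (normalized_laplacian G) l"
      unfolding laplacian_eigenvalue_iff kl using root[OF xy0] adjV(1)[OF xy0] by (intro exI[of _ "\<lambda>t. D t y0 - D t x0"]) auto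
    moreover have "l \<noteq> 0" using k_pos by (simp add: l_def \<theta>_def field_simps)
    ultimately show "l \<in> {l. matrix_eigenvalue_on V (normalized_laplacian G) l \<and> l \<noteq> 0}" by simp
    fix l' assume "l' \<in> {l. matrix_eigenvalue_on V (normalized_laplacian G) l \<and> l \<noteq> 0}"
    then have l': "l' \<noteq> 0" "\<exists>f. (\<exists>x\<in>V. f x \<noteq> 0) \<and> adj_eigen f (k * (1 - l'))"
      unfolding laplacian_eigenvalue_iff by auto
    then obtain f where f: "\<exists>x\<in>V. f x \<noteq> 0" "adj_eigen f (k * (1 - l'))" by blast
    \<comment> \<open>An arc of steepest descent of f; L = 0 would make f locally constant and force
      l' = 0.\<close>
    define L where "L = Max ((\<lambda>(u, v). f u - f v) ` parcs G)"
    have Lle: "f u - f v \<le> L" if "A u v" for u v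
      unfolding L_def using pair_finite_arcs that by (intro Max_ge) auto
    have "L \<in> (\<lambda>(u, v). f u - f v) ` parcs G" unfolding L_def using pair_finite_arcs ne by (intro Max_in) auto
    then obtain x y where xy: "A x y" "f x - f y = L" by auto
    have "L > 0"
    proof (rule ccontr)
      assume "\<not> L > 0"
      then have eq: "f u = f v" if "A u v" for u v using Lle[OF that] Lle[OF adj_sym[OF that]] by simp
      obtain x where x: "x \<in> V" "f x \<noteq> 0" using f(1) by blast
      have "(\<Sum>y\<in>N x. f y) = (\<Sum>y\<in>N x. f x)" using eq by (intro sum.cong) (auto simp: mem_N)
      then have "k * f x = k * (1 - l') * f x" using f(2) x card_N[OF x(1)] unfolding adj_eigen_def by simp
      then show False using k_pos x l'(1) by simp
    qed
    obtain \<sigma> where s: "bij_betw \<sigma> (NN x) (NN y)" "(\<Sum>u\<in>NN x. real (dd u (\<sigma> u))) = real k - 1 - real a"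
      using translation_bij[OF M a[OF xy(1)] xy(1)] .
    have "k * (1 - l') \<le> real k - 1 - real a - 1"
      using sum_bij_eigen_bound[OF xy(1) s(1) f(2) Lle xy(2) \<open>L > 0\<close>] unfolding s(2) .
    then have "k * (1 - l') \<le> k * (1 - l)" unfolding kl by (simp add: \<theta>_def)
    then show "l \<le> l'" using k_pos by simp
  qed
  then show ?thesis unfolding lichnerowicz_sharp_def using ne mincurv by simp
qed

end

subsection \<open>Radial eigenfunctions\<close>

text \<open>In \<open>n j i\<close> the index j is the distance of z from x and i that of its
  neighbour; c, a and b are merged into one array so that the shell sums obey one
  recurrence.\<close>

locale distance_regular_graph = regular_graph +
  fixes n :: "nat \<Rightarrow> nat \<Rightarrow> nat"
  assumes inter: "x \<in> pverts G \<Longrightarrow> z \<in> pverts G \<Longrightarrow> card {y \<in> neighbours G z. gdist G x y = i} = n (gdist G x z) i"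
begin

definition sphere :: "'a \<Rightarrow> nat \<Rightarrow> 'a set" where "sphere x i = {y \<in> V. dd x y = i}"

definition shell_sum :: "('a \<Rightarrow> real) \<Rightarrow> 'a \<Rightarrow> nat \<Rightarrow> real" where "shell_sum h x i = (\<Sum>y\<in>sphere x i. h y)"

lemma finite_sphere: "finite (sphere x i)" using pair_finite_verts by (simp add: sphere_def)

lemma radial_sum:
  "(\<Sum>z\<in>V. w (dd x z) * h z) = (\<Sum>j\<in>dd x ` V. w j * shell_sum h x j)"
proof -
  have "(\<Sum>z\<in>V. w (dd x z) * h z) = (\<Sum>j\<in>dd x ` V. \<Sum>z\<in>{z \<in> V. dd x z = j}. w (dd x z) * h z)"
    by (rule sum.image_gen[OF pair_finite_verts])
  also have "\<dots> = (\<Sum>j\<in>dd x ` V. w j * shell_sum h x j)"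
    by (rule sum.cong) (simp_all add: shell_sum_def sphere_def sum_distrib_left)
  finally show ?thesis .
qed

lemma shell_neighbour_sum:
  assumes x: "x \<in> V"
  shows "(\<Sum>y\<in>sphere x i. \<Sum>z\<in>N y. h z) = (\<Sum>z\<in>V. real (n (dd x z) i) * h z)"
proof -
  have "(\<Sum>y\<in>sphere x i. \<Sum>z\<in>N y. h z) = (\<Sum>y\<in>sphere x i. \<Sum>z\<in>V. if A y z then h z else 0)"
  proof (rule sum.cong[OF refl])
    fix y
    have "N y = {z \<in> V. A y z}" using N_V by (auto simp: mem_N)
    then show "(\<Sum>z\<in>N y. h z) = (\<Sum>z\<in>V. if A y z then h z else 0)"
      using pair_finite_verts by (simp add: sum.inter_filter[symmetric])
  qed
  also have "\<dots> = (\<Sum>z\<in>V. \<Sum>y\<in>sphere x i. if A y z then h z else 0)" by (rule sum.swap)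
  also have "\<dots> = (\<Sum>z\<in>V. real (n (dd x z) i) * h z)"
  proof (rule sum.cong[OF refl])
    fix z assume z: "z \<in> V"
    have "{y \<in> sphere x i. A y z} = {y \<in> N z. dd x y = i}"
      using adj_sym adjV by (auto simp: sphere_def mem_N)
    then show "(\<Sum>y\<in>sphere x i. if A y z then h z else 0) = real (n (dd x z) i) * h z"
      using inter[OF x z, of i] finite_sphere by (simp add: sum.inter_filter[symmetric])
  qed
  finally show ?thesis .
qed

lemma far_inter:
  assumes "x \<in> V" "z \<in> V" "Suc i < dd x z" shows "n (dd x z) i = 0"
proof -
  have "dd x y \<noteq> i" if "y \<in> N z" for y
    using dd_step[of y z x] that assms adj_sym[of z y] by (auto simp: mem_N)
  then have "{y \<in> N z. dd x y = i} = {}" by blast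
  then show ?thesis using inter[OF assms(1,2), of i] by (simp only: card.empty)
qed

text \<open>The eigenvalue equation summed over a sphere, with the arcs counted from their other
  end. Each shell sum is thus determined by the inner ones unless the leading coefficient vanishes,
  and then \<open>sphere_empty\<close> applies.\<close>

lemma shell_recurrence:
  assumes h: "adj_eigen h \<theta>" and x: "x \<in> V"
  shows "real (n (Suc i) i) * shell_sum h x (Suc i) = \<theta> * shell_sum h x i - (\<Sum>j\<le>i. real (n j i) * shell_sum h x j)"
proof -
  have "\<theta> * shell_sum h x i = (\<Sum>y\<in>sphere x i. \<Sum>z\<in>N y. h z)"
    using h unfolding adj_eigen_def shell_sum_def sum_distrib_left by (intro sum.cong) (auto simp: sphere_def)
  also have "\<dots> = (\<Sum>z\<in>V. real (n (dd x z) i) * h z)" by (rule shell_neighbour_sum[OF x])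
  also have "\<dots> = (\<Sum>j\<in>dd x ` V. real (n j i) * shell_sum h x j)"
    by (rule radial_sum[of "\<lambda>j. real (n j i)"])
  also have "\<dots> = (\<Sum>j\<in>dd x ` V \<union> {..Suc i}. real (n j i) * shell_sum h x j)"
  proof (rule sum.mono_neutral_left)
    show "\<forall>j\<in>dd x ` V \<union> {..Suc i} - dd x ` V. real (n j i) * shell_sum h x j = 0"
    proof
      fix j assume "j \<in> dd x ` V \<union> {..Suc i} - dd x ` V"
      then have "sphere x j = {}" by (auto simp: sphere_def)
      then show "real (n j i) * shell_sum h x j = 0" by (simp add: shell_sum_def)
    qed
  qed (use pair_finite_verts in auto)
  also have "\<dots> = (\<Sum>j\<in>{..Suc i}. real (n j i) * shell_sum h x j)"
  proof (rule sum.mono_neutral_right)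
    show "\<forall>j\<in>dd x ` V \<union> {..Suc i} - {..Suc i}. real (n j i) * shell_sum h x j = 0"
      using far_inter[OF x, of _ i] by (auto simp: not_le)
  qed (use pair_finite_verts in auto)
  finally show ?thesis by simp
qed

lemma shell_sum_0: "x \<in> V \<Longrightarrow> shell_sum h x 0 = h x"
proof -
  assume x: "x \<in> V"
  then have "sphere x 0 = {x}" using dd_0 by (auto simp: sphere_def)
  then show ?thesis by (simp add: shell_sum_def)
qed

lemma sphere_empty:
  assumes "n (Suc i) i = 0" "x \<in> V" shows "sphere x (Suc i) = {}"
proof (rule ccontr)
  assume "sphere x (Suc i) \<noteq> {}"
  then obtain y where y: "y \<in> V" "dd x y = Suc i" by (auto simp: sphere_def)
  obtain z where "A z y" "dd x z = i" using dd_Suc[OF assms(2) y] .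
  then have "z \<in> {z \<in> N y. dd x z = i}" using adj_sym by (simp add: mem_N)
  then have "card {z \<in> N y. dd x z = i} \<noteq> 0" using finite_N by (simp add: card_eq_0_iff) blast
  then show False using inter[OF assms(2) y(1), of i] y(2) assms(1) by simp
qed

text \<open>The recurrence is linear and the same for all centres and eigenfunctions, so shell sums
  depend only on the value at the centre. The product form covers centres where that value is
  zero.\<close>

lemma shell_sum_proportional:
  assumes h: "adj_eigen h \<theta>" and h': "adj_eigen h' \<theta>" and x: "x \<in> V" "x' \<in> V"
  shows "shell_sum h x i * h' x' = shell_sum h' x' i * h x"
proof (induction i rule: less_induct)
  case (less i)
  show ?case
  proof (cases i)
    case 0
    then show ?thesis using shell_sum_0 x by simp
  next
    case (Suc m)
    show ?thesis
    proof (cases "n (Suc m) m = 0")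
      case True
      then show ?thesis using sphere_empty x Suc by (simp add: shell_sum_def)
    next
      case False
      have "(\<Sum>j\<le>m. real (n j m) * shell_sum h x j) * h' x' = (\<Sum>j\<le>m. real (n j m) * (shell_sum h x j * h' x'))"
        by (simp add: sum_distrib_right mult.assoc)
      also have "\<dots> = (\<Sum>j\<le>m. real (n j m) * (shell_sum h' x' j * h x))"
        using less Suc by (intro sum.cong) auto
      also have "\<dots> = (\<Sum>j\<le>m. real (n j m) * shell_sum h' x' j) * h x"
        by (simp add: sum_distrib_right mult.assoc)
      finally have eq: "(\<Sum>j\<le>m. real (n j m) * shell_sum h x j) * h' x' = (\<Sum>j\<le>m. real (n j m) * shell_sum h' x' j) * h x" .
      have IH: "shell_sum h x m * h' x' = shell_sum h' x' m * h x" using less[of m] Suc by simp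
      have "real (n (Suc m) m) * (shell_sum h x (Suc m) * h' x') = (\<theta> * shell_sum h x m - (\<Sum>j\<le>m. real (n j m) * shell_sum h x j)) * h' x'"
        using shell_recurrence[OF h x(1), of m] by (simp add: mult.assoc[symmetric])
      also have "\<dots> = \<theta> * (shell_sum h x m * h' x') - (\<Sum>j\<le>m. real (n j m) * shell_sum h x j) * h' x'"
        by (simp add: left_diff_distrib mult.assoc)
      also have "\<dots> = \<theta> * (shell_sum h' x' m * h x) - (\<Sum>j\<le>m. real (n j m) * shell_sum h' x' j) * h x"
        unfolding eq IH ..
      also have "\<dots> = (\<theta> * shell_sum h' x' m - (\<Sum>j\<le>m. real (n j m) * shell_sum h' x' j)) * h x"
        by (simp add: left_diff_distrib mult.assoc)
      also have "\<dots> = real (n (Suc m) m) * (shell_sum h' x' (Suc m) * h x)"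
        using shell_recurrence[OF h' x(2), of m] by (simp add: mult.assoc[symmetric])
      finally show ?thesis using False Suc by simp
    qed
  qed
qed

text \<open>Proportionality applied to the constant eigenfunction, whose shell sums are the sizes of
  the spheres.\<close>

lemma card_sphere: assumes "x \<in> V" "x' \<in> V" shows "card (sphere x i) = card (sphere x' i)"
proof -
  have "adj_eigen (\<lambda>_. 1) k" unfolding adj_eigen_def using card_N by simp
  then show ?thesis using shell_sum_proportional[OF _ _ assms, of "\<lambda>_. 1" k "\<lambda>_. 1" i] by (simp add: shell_sum_def)
qed

text \<open>
  \<open>u\<close> is the standard sequence of \<open>\<theta>\<close>: the kernel \<open>u (dd x y)\<close> is a multiple of the orthogonal projection
  onto the \<open>\<theta>\<close>-eigenspace.
\<close>

lemma ex_standard_sequence: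
  assumes f: "adj_eigen f \<theta>" "x0 \<in> V" "f x0 \<noteq> 0"
  shows "\<exists>u C. u 0 = 1 \<and> (\<forall>x\<in>V. adj_eigen (\<lambda>y. u (dd x y)) \<theta>) \<and> C > 0 \<and>
    (\<forall>x\<in>V. \<forall>h. adj_eigen h \<theta> \<longrightarrow> (\<Sum>z\<in>V. u (dd x z) * h z) = C * h x)"
proof -
  \<comment> \<open>The mean of f over the sphere of radius i, normalised at the centre.\<close>
  define u where "u i = shell_sum f x0 i / (f x0 * card (sphere x0 i))" for i
  have shell_u: "shell_sum h x i = card (sphere x i) * u i * h x" if "adj_eigen h \<theta>" "x \<in> V" for h x i
  proof (cases "sphere x i = {}")
    case False
    then have c: "card (sphere x0 i) > 0" using card_sphere[OF that(2) f(2)] finite_sphere by (simp add: card_gt_0_iff flip: card_sphere[OF that(2) f(2)])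
    have "shell_sum h x i * f x0 = shell_sum f x0 i * h x" using shell_sum_proportional[OF that(1) f(1) that(2) f(2)] .
    moreover have "shell_sum f x0 i = u i * (f x0 * card (sphere x0 i))" using f(3) c by (simp add: u_def)
    ultimately have "shell_sum h x i * f x0 = card (sphere x i) * u i * h x * f x0"
      using card_sphere[OF that(2) f(2), of i] by (simp add: algebra_simps)
    then show ?thesis using f(3) by simp
  qed (simp add: shell_sum_def)
  have u0: "u 0 = 1"
  proof -
    have "sphere x0 0 = {x0}" using f(2) dd_0 by (auto simp: sphere_def)
    then show ?thesis using shell_sum_0[OF f(2)] f(3) by (simp add: u_def)
  qed
  have shell_radial: "shell_sum (\<lambda>z. u (dd x z)) x j = card (sphere x j) * u j" for x j
  proof -
    have "shell_sum (\<lambda>z. u (dd x z)) x j = (\<Sum>z\<in>sphere x j. u j)"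
      unfolding shell_sum_def by (rule sum.cong) (auto simp: sphere_def)
    then show ?thesis by simp
  qed
  have row: "(\<Sum>z\<in>N y. u (dd x z)) = (\<Sum>j\<le>Suc (dd x y). real (n (dd x y) j) * u j)" if xy: "x \<in> V" "y \<in> V" for x y
  proof -
    have sub: "dd x ` N y \<subseteq> {..Suc (dd x y)}" using dd_step[OF _ xy(1)] by (auto simp: mem_N)
    have "(\<Sum>z\<in>N y. u (dd x z)) = (\<Sum>j\<in>{..Suc (dd x y)}. \<Sum>z\<in>{z \<in> N y. dd x z = j}. u (dd x z))"
      by (rule sum.group[symmetric]) (use finite_N sub in auto)
    also have "\<dots> = (\<Sum>j\<le>Suc (dd x y). real (n (dd x y) j) * u j)"
      by (rule sum.cong) (simp_all add: inter[OF xy])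
    finally show ?thesis .
  qed
  have eig: "adj_eigen (\<lambda>y. u (dd x y)) \<theta>" if x: "x \<in> V" for x
    unfolding adj_eigen_def
  proof
    fix y assume y: "y \<in> V"
    define i where "i = dd x y"
    define r where "r = (\<Sum>j\<le>Suc i. real (n i j) * u j)"
    have "sphere x i \<noteq> {}" using y by (auto simp: sphere_def i_def)
    then have c: "card (sphere x0 i) > 0" using card_sphere[OF x f(2), of i] finite_sphere[of x i] by (metis card_gt_0_iff)
    \<comment> \<open>The row equation depends on x and y only through i, so it may be checked in
      the sum over a sphere around x0; there the radial function and f / f x0 have equal shell
      sums.\<close>
    have "card (sphere x0 i) * r = (\<Sum>y\<in>sphere x0 i. \<Sum>z\<in>N y. u (dd x0 z))"
      using row[OF f(2)] by (simp add: sphere_def r_def)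
    also have "\<dots> = (\<Sum>j\<in>dd x0 ` V. real (n j i) * shell_sum (\<lambda>z. u (dd x0 z)) x0 j)"
      unfolding shell_neighbour_sum[OF f(2)] by (rule radial_sum[of "\<lambda>j. real (n j i)"])
    also have "\<dots> = (\<Sum>j\<in>dd x0 ` V. real (n j i) * shell_sum f x0 j) / f x0"
      unfolding shell_radial using shell_u[OF f(1,2)] f(3) by (simp add: sum_divide_distrib)
    also have "(\<Sum>j\<in>dd x0 ` V. real (n j i) * shell_sum f x0 j) = (\<Sum>y\<in>sphere x0 i. \<Sum>z\<in>N y. f z)"
      unfolding shell_neighbour_sum[OF f(2)] by (rule radial_sum[of "\<lambda>j. real (n j i)", symmetric])
    also have "\<dots> = \<theta> * shell_sum f x0 i"
      using f(1) unfolding adj_eigen_def shell_sum_def sum_distrib_left by (intro sum.cong) (auto simp: sphere_def)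
    also have "\<dots> / f x0 = card (sphere x0 i) * (\<theta> * u i)" using shell_u[OF f(1,2)] f(3) by simp
    finally have "r = \<theta> * u i" using c by simp
    then show "(\<Sum>z\<in>N y. u (dd x z)) = \<theta> * u (dd x y)" using row[OF x y] by (simp add: r_def i_def)
  qed
  define C where "C = (\<Sum>z\<in>V. u (dd x0 z) * u (dd x0 z))"
  have Cx: "(\<Sum>z\<in>V. u (dd x z) * h z) = C * h x" if x: "x \<in> V" and h: "adj_eigen h \<theta>" for x h
  proof -
    have im: "dd x ` V = dd x0 ` V"
    proof -
      have "j \<in> dd x ` V \<longleftrightarrow> card (sphere x j) > 0" for x j
        using finite_sphere[of x j] by (auto simp: card_gt_0_iff sphere_def)
      then show ?thesis by (simp add: set_eq_iff card_sphere[OF x f(2)] del: image_iff)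
    qed
    have "(\<Sum>z\<in>V. u (dd x z) * h z) = (\<Sum>j\<in>dd x0 ` V. u j * shell_sum h x j)"
      unfolding im[symmetric] by (rule radial_sum)
    also have "\<dots> = (\<Sum>j\<in>dd x0 ` V. u j * (card (sphere x0 j) * u j)) * h x"
      using shell_u[OF h x] card_sphere[OF x f(2)] by (simp add: sum_distrib_right sum_distrib_left algebra_simps)
    also have "(\<Sum>j\<in>dd x0 ` V. u j * (card (sphere x0 j) * u j)) = C"
      unfolding C_def radial_sum[of u x0 "\<lambda>z. u (dd x0 z)"] shell_radial ..
    finally show ?thesis .
  qed
  have "C > 0"
  proof -
    have "u (dd x0 x0) * u (dd x0 x0) \<le> C"
      unfolding C_def using f(2) pair_finite_verts by (intro member_le_sum) auto
    then show ?thesis using u0 dd_self[OF f(2)] by simp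
  qed
  then show ?thesis using u0 eig Cx by (intro exI[of _ u] exI[of _ C]) simp
qed

subsection \<open>Sharp graphs are minuscule\<close>

text \<open>A vertex x becomes the eigenfunction \<open>K x\<close>. By the reproducing identity
  \<open>rep\<close>, inner products in the eigenspace are kernel values times \<open>C\<close>, so
  steepness of a potential becomes Cauchy-Schwarz and the equality case identifies vectors.\<close>

theorem minuscule_if_sharp:
  assumes sharp: "lichnerowicz_sharp G"
  shows "\<exists>D. minuscule V A D"
proof -
  have ne: "parcs G \<noteq> {}" using sharp by (simp add: lichnerowicz_sharp_def)
  define l where "l = lambda1 G"
  have "l \<in> {l. matrix_eigenvalue_on V (normalized_laplacian G) l \<and> l \<noteq> 0}"
    unfolding l_def lambda1_def using lambda1_set ne by (intro Min_in) auto
  then have l: "l \<noteq> 0" "\<exists>f. (\<exists>x\<in>V. f x \<noteq> 0) \<and> adj_eigen f (k * (1 - l))"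
    unfolding laplacian_eigenvalue_iff by auto
  define \<theta> where "\<theta> = k * (1 - l)"
  have th: "1 - \<theta> / k = l" using k_pos by (simp add: \<theta>_def)
  obtain f x0 where f: "adj_eigen f \<theta>" "x0 \<in> V" "f x0 \<noteq> 0" using l(2) unfolding \<theta>_def by blast
  obtain u C where u0: "u 0 = 1" and ueig': "\<forall>x\<in>V. adj_eigen (\<lambda>y. u (dd x y)) \<theta>" and C: "C > 0"
    and rep': "\<forall>x\<in>V. \<forall>h. adj_eigen h \<theta> \<longrightarrow> (\<Sum>z\<in>V. u (dd x z) * h z) = C * h x"
    using ex_standard_sequence[OF f] by blast
  note ueig = bspec[OF ueig']
  have rep: "(\<Sum>z\<in>V. u (dd x z) * h z) = C * h x" if "x \<in> V" "adj_eigen h \<theta>" for x h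
    using rep' that by blast
  define K where "K x y = u (dd x y)" for x y
  have Ksym: "K x y = K y x" if "x \<in> V" "y \<in> V" for x y using dd_sym[OF that] by (simp add: K_def)
  have Kself: "K x x = 1" if "x \<in> V" for x using dd_self[OF that] u0 by (simp add: K_def)
  have Kadj: "K x y = u 1" if "A x y" for x y using dd_adj[OF that] by (simp add: K_def)
  have u1: "u 1 \<noteq> 1"
  proof
    assume 1: "u 1 = 1"
    have "(\<Sum>y\<in>N x0. u (dd x0 y)) = (\<Sum>y\<in>N x0. 1)" 
    proof (rule sum.cong[OF refl])
      fix y assume "y \<in> N x0"
      then show "u (dd x0 y) = 1" using 1 dd_adj[of x0 y] by (simp add: mem_N)
    qed
    then have "\<theta> = k" using ueig[OF f(2)] f(2) card_N dd_self u0 unfolding adj_eigen_def by simp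
    then show False using l(1) k_pos by (simp add: \<theta>_def)
  qed
  define r where "r x y t = K x t - K y t" for x y t
  have reig: "adj_eigen (r x y) \<theta>" if "x \<in> V" "y \<in> V" for x y
    using ueig[OF that(1)] ueig[OF that(2)] unfolding adj_eigen_def r_def K_def
    by (simp add: sum_subtractf right_diff_distrib)
  have inner: "(\<Sum>t\<in>V. r z w t * r x y t) = C * (r x y z - r x y w)" if "x \<in> V" "y \<in> V" "z \<in> V" "w \<in> V" for x y z w
  proof -
    have "(\<Sum>t\<in>V. r z w t * r x y t) = (\<Sum>t\<in>V. K z t * r x y t) - (\<Sum>t\<in>V. K w t * r x y t)"
      by (simp add: r_def[of z w] left_diff_distrib sum_subtractf)
    then show ?thesis
      using rep[OF that(3) reig[OF that(1,2)]] rep[OF that(4) reig[OF that(1,2)]] by (simp add: K_def right_diff_distrib)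
  qed
  \<comment> \<open>Up to the factor \<open>C\<close> this is the squared length of every edge
    vector, and therefore also the maximal gradient of \<open>r x y\<close>.\<close>
  define L where "L = 2 * (1 - u 1)"
  have norm: "(\<Sum>t\<in>V. r x y t * r x y t) = C * L" if "A x y" for x y
    using inner[of x y x y] adjV[OF that] Kself Kadj[OF that] Kadj[OF adj_sym[OF that]] by (simp add: r_def L_def)
  have L: "L > 0"
  proof -
    obtain x y where "A x y" using ne by auto
    moreover have "0 \<le> (\<Sum>t\<in>V. r x y t * r x y t)" by (rule sum_nonneg) simp
    ultimately have "0 \<le> C * L" using norm by simp
    then have "0 \<le> L" using C by (simp add: zero_le_mult_iff)
    then show ?thesis using u1 by (simp add: L_def)
  qed
  have diff: "(\<Sum>t\<in>V. (r x y t - r z w t)\<^sup>2) = 2 * C * (L - (r x y z - r x y w))" if "A x y" "A z w" for x y z w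
  proof -
    have "(\<Sum>t\<in>V. (r x y t - r z w t)\<^sup>2) = (\<Sum>t\<in>V. r x y t * r x y t) + (\<Sum>t\<in>V. r z w t * r z w t) - 2 * (\<Sum>t\<in>V. r z w t * r x y t)"
      by (simp add: power2_eq_square algebra_simps sum.distrib sum_subtractf sum_distrib_left)
    moreover have "(\<Sum>t\<in>V. r z w t * r x y t) = C * (r x y z - r x y w)"
      using inner adjV[OF that(1)] adjV[OF that(2)] by blast
    ultimately show ?thesis unfolding norm[OF that(1)] norm[OF that(2)] by (simp add: algebra_simps)
  qed
  have grad: "r x y z - r x y w \<le> L" if "A x y" "A z w" for x y z w
  proof -
    have "0 \<le> (\<Sum>t\<in>V. (r x y t - r z w t)\<^sup>2)" by (rule sum_nonneg) simp
    then have "0 \<le> 2 * C * (L - (r x y z - r x y w))" using diff[OF that] by simp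
    then show ?thesis using C by (simp add: zero_le_mult_iff)
  qed
  have extremal: "r z w t = r x y t" if "A x y" "A z w" "r x y z - r x y w = L" "t \<in> V" for x y z w t
  proof -
    have "(\<Sum>t\<in>V. (r x y t - r z w t)\<^sup>2) = 0" using diff[OF that(1,2)] that(3) by simp
    then have "\<forall>t\<in>V. (r x y t - r z w t)\<^sup>2 = 0" using pair_finite_verts by (subst (asm) sum_nonneg_eq_0_iff) auto
    then show ?thesis using that(4) by simp
  qed
  have rxy: "r x y x - r x y y = L" if "A x y" for x y
    using Kself adjV[OF that] Kadj[OF that] Kadj[OF adj_sym[OF that]] by (simp add: r_def L_def)
  have curv: "l \<le> lly_curvature G x y" if xy: "A x y" for x y
  proof -
    have "finite {lly_curvature G x y |x y. A x y}"
    proof -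
      have "{lly_curvature G x y |x y. A x y} = (\<lambda>(x, y). lly_curvature G x y) ` parcs G" by force
      then show ?thesis using pair_finite_arcs by simp
    qed
    moreover have "lly_curvature G x y \<in> {lly_curvature G x y |x y. A x y}" using xy by blast
    ultimately have "Min {lly_curvature G x y |x y. A x y} \<le> lly_curvature G x y" by (rule Min_le)
    then show ?thesis using sharp unfolding lichnerowicz_sharp_def l_def[symmetric] by simp
  qed
  have translate: "\<exists>w. A y w \<and> A z w \<and> (\<forall>s\<in>V. r z w s = r x y s)"
    if xy: "A x y" and xz: "A x z" and zy: "z \<noteq> y" "\<not> A y z" for x y z
  proof (rule ccontr)
    assume none: "\<not> ?thesis"
    have V: "x \<in> V" "y \<in> V" "z \<in> V" using xy xz adjV by auto
    \<comment> \<open>The Kantorovich slack of moving mass from z to w. Without a translate it is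
      positive on the whole support B of the measure at y, which will push the curvature strictly
      below l.\<close>
    define ex where "ex w = L * dd z w - (r x y z - r x y w)" for w
    define B where "B = insert y (N y)"
    have B: "finite B" "B \<noteq> {}" "B \<subseteq> V" using finite_N N_V V by (auto simp: B_def)
    have pos: "ex w > 0" if w: "w \<in> B" for w
    proof (rule ccontr)
      assume "\<not> ex w > 0"
      have wV: "w \<in> V" using w B by blast
      have lip: "r x y a - r x y b \<le> L * dd a b" if "a \<in> V" "b \<in> V" for a b
        using lipschitz[of "r x y" L, OF grad[OF xy] that] .
      have eq: "r x y z - r x y w = L * dd z w" using \<open>\<not> ex w > 0\<close> lip[OF V(3) wV] by (simp add: ex_def)
      have "z \<noteq> w" using w zy adj_sym by (auto simp: B_def mem_N)
      then have "dd z w \<noteq> 0" using dd_0 V wV by blast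
      then obtain m where m: "dd z w = Suc m" by (cases "dd z w") auto
      obtain z1 where z1: "A z z1" "dd z1 w = m" using dd_Suc_left[OF V(3) wV m] .
      have z1V: "z1 \<in> V" using z1 adjV by blast
      have e1: "r x y z - r x y z1 = L" "r x y z1 - r x y w = L * dd z1 w"
        using grad[OF xy z1(1)] lip[OF z1V wV] eq m z1(2) by (simp_all add: algebra_simps)
      have p1: "r z z1 t = r x y t" if "t \<in> V" for t using extremal[OF xy z1(1) e1(1) that] .
      show False
      proof (cases m)
        case 0
        then have "z1 = w" using z1 dd_0[OF z1V wV] by simp
        then have "A z w" using z1 by simp
        moreover from this have "A y w" using w zy adj_sym by (auto simp: B_def mem_N)
        ultimately show False using none p1 \<open>z1 = w\<close> by blast
      next
        case (Suc m')
        \<comment> \<open>Two consecutive extremal arcs would both represent the vector of x y;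
          evaluated at z1 they give 1 - u 1 and u 1 - 1.\<close>
        obtain z2 where z2: "A z1 z2" "dd z2 w = m'" using dd_Suc_left[OF z1V wV] z1(2) Suc by metis
        have z2V: "z2 \<in> V" using z2 adjV by blast
        have e2: "r x y z1 - r x y z2 = L"
          using grad[OF xy z2(1)] lip[OF z2V wV] e1(2) z1(2) z2(2) Suc by (simp add: algebra_simps)
        have "r z1 z2 z1 = r z z1 z1" using extremal[OF xy z2(1) e2 z1V] p1[OF z1V] by simp
        then have "1 - u 1 = u 1 - 1"
          using Kself[OF z1V] Kadj[OF z1(1)] Kadj[OF adj_sym[OF z2(1)]] by (simp add: r_def)
        then show False using u1 by simp
      qed
    qed
    define \<delta> where "\<delta> = Min (ex ` B)"
    \<comment> \<open>All of the mass (1 - p) / k at z must go into B, so every plan pays at least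
      \<delta> (1 - p) / k above the dual bound, before division by L.\<close>
    have \<delta>: "\<delta> > 0" "\<And>w. w \<in> B \<Longrightarrow> \<delta> \<le> ex w" unfolding \<delta>_def using B pos by (simp_all add: Min_gr_iff)
    have "lly_curvature G x y \<le> l - \<delta> / (k * L)"
    proof (rule lly_le[OF xy, of 0])
      fix p :: real assume p: "0 < p" "p < 1"
      have "p + (1 - p) * \<theta> / k + \<delta> * (1 - p) / (k * L) \<le> wasserstein G (lazy_walk_measure G p x) (lazy_walk_measure G p y)"
      proof (rule wasserstein_ge)
        show "\<exists>\<pi>. coupling G (lazy_walk_measure G p x) (lazy_walk_measure G p y) \<pi>"
          using ex_coupling[OF V(1,2)] p by simp
        fix \<pi> assume \<pi>: "coupling G (lazy_walk_measure G p x) (lazy_walk_measure G p y) \<pi>"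
        have \<pi>0: "0 \<le> \<pi> a b" if "a \<in> V" "b \<in> V" for a b using \<pi> that unfolding coupling_def by blast
        have zero: "\<pi> z w = 0" if w: "w \<in> V" "w \<notin> B" for w
        proof -
          have "(\<Sum>a\<in>V. \<pi> a w) = lazy_walk_measure G p y w" using \<pi> w unfolding coupling_def by blast
          also have "\<dots> = 0" using w(2) by (auto simp: lazy_walk_measure_def B_def mem_N)
          finally have "\<forall>a\<in>V. \<pi> a w = 0" using \<pi>0 w(1) pair_finite_verts by (subst (asm) sum_nonneg_eq_0_iff) auto
          then show ?thesis using V by blast
        qed
        have "\<delta> * ((1 - p) / k) = (\<Sum>w\<in>V. \<pi> z w * \<delta>)"
        proof -
          have "(\<Sum>w\<in>V. \<pi> z w) = lazy_walk_measure G p x z" using \<pi> V unfolding coupling_def by blast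
          also have "\<dots> = (1 - p) / k" using xz adj_irrefl regular[OF V(1)] by (auto simp: lazy_walk_measure_def)
          finally have "(\<Sum>w\<in>V. \<pi> z w) = (1 - p) / k" .
          then show ?thesis unfolding sum_distrib_right[symmetric] by simp
        qed
        also have "\<dots> \<le> (\<Sum>w\<in>V. \<pi> z w * (L * dd z w - (r x y z - r x y w)))"
        proof (rule sum_mono)
          fix w assume w: "w \<in> V"
          show "\<pi> z w * \<delta> \<le> \<pi> z w * (L * dd z w - (r x y z - r x y w))"
          proof (cases "w \<in> B")
            case True
            show ?thesis using \<delta>(2)[OF True] \<pi>0[OF V(3) w] unfolding ex_def by (rule mult_left_mono)
          next
            case False
            then show ?thesis using zero[OF w] by simp
          qed
        qed
        also have "\<dots> \<le> (\<Sum>a\<in>V. \<Sum>w\<in>V. \<pi> a w * (L * dd a w - (r x y a - r x y w)))"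
          by (rule member_le_sum[OF V(3), of "\<lambda>a. \<Sum>w\<in>V. \<pi> a w * (L * dd a w - (r x y a - r x y w))"])
            (use pair_finite_verts excess_nonneg(1)[of _ _ \<pi> "r x y" L, OF \<pi> grad[OF xy]] in \<open>auto intro!: sum_nonneg\<close>)
        also have "\<dots> = L * cost \<pi> - (p + (1 - p) * \<theta> / k) * L"
          using cost_excess[OF \<pi>, of L "r x y"] lazy_potential_diff[OF reig[OF V(1,2)] V(1,2), of p] rxy[OF xy] by simp
        finally have "(p + (1 - p) * \<theta> / k) * L + \<delta> * ((1 - p) / k) \<le> cost \<pi> * L" by (simp add: mult.commute)
        then have "((p + (1 - p) * \<theta> / k) * L + \<delta> * ((1 - p) / k)) / L \<le> cost \<pi>" using L by (simp add: pos_divide_le_eq)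
        moreover have "((p + (1 - p) * \<theta> / k) * L + \<delta> * ((1 - p) / k)) / L = p + (1 - p) * \<theta> / k + \<delta> * (1 - p) / (k * L)"
          using L by (simp add: add_divide_distrib)
        ultimately show "p + (1 - p) * \<theta> / k + \<delta> * (1 - p) / (k * L) \<le> cost \<pi>" by simp
      qed
      then have "lazy_curvature G p x y \<le> 1 - (p + (1 - p) * \<theta> / k + \<delta> * (1 - p) / (k * L))"
        unfolding lazy_curvature_def using dd_adj[OF xy] by simp
      also have "\<dots> = (1 - \<theta> / k - \<delta> / (k * L)) * (1 - p)" by (simp add: algebra_simps)
      finally show "lazy_curvature G p x y / (1 - p) \<le> l - \<delta> / (k * L)" using p th by (simp add: pos_divide_le_eq)
    qed simp
    moreover have "\<delta> / (k * L) > 0" using \<delta>(1) k_pos L by simp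
    ultimately show False using curv[OF xy] by simp
  qed
  \<comment> \<open>The parallelogram on x, y, z gives the kernel value at w and y, another pair at
    distance two. Since \<open>K\<close> depends only on the distance, the same value holds at x and
    z.\<close>
  have u2: "K x z = 2 * u 1 - 1" if xy: "A x y" "A y z" "x \<noteq> z" "\<not> A x z" for x y z
  proof -
    have V: "x \<in> V" "y \<in> V" "z \<in> V" using xy adjV by auto
    obtain w where w: "A z w" "A x w" "\<forall>s\<in>V. r x w s = r y z s"
      using translate[OF xy(2) adj_sym[OF xy(1)]] xy(3,4) adj_sym by blast
    have wV: "w \<in> V" using w adjV by blast
    have "K x y - K w y = K y y - K z y" using w(3) V unfolding r_def by blast
    then have kw: "K w y = 2 * u 1 - 1" using Kself[OF V(2)] Kadj[OF xy(1)] Kadj[OF adj_sym[OF xy(2)]] by simp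
    have "w \<noteq> y" using kw Kself[OF V(2)] u1 by auto
    moreover have "\<not> A w y" using kw Kadj[of w y] u1 by auto
    ultimately have "dd w y = 2" using dd_two[OF adj_sym[OF w(1)] adj_sym[OF xy(2)]] by blast
    moreover have "dd x z = 2" using dd_two[OF xy] .
    ultimately show ?thesis using kw by (simp add: K_def)
  qed
  \<comment> \<open>Half the squared distance of the unit vectors, scaled so that adjacent vertices
    have \<open>D = 1\<close>.\<close>
  define D where "D x y = (1 - K x y) / (1 - u 1)" for x y
  have "minuscule V A D"
  proof
    show "A\<^sup>*\<^sup>* x y" if "x \<in> V" "y \<in> V" for x y using rtranclp_adj that by blast
    show "D x y = 1" if "A x y" for x y using Kadj[OF that] u1 by (simp add: D_def)
    show "D x z = 2" if "A x y" "A y z" "x \<noteq> z" "\<not> A x z" for x y z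
      using u2[OF that] u1 by (simp add: D_def field_simps)
    show "\<exists>w. A y w \<and> A z w \<and> (\<forall>s\<in>V. D s w - D s z = D s y - D s x)"
      if as: "A x y" "A x z" "z \<noteq> y" "\<not> A y z" for x y z
    proof -
      obtain w where w: "A y w" "A z w" "\<forall>s\<in>V. r z w s = r x y s" using translate[OF as] by blast
      have V: "x \<in> V" "y \<in> V" "z \<in> V" "w \<in> V" using as w adjV by auto
      have "D s w - D s z = D s y - D s x" if s: "s \<in> V" for s
      proof -
        have "K z s - K w s = K x s - K y s" using w(3) s unfolding r_def by blast
        then show ?thesis using Ksym[OF s] V by (simp add: D_def diff_divide_distrib[symmetric])
      qed
      then show ?thesis using w by blast
    qed
  qed (use pair_finite_verts adjV adj_sym adj_irrefl Kself Ksym in \<open>auto simp: D_def\<close>)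
  then show ?thesis by blast
qed

end

subsection \<open>The classification\<close>

text \<open>The general notion carries separate maps for vertices, arcs, tails and heads. Here tails
  and heads are \<open>fst\<close> and \<open>snd\<close>, which forces the arc map to be
  \<open>map_prod\<close> of the vertex map.\<close>

lemma digraph_iso_pair_iff:
  assumes G: "pair_wf_digraph G"
  shows "digraph_iso (with_proj G) (with_proj H) \<longleftrightarrow>
    (\<exists>\<phi>. bij_betw \<phi> (pverts G) (pverts H) \<and> parcs H = map_prod \<phi> \<phi> ` parcs G)"
proof
  interpret pair_wf_digraph G by fact
  assume "digraph_iso (with_proj G) (with_proj H)"
  then obtain f where f: "digraph_isomorphism f" and H: "with_proj H = app_iso f (with_proj G)"
    unfolding digraph_iso_def by blast
  have eqs: "pverts H = iso_verts f ` pverts G" "parcs H = iso_arcs f ` parcs G"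
      "fst = iso_tail f" "snd = iso_head f"
    using arg_cong[OF H, of verts] arg_cong[OF H, of arcs] arg_cong[OF H, of tail] arg_cong[OF H, of head]
    by simp_all
  have "iso_arcs f a = map_prod (iso_verts f) (iso_verts f) a" if "a \<in> parcs G" for a
    using f that eqs(3,4) unfolding digraph_isomorphism_def by (cases a) (auto simp: prod_eq_iff)
  then have "parcs H = map_prod (iso_verts f) (iso_verts f) ` parcs G" using eqs(2) by (auto simp: image_iff)
  moreover have "bij_betw (iso_verts f) (pverts G) (pverts H)"
    using f eqs(1) unfolding digraph_isomorphism_def bij_betw_def by simp
  ultimately show "\<exists>\<phi>. bij_betw \<phi> (pverts G) (pverts H) \<and> parcs H = map_prod \<phi> \<phi> ` parcs G" by blast
next
  interpret pair_wf_digraph G by fact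
  assume "\<exists>\<phi>. bij_betw \<phi> (pverts G) (pverts H) \<and> parcs H = map_prod \<phi> \<phi> ` parcs G"
  then obtain \<phi> where \<phi>: "bij_betw \<phi> (pverts G) (pverts H)" "parcs H = map_prod \<phi> \<phi> ` parcs G" by blast
  define f where "f = \<lparr>iso_verts = \<phi>, iso_arcs = map_prod \<phi> \<phi>, iso_head = snd, iso_tail = fst\<rparr>"
  have inj: "inj_on \<phi> (pverts G)" using \<phi>(1) by (simp add: bij_betw_def)
  have "inj_on (map_prod \<phi> \<phi>) (parcs G)"
    by (rule inj_on_subset[OF map_prod_inj_on[OF inj inj]]) (use in_arcsD1 in_arcsD2 in auto)
  then have "digraph_isomorphism f"
    unfolding digraph_isomorphism_def using inj wf_digraph_axioms by (simp add: f_def)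
  moreover have "with_proj H = app_iso f (with_proj G)"
    using \<phi> by (simp add: with_proj_def app_iso_def f_def bij_betw_def)
  ultimately show "digraph_iso (with_proj G) (with_proj H)" unfolding digraph_iso_def by blast
qed

text \<open>From \<open>minuscule\<close> comes the fact that arcs of H have both ends in
  \<open>pverts H\<close>.\<close>

lemma digraph_iso_iff:
  assumes G: "pair_wf_digraph G" and M: "minuscule (pverts H) (adjG H) E"
  shows "digraph_iso (with_proj G) (with_proj H) \<longleftrightarrow> iso_on (pverts G) (adjG G) (pverts H) (adjG H)"
proof -
  interpret G: pair_wf_digraph G by fact
  interpret H: minuscule "pverts H" "adjG H" E by fact
  have "parcs H = map_prod \<phi> \<phi> ` parcs G \<longleftrightarrow> (\<forall>x\<in>pverts G. \<forall>y\<in>pverts G. adjG G x y \<longleftrightarrow> adjG H (\<phi> x) (\<phi> y))"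
    if \<phi>: "bij_betw \<phi> (pverts G) (pverts H)" for \<phi>
  proof
    assume eq: "parcs H = map_prod \<phi> \<phi> ` parcs G"
    show "\<forall>x\<in>pverts G. \<forall>y\<in>pverts G. adjG G x y \<longleftrightarrow> adjG H (\<phi> x) (\<phi> y)"
    proof (intro ballI iffI)
      fix x y assume xy: "x \<in> pverts G" "y \<in> pverts G" and "adjG H (\<phi> x) (\<phi> y)"
      then obtain a b where ab: "adjG G a b" "\<phi> x = \<phi> a" "\<phi> y = \<phi> b" using eq by auto
      then have "x = a" "y = b"
        using \<phi> xy G.in_arcsD1 G.in_arcsD2 unfolding bij_betw_def inj_on_def by blast+
      then show "adjG G x y" using ab by simp
    qed (use eq in force)
  next
    assume iff: "\<forall>x\<in>pverts G. \<forall>y\<in>pverts G. adjG G x y \<longleftrightarrow> adjG H (\<phi> x) (\<phi> y)"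
    show "parcs H = map_prod \<phi> \<phi> ` parcs G"
    proof (intro equalityI subsetI)
      fix e assume "e \<in> parcs H"
      then obtain u v where e: "e = (u, v)" "adjG H u v" by (cases e) auto
      have "u \<in> pverts H" "v \<in> pverts H" using e H.A_V H.A_V2 by blast+
      then obtain x y where "x \<in> pverts G" "y \<in> pverts G" "\<phi> x = u" "\<phi> y = v"
        using bij_betw_imp_surj_on[OF \<phi>] by (metis imageE)
      then show "e \<in> map_prod \<phi> \<phi> ` parcs G" using iff e by force
    next
      fix e assume "e \<in> map_prod \<phi> \<phi> ` parcs G"
      then obtain x y where "adjG G x y" "e = (\<phi> x, \<phi> y)" by auto
      then show "e \<in> parcs H" using iff G.in_arcsD1 G.in_arcsD2 by blast
    qed
  qed
  then show ?thesis unfolding digraph_iso_pair_iff[OF G] iso_on_def by blast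
qed

text \<open>Excludes the one-vertex graph, which has no edge and is not sharp by definition.\<close>

lemma distinct_vertices:
  "n \<ge> 2 \<Longrightarrow> \<exists>u v. u \<in> pverts (cocktail_party_graph n) \<and> v \<in> pverts (cocktail_party_graph n) \<and> u \<noteq> v"
  "d \<ge> 1 \<Longrightarrow> n \<ge> 2 \<Longrightarrow> \<exists>u v. u \<in> pverts (hamming_graph d n) \<and> v \<in> pverts (hamming_graph d n) \<and> u \<noteq> v"
  "1 \<le> k \<Longrightarrow> k \<le> n - 1 \<Longrightarrow> \<exists>u v. u \<in> pverts (johnson_graph n k) \<and> v \<in> pverts (johnson_graph n k) \<and> u \<noteq> v"
  "n \<ge> 2 \<Longrightarrow> \<exists>u v. u \<in> pverts (demicube_graph n) \<and> v \<in> pverts (demicube_graph n) \<and> u \<noteq> v"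
  "\<exists>u v. u \<in> pverts schlaefli_graph \<and> v \<in> pverts schlaefli_graph \<and> u \<noteq> v"
  "\<exists>u v. u \<in> gosset_verts \<and> v \<in> gosset_verts \<and> u \<noteq> v"
proof -
  show "\<exists>u v. u \<in> pverts (cocktail_party_graph n) \<and> v \<in> pverts (cocktail_party_graph n) \<and> u \<noteq> v" if "n \<ge> 2"
    using that by (intro exI[of _ 0] exI[of _ 1]) (simp add: cocktail_party_graph_def graph_on_def)
  show "\<exists>u v. u \<in> pverts (hamming_graph d n) \<and> v \<in> pverts (hamming_graph d n) \<and> u \<noteq> v" if "d \<ge> 1" "n \<ge> 2"
  proof -
    have "replicate d (0::nat) ! 0 \<noteq> replicate d 1 ! 0" using that by simp
    then have "replicate d (0::nat) \<noteq> replicate d 1" by metis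
    then show ?thesis using that
      by (intro exI[of _ "replicate d 0"] exI[of _ "replicate d 1"]) (auto simp: hamming_graph_def graph_on_def)
  qed
  show "\<exists>u v. u \<in> pverts (johnson_graph n k) \<and> v \<in> pverts (johnson_graph n k) \<and> u \<noteq> v" if "1 \<le> k" "k \<le> n - 1"
  proof -
    have "adjG (johnson_graph n k) {..<k} {1..k}" using johnson_local_local(1)[of k n] that by simp
    moreover have "0 \<in> {..<k}" "0 \<notin> {1..k}" using that by auto
    ultimately show ?thesis unfolding adj_johnson by metis
  qed
  show "\<exists>u v. u \<in> pverts (demicube_graph n) \<and> v \<in> pverts (demicube_graph n) \<and> u \<noteq> v" if "n \<ge> 2"
  proof -
    let ?w = "True # True # replicate (n - 2) False"
    have z: "count_list (replicate m False) True = 0" for m by (induction m) auto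
    have "?w \<in> pverts (demicube_graph n)" using that by (simp add: demicube_graph_def graph_on_def z)
    moreover have "replicate n False \<noteq> ?w" using that by (cases n) auto
    ultimately show ?thesis using demicube_local(1)[of n] by blast
  qed
  show "\<exists>u v. u \<in> pverts schlaefli_graph \<and> v \<in> pverts schlaefli_graph \<and> u \<noteq> v"
    by (intro exI[of _ "LineA 0"] exI[of _ "LineA 1"]) (simp add: verts_schlaefli)
  show "\<exists>u v. u \<in> gosset_verts \<and> v \<in> gosset_verts \<and> u \<noteq> v"
    by (intro exI[of _ "(True, {0, 1})"] exI[of _ "(False, {0, 1})"]) (simp add: mem_gosset)
qed

lemma (in connected_graph) ex_arc:
  assumes "iso_on V A W B" "u \<in> W" "v \<in> W" "u \<noteq> v"
  shows "parcs G \<noteq> {}"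
proof
  assume empty: "parcs G = {}"
  obtain \<phi> where \<phi>: "bij_betw \<phi> V W" using assms(1) unfolding iso_on_def by blast
  obtain x y where xy: "x \<in> V" "y \<in> V" "\<phi> x = u" "\<phi> y = v"
    using assms(2,3) bij_betw_imp_surj_on[OF \<phi>] by (metis (no_types) imageE)
  have "x = y" using constant_if_locally_constant[of "\<lambda>z. z"] xy empty by blast
  then show False using assms(4) xy by simp
qed

lemma (in connected_graph) sharp_if_iso_minuscule:
  assumes M: "minuscule (pverts H) (adjG H) E" and i: "digraph_iso (with_proj G) (with_proj H)"
    and uv: "\<exists>u v. u \<in> pverts H \<and> v \<in> pverts H \<and> u \<noteq> v"
    and reg: "parcs G \<noteq> {} \<Longrightarrow> regular_graph G k" and triangles: "\<And>x y. A x y \<Longrightarrow> card (N x \<inter> N y) = a"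
  shows "lichnerowicz_sharp G"
proof -
  have wf: "pair_wf_digraph G" by unfold_locales
  have io: "iso_on V A (pverts H) (adjG H)" using i digraph_iso_iff[OF wf M] by blast
  then obtain \<phi> where \<phi>: "bij_betw \<phi> V (pverts H)" "\<forall>x\<in>V. \<forall>y\<in>V. A x y \<longleftrightarrow> adjG H (\<phi> x) (\<phi> y)"
    unfolding iso_on_def by blast
  have m: "minuscule V A (\<lambda>x y. E (\<phi> x) (\<phi> y))"
    by (rule minuscule_iso[OF M \<phi>(1)]) (use \<phi>(2) adjV in blast)
  have ne: "parcs G \<noteq> {}" using ex_arc[OF io] uv by blast
  show ?thesis by (rule regular_graph.sharp_if_minuscule[OF reg[OF ne] m triangles ne])
qed

theorem theorem1p3:
  fixes G :: "'a pair_pre_digraph"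
  assumes "pair_graph G"
    and "Digraph_Component.connected (with_proj G)"
    and "distance_regular G"
  shows "lichnerowicz_sharp G \<longleftrightarrow>
      (\<exists>n\<ge>2. digraph_iso (with_proj G) (with_proj (cocktail_party_graph n))) \<or>
      (\<exists>d n. d \<ge> 1 \<and> n \<ge> 2 \<and> digraph_iso (with_proj G) (with_proj (hamming_graph d n))) \<or>
      (\<exists>n k. 1 \<le> k \<and> k \<le> n - 1 \<and> digraph_iso (with_proj G) (with_proj (johnson_graph n k))) \<or>
      (\<exists>n\<ge>2. digraph_iso (with_proj G) (with_proj (demicube_graph n))) \<or>
      digraph_iso (with_proj G) (with_proj schlaefli_graph) \<or>
      digraph_iso (with_proj G) (with_proj gosset_graph)"
    (is "?L \<longleftrightarrow> ?cp \<or> ?ham \<or> ?john \<or> ?demi \<or> ?schl \<or> ?goss")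
proof -
  interpret connected_graph G using assms(1,2) by (simp add: connected_graph_def connected_graph_axioms_def)
  have wf: "pair_wf_digraph G" by unfold_locales
  note iso = digraph_iso_iff[OF wf]
  obtain c a b where "intersection_numbers G c a b" using assms(3) unfolding distance_regular_def by blast
  then have inum: "card {z \<in> N y. dd x z + 1 = dd x y} = c (dd x y) \<and> card {z \<in> N y. dd x z = dd x y} = a (dd x y) \<and>
      card {z \<in> N y. dd x z = dd x y + 1} = b (dd x y)" if "x \<in> V" "y \<in> V" for x y
  proof -
    have "finite {gdist G x y |x y. x \<in> V \<and> y \<in> V}" by (rule finite_image_set2) (simp_all add: pair_finite_verts)
    then have "dd x y \<le> gdiameter G" unfolding gdiameter_def using that by (intro Max_ge) auto
    then show ?thesis using \<open>intersection_numbers G c a b\<close> that unfolding intersection_numbers_def by blast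
  qed
  have triangles: "card (N x \<inter> N y) = a 1" if xy: "A x y" for x y
  proof -
    have V: "x \<in> V" "y \<in> V" using adjV[OF xy] by auto
    have "{z \<in> N y. dd x z = dd x y} = N x \<inter> N y"
      using dd_adj[OF xy] dd_1[OF V(1)] adjV(2)[of y] by (auto simp: mem_N)
    then show ?thesis using inum[OF V] dd_adj[OF xy] by simp
  qed
  have deg: "deg G x = b 0" if "x \<in> V" for x
  proof -
    have "{z \<in> N x. dd x z = dd x x + 1} = N x"
      using dd_adj dd_self[OF that] by (auto simp: mem_N)
    then show ?thesis using inum[OF that that] dd_self[OF that] by (simp add: deg_def)
  qed
  have b0: "b 0 > 0" if ne: "parcs G \<noteq> {}"
  proof -
    obtain x y where xy: "A x y" using ne by auto
    then have "N x \<noteq> {}" by (auto simp: mem_N)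
    then have "deg G x > 0" unfolding deg_def using finite_N by (simp add: card_gt_0_iff)
    then show ?thesis using deg adjV(1)[OF xy] by simp
  qed
  have reg: "regular_graph G (b 0)" if "parcs G \<noteq> {}"
    by unfold_locales (use deg b0[OF that] in auto)
  note sharp_of = sharp_if_iso_minuscule[OF _ _ _ reg triangles]
  show ?thesis
  proof
    assume sharp: ?L
    then have ne: "parcs G \<noteq> {}" by (simp add: lichnerowicz_sharp_def)
    interpret regular_graph G "b 0" by (rule reg[OF ne])
    \<comment> \<open>Entries off the three diagonals are zero: along an arc the distance from x
      changes by at most one.\<close>
    define n where "n j i = (if i + 1 = j then c j else if i = j then a j else if i = j + 1 then b j else 0)" for i j
    interpret distance_regular_graph G "b 0" n
    proof unfold_locales
      fix x z i assume xz: "x \<in> V" "z \<in> V"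
      have near: "dd x y + 1 = dd x z \<or> dd x y = dd x z \<or> dd x y = dd x z + 1" if "y \<in> N z" for y
        using dd_step[of z y x] dd_step[of y z x] that xz adj_sym[of z y] by (auto simp: mem_N)
      consider "i + 1 = dd x z" | "i = dd x z" | "i = dd x z + 1" | "i + 1 \<noteq> dd x z" "i \<noteq> dd x z" "i \<noteq> dd x z + 1" by blast
      then show "card {y \<in> N z. dd x y = i} = n (dd x z) i"
      proof cases
        case 1
        then have "{y \<in> N z. dd x y = i} = {y \<in> N z. dd x y + 1 = dd x z}" by auto
        then show ?thesis using inum[OF xz] 1 by (simp add: n_def)
      next
        case 2 then show ?thesis using inum[OF xz] by (simp add: n_def)
      next
        case 3 then show ?thesis using inum[OF xz] by (simp add: n_def)
      next
        case 4
        then have "{y \<in> N z. dd x y = i} = {}" using near by auto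
        then have "card {y \<in> N z. dd x y = i} = 0" by (simp only: card.empty)
        then show ?thesis using 4 by (simp add: n_def)
      qed
    qed
    obtain D where D: "minuscule V A D" using minuscule_if_sharp[OF sharp] by blast
    interpret D: minuscule V A D by (rule D)
    have mu: "mu_on A (c 2)"
      unfolding mu_on_def
    proof (intro allI impI)
      fix x y z assume as: "A x y" "A x z" "y \<noteq> z" "\<not> A y z"
      have V: "y \<in> V" "z \<in> V" using as adjV by auto
      have d: "dd y z = 2" using dd_two[OF adj_sym[OF as(1)] as(2)] as by blast
      have "{t \<in> N z. dd y t + 1 = dd y z} = {t. A y t \<and> A z t}"
        using dd_1[OF V(1)] adjV(2)[of z] d by (auto simp: mem_N)
      then show "card {t. A y t \<and> A z t} = c 2" using inum[OF V] d by simp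
    qed
    show "?cp \<or> ?ham \<or> ?john \<or> ?demi \<or> ?schl \<or> ?goss"
    proof (cases "complete_on V A \<or> c 2 = 2")
      \<comment> \<open>Both cases have disjoint unions of cliques as neighbourhoods; a complete
        graph is a Hamming graph with d = 1.\<close>
      case True
      obtain x y where xy: "A x y" using ne by auto
      have "\<exists>d\<ge>1. iso_on V A (pverts (hamming_graph d (a 1 + 2))) (adjG (hamming_graph d (a 1 + 2)))"
      proof (rule hamming_recognition[OF D adjV(1)[OF xy]])
        show "nb A x \<noteq> {}" using xy by (auto simp: nb_def)
        show "card {t. A x t \<and> A y t} = a 1" if "A x y" for y
        proof -
          have "{t. A x t \<and> A y t} = N x \<inter> N y" by (auto simp: mem_N)
          then show ?thesis using triangles[OF that] by simp
        qed
        \<comment> \<open>Otherwise q would be a third common neighbour of p and r, besides x and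
          the corner opposite to x, against \<open>c 2 = 2\<close>.\<close>
        show "A p r" if as: "A x p" "A x q" "A x r" "A p q" "A q r" "p \<noteq> r" for p q r
        proof (rule ccontr)
          assume n: "\<not> A p r"
          then have "\<not> complete_on V A" using as adjV unfolding complete_on_def by blast
          then have c2: "c 2 = 2" using True by blast
          have "card {t. A p t \<and> A r t} = c 2"
            using mu[unfolded mu_on_def, rule_format, OF as(1,3,6) n] .
          then have "card {t. A p t \<and> A r t} = 2" using c2 by simp
          then have "card {t. A x t \<and> A p t \<and> A r t} = 0" using D.card_common_neighbours[OF as(1,3,6) n] by simp
          moreover have "finite {t. A x t \<and> A p t \<and> A r t}"
            by (rule finite_subset[OF _ finite_N[of x]]) (auto simp: mem_N)
          ultimately show False using as adj_sym by auto
        qed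
      qed
      then obtain d where "d \<ge> 1" "iso_on V A (pverts (hamming_graph d (a 1 + 2))) (adjG (hamming_graph d (a 1 + 2)))"
        by blast
      then have "d \<ge> 1 \<and> a 1 + 2 \<ge> 2 \<and> digraph_iso (with_proj G) (with_proj (hamming_graph d (a 1 + 2)))"
        using iso[OF minuscule_hamming] by simp
      then show ?thesis by blast
    next
      case False
      then have nc: "\<not> complete_on V A" and c2: "c 2 \<noteq> 2" by blast+
      from minuscule_classification[OF D nc mu] c2
      consider n k where "2 \<le> k" "2 * k \<le> n" "iso_on V A (pverts (johnson_graph n k)) (adjG (johnson_graph n k))"
        | n where "4 \<le> n" "iso_on V A (pverts (demicube_graph n)) (adjG (demicube_graph n))"
        | n where "2 \<le> n" "iso_on V A (pverts (cocktail_party_graph n)) (adjG (cocktail_party_graph n))"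
        | "iso_on V A (pverts schlaefli_graph) (adjG schlaefli_graph)"
        | "iso_on V A gosset_verts (adjG gosset_graph)"
        by blast
      then show ?thesis
      proof cases
        case 1
        then have "1 \<le> k \<and> k \<le> n - 1 \<and> digraph_iso (with_proj G) (with_proj (johnson_graph n k))"
          using iso[OF minuscule_johnson] by auto
        then show ?thesis by blast
      next
        case 2
        then have "2 \<le> n \<and> digraph_iso (with_proj G) (with_proj (demicube_graph n))"
          using iso[OF minuscule_demicube] by auto
        then show ?thesis by blast
      next
        case 3
        then show ?thesis using iso[OF minuscule_cocktail_party] by blast
      next
        case 4
        then show ?thesis using iso[OF minuscule_schlaefli] by blast
      next
        case 5
        then show ?thesis using iso[OF minuscule_gosset] by blast
      qed
    qed
  next
    assume "?cp \<or> ?ham \<or> ?john \<or> ?demi \<or> ?schl \<or> ?goss"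
    then consider n where "n \<ge> 2" "digraph_iso (with_proj G) (with_proj (cocktail_party_graph n))"
      | d n where "d \<ge> 1" "n \<ge> 2" "digraph_iso (with_proj G) (with_proj (hamming_graph d n))"
      | n k where "1 \<le> k" "k \<le> n - 1" "digraph_iso (with_proj G) (with_proj (johnson_graph n k))"
      | n where "n \<ge> 2" "digraph_iso (with_proj G) (with_proj (demicube_graph n))"
      | "digraph_iso (with_proj G) (with_proj schlaefli_graph)"
      | "digraph_iso (with_proj G) (with_proj gosset_graph)" by blast
    then show ?L
    proof cases
      case 1
      then show ?thesis
        using sharp_of[OF minuscule_cocktail_party] distinct_vertices(1) by blast
    next
      case 2
      then show ?thesis using sharp_of[OF minuscule_hamming] distinct_vertices(2) by blast
    next
      case 3
      then show ?thesis using sharp_of[OF minuscule_johnson] distinct_vertices(3) by blast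
    next
      case 4
      then show ?thesis using sharp_of[OF minuscule_demicube] distinct_vertices(4) by blast
    next
      case 5
      then show ?thesis using sharp_of[OF minuscule_schlaefli] distinct_vertices(5) by blast
    next
      case 6
      then show ?thesis using sharp_of[OF minuscule_gosset] distinct_vertices(6) by blast
    qed
  qed
qed

end
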